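(* Let $G=\mathbb{F}_2\times\mathbb{Z}$ act geometrically on two proper CAT(0) spaces $X$ and $Y$. If there is a limset map $\partial X\to\partial Y$, then that limset map is a homeomorphism.
   Context: $\mathbb{F}_2$ is the free group of rank 2. A group acts geometrically if it acts properly discontinuously and cocompactly by isometries. $\partial X$ is the visual boundary of the proper CAT(0) space $X$ with the cone topology, and $\overline X=X\cup\partial X$. If $G$ acts geometrically on $X$ with base point $x_0$, then $G\cup\partial X$ is a compactification of the discrete space $G$, with basis of open sets the singletons $\{g\}$, $g\in G$, and the sets $\{g\in G: gx_0\in U\}\cup(U\cap\partial X)$ for $U$ open in $\overline X$. If $G$ acts geometrically on $X$ and $Y$, a limset map $\partial X\to\partial Y$ is the restriction to $\partial X$ of a continuous map $G\cup\partial X\to G\cup\partial Y$ extending the identity of $G$ (and taking $\partial X$ into $\partial Y$). *)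

theory Defs
  imports
    "HOL-Analysis.Analysis"
    "HOL-Algebra.Elementary_Groups"
    "HOL-Algebra.Group_Action"
begin

section \<open>Free groups\<close>

text \<open>
  A letter \<open>(a, True)\<close> stands for the generator \<open>a\<close>, and \<open>(a, False)\<close> for its inverse.
  Elements of the free group are the reduced words; \<open>foldr push u v\<close> is the reduced form of
  the concatenation of \<open>u\<close> with the reduced word \<open>v\<close>.
\<close>

definition inv_letter :: "'a \<times> bool \<Rightarrow> 'a \<times> bool" where
  "inv_letter l = (fst l, \<not> snd l)"

definition reduced_word :: "('a \<times> bool) list \<Rightarrow> bool" where
  "reduced_word w \<longleftrightarrow> successively (\<lambda>k l. l \<noteq> inv_letter k) w"

fun push :: "'a \<times> bool \<Rightarrow> ('a \<times> bool) list \<Rightarrow> ('a \<times> bool) list" where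
  "push k [] = [k]"
| "push k (l # w) = (if l = inv_letter k then w else k # l # w)"

definition free_group :: "'a set \<Rightarrow> ('a \<times> bool) list monoid" where
  "free_group S =
     \<lparr>carrier = {w. set w \<subseteq> S \<times> UNIV \<and> reduced_word w},
      mult = (\<lambda>u v. foldr push u v),
      one = []\<rparr>"

abbreviation F2 :: "(nat \<times> bool) list monoid" where
  "F2 \<equiv> free_group {0, 1}"

lemma inv_letter_inv_letter [simp]: "inv_letter (inv_letter k) = k"
  by (simp add: inv_letter_def)

lemma inv_letter_neq [simp]: "inv_letter k \<noteq> k" "k \<noteq> inv_letter k"
  by (auto simp: inv_letter_def prod_eq_iff)

lemma reduced_word_Nil [simp]: "reduced_word []"
  by (simp add: reduced_word_def)

lemma reduced_word_Cons:
  "reduced_word (k # w) \<longleftrightarrow> reduced_word w \<and> (w = [] \<or> hd w \<noteq> inv_letter k)"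
  by (cases w) (auto simp: reduced_word_def)

lemma reduced_push: "reduced_word w \<Longrightarrow> reduced_word (push k w)"
  by (cases w) (auto simp: reduced_word_Cons)

lemma reduced_foldr_push: "reduced_word w \<Longrightarrow> reduced_word (foldr push u w)"
  by (induction u) (auto intro: reduced_push)

lemma push_push_inv: "reduced_word w \<Longrightarrow> push k (push (inv_letter k) w) = w"
  by (cases w rule: list.exhaust[case_names Nil Cons]; cases "tl w")
     (auto simp: reduced_word_Cons)

lemma push_eq_Cons: "reduced_word (k # w) \<Longrightarrow> push k w = k # w"
  by (cases w) (auto simp: reduced_word_Cons)

lemma foldr_push_Nil: "reduced_word w \<Longrightarrow> foldr push w [] = w"
proof (induction w)
  case (Cons k w)
  then have "foldr push w [] = w"
    by (simp add: reduced_word_Cons)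
  then show ?case
    using push_eq_Cons[OF Cons.prems] by simp
qed simp

lemma foldr_push_push:
  assumes "reduced_word w"
  shows "foldr push (push k v) w = push k (foldr push v w)"
proof (cases v)
  case (Cons l v')
  then show ?thesis
    using push_push_inv[OF reduced_foldr_push[OF assms], of k v'] by auto
qed simp

lemma foldr_push_assoc:
  "reduced_word w \<Longrightarrow> foldr push (foldr push u v) w = foldr push u (foldr push v w)"
  by (induction u) (auto simp: foldr_push_push)

lemma set_foldr_push: "set (foldr push u v) \<subseteq> set u \<union> set v"
proof (induction u)
  case (Cons k u)
  have "set (push k w) \<subseteq> insert k (set w)" for w
    by (cases w) auto
  then show ?case
    using Cons by fastforce
qed simp

lemma foldr_push_inverse:
  assumes "reduced_word w"
  shows "foldr push (foldr push (rev (map inv_letter u)) []) (foldr push u w) = w"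
proof -
  have "foldr push (rev (map inv_letter u)) (foldr push u w) = w" if "reduced_word w" for w
    using that
  proof (induction u arbitrary: w)
    case (Cons k u)
    have "push (inv_letter k) (push k (foldr push u w)) = foldr push u w"
      using push_push_inv[OF reduced_foldr_push[OF Cons.prems], of "inv_letter k" u] by simp
    then show ?case
      using Cons by simp
  qed simp
  then show ?thesis
    using assms by (simp add: foldr_push_assoc reduced_foldr_push)
qed

lemma group_free_group: "group (free_group S)"
proof (rule groupI)
  fix u v w
  assume u: "u \<in> carrier (free_group S)" and v: "v \<in> carrier (free_group S)"
    and w: "w \<in> carrier (free_group S)"
  show "u \<otimes>\<^bsub>free_group S\<^esub> v \<in> carrier (free_group S)"
    using u v set_foldr_push[of u v] by (fastforce simp: free_group_def reduced_foldr_push)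
  show "u \<otimes>\<^bsub>free_group S\<^esub> v \<otimes>\<^bsub>free_group S\<^esub> w
      = u \<otimes>\<^bsub>free_group S\<^esub> (v \<otimes>\<^bsub>free_group S\<^esub> w)"
    using w by (simp add: free_group_def foldr_push_assoc)
next
  fix u assume u: "u \<in> carrier (free_group S)"
  show "\<one>\<^bsub>free_group S\<^esub> \<otimes>\<^bsub>free_group S\<^esub> u = u"
    by (simp add: free_group_def)
  let ?v = "foldr push (rev (map inv_letter u)) []"
  have "set ?v \<subseteq> inv_letter ` set u"
    using set_foldr_push[of "rev (map inv_letter u)" "[]"] by auto
  also have "\<dots> \<subseteq> S \<times> UNIV"
    using u by (auto simp: free_group_def inv_letter_def)
  finally have "?v \<in> carrier (free_group S)"
    by (simp add: free_group_def reduced_foldr_push)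
  moreover have "?v \<otimes>\<^bsub>free_group S\<^esub> u = \<one>\<^bsub>free_group S\<^esub>"
    using u foldr_push_inverse[of "[]" u] by (simp add: free_group_def foldr_push_Nil)
  ultimately show "\<exists>v\<in>carrier (free_group S). v \<otimes>\<^bsub>free_group S\<^esub> u = \<one>\<^bsub>free_group S\<^esub>"
    by blast
qed (simp add: free_group_def)


section \<open>Proper CAT(0) spaces\<close>

text \<open>
  A metric space is given as a set \<open>X\<close> in a type of class \<^class>\<open>metric_space\<close>, with the induced
  metric. Every metric space is of this form, with \<open>X = UNIV\<close>. The type is a mere container:
  all notions below refer to points and paths of \<open>X\<close> only.
\<close>

definition geodesic_path :: "'a::metric_space set \<Rightarrow> 'a \<Rightarrow> 'a \<Rightarrow> (real \<Rightarrow> 'a) \<Rightarrow> bool" where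
  "geodesic_path X x y c \<longleftrightarrow>
     c ` {0..dist x y} \<subseteq> X \<and> c 0 = x \<and> c (dist x y) = y \<and>
     (\<forall>s\<in>{0..dist x y}. \<forall>t\<in>{0..dist x y}. dist (c s) (c t) = \<bar>s - t\<bar>)"

definition geodesic_space :: "'a::metric_space set \<Rightarrow> bool" where
  "geodesic_space X \<longleftrightarrow> (\<forall>x\<in>X. \<forall>y\<in>X. \<exists>c. geodesic_path X x y c)"

text \<open>
  In the CAT(0) inequality, \<open>p'\<close>, \<open>q'\<close>, \<open>r'\<close> is a comparison triangle in the Euclidean plane, and
  \<open>x'\<close>, \<open>y'\<close> are the comparison points of \<open>x\<close> and \<open>y\<close>. Any two different sides of a triangle share
  a vertex, which is called \<open>p\<close> here; for two points on one side the inequality is trivial.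
\<close>

definition CAT0_space :: "'a::metric_space set \<Rightarrow> bool" where
  "CAT0_space X \<longleftrightarrow>
     geodesic_space X \<and>
     (\<forall>p\<in>X. \<forall>q\<in>X. \<forall>r\<in>X. \<forall>c1 c2. \<forall>p' q' r' :: real^2.
        geodesic_path X p q c1 \<longrightarrow> geodesic_path X p r c2 \<longrightarrow>
        dist p' q' = dist p q \<longrightarrow> dist q' r' = dist q r \<longrightarrow> dist p' r' = dist p r \<longrightarrow>
        (\<forall>x \<in> c1 ` {0..dist p q}. \<forall>y \<in> c2 ` {0..dist p r}.
         \<forall>x' \<in> closed_segment p' q'. \<forall>y' \<in> closed_segment p' r'.
           dist p' x' = dist p x \<longrightarrow> dist p' y' = dist p y \<longrightarrow> dist x y \<le> dist x' y'))"

definition proper_space :: "'a::metric_space set \<Rightarrow> bool" where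
  "proper_space X \<longleftrightarrow> (\<forall>x\<in>X. \<forall>r. compact (cball x r \<inter> X))"


section \<open>The visual boundary and the cone topology\<close>

text \<open>Rays are functions on \<^typ>\<open>real\<close>, but their values at negative arguments are irrelevant.\<close>

definition geodesic_ray :: "'a::metric_space set \<Rightarrow> (real \<Rightarrow> 'a) \<Rightarrow> bool" where
  "geodesic_ray X c \<longleftrightarrow>
     c ` {0..} \<subseteq> X \<and> (\<forall>s\<ge>0. \<forall>t\<ge>0. dist (c s) (c t) = \<bar>s - t\<bar>)"

definition asymptotic_rel :: "'a::metric_space set \<Rightarrow> (real \<Rightarrow> 'a) rel" where
  "asymptotic_rel X =
     {(c, c'). geodesic_ray X c \<and> geodesic_ray X c' \<and> (\<exists>K. \<forall>t\<ge>0. dist (c t) (c' t) \<le> K)}"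

definition visual_boundary :: "'a::metric_space set \<Rightarrow> (real \<Rightarrow> 'a) set set" where
  "visual_boundary X = {c. geodesic_ray X c} // asymptotic_rel X"

text \<open>
  The space \<open>X \<union> \<partial>X\<close> is the disjoint sum \<open>X <+> visual_boundary X\<close>. The set \<open>cone_nbhd X c r e\<close>
  is \<open>{z. d z (c 0) > r \<and> d (p z) (c r) < e}\<close>, where \<open>p z\<close> is the point at distance \<open>r\<close> from
  \<open>c 0\<close> on the geodesic, or the ray, from \<open>c 0\<close> to \<open>z\<close>, and points at infinity have infinite
  distance from \<open>c 0\<close>.
\<close>

definition cone_nbhd ::
    "'a::metric_space set \<Rightarrow> (real \<Rightarrow> 'a) \<Rightarrow> real \<Rightarrow> real \<Rightarrow> ('a + (real \<Rightarrow> 'a) set) set" where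
  "cone_nbhd X c r e =
     Inl ` {x \<in> X. dist x (c 0) > r \<and>
              (\<exists>\<gamma>. geodesic_path X (c 0) x \<gamma> \<and> dist (\<gamma> r) (c r) < e)} \<union>
     Inr ` {\<xi> \<in> visual_boundary X. \<exists>\<gamma>\<in>\<xi>. \<gamma> 0 = c 0 \<and> dist (\<gamma> r) (c r) < e}"

text \<open>
  The generating sets are a basis of the topology. For a complete CAT(0) space the topology does
  not depend on the base point \<open>x0\<close>.
\<close>

definition cone_topology :: "'a::metric_space set \<Rightarrow> 'a \<Rightarrow> ('a + (real \<Rightarrow> 'a) set) topology" where
  "cone_topology X x0 = topology_generated_by
     ({Inl ` (ball x r \<inter> X) | x r. x \<in> X \<and> r > 0} \<union>
      {cone_nbhd X c r e | c r e. geodesic_ray X c \<and> c 0 = x0 \<and> r > 0 \<and> e > 0})"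

definition boundary_topology :: "'a::metric_space set \<Rightarrow> 'a \<Rightarrow> (real \<Rightarrow> 'a) set topology" where
  "boundary_topology X x0 = pullback_topology (visual_boundary X) Inr (cone_topology X x0)"


section \<open>Geometric actions and limset maps\<close>

definition geometric_action ::
    "('g, 'm) monoid_scheme \<Rightarrow> 'a::metric_space set \<Rightarrow> ('g \<Rightarrow> 'a \<Rightarrow> 'a) \<Rightarrow> bool" where
  "geometric_action G X \<phi> \<longleftrightarrow>
     group_action G X \<phi> \<and>
     (\<forall>g\<in>carrier G. \<forall>x\<in>X. \<forall>y\<in>X. dist (\<phi> g x) (\<phi> g y) = dist x y) \<and>
     (\<forall>K. K \<subseteq> X \<longrightarrow> compact K \<longrightarrow> finite {g \<in> carrier G. \<phi> g ` K \<inter> K \<noteq> {}}) \<and>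
     (\<exists>K. K \<subseteq> X \<and> compact K \<and> (\<Union>g\<in>carrier G. \<phi> g ` K) = X)"

definition compactification ::
    "('g, 'm) monoid_scheme \<Rightarrow> 'a::metric_space set \<Rightarrow> ('g \<Rightarrow> 'a \<Rightarrow> 'a) \<Rightarrow> 'a
     \<Rightarrow> ('g + (real \<Rightarrow> 'a) set) topology" where
  "compactification G X \<phi> x0 = topology_generated_by
     ({{Inl g} | g. g \<in> carrier G} \<union>
      {Inl ` {g \<in> carrier G. Inl (\<phi> g x0) \<in> U} \<union> Inr ` {\<xi> \<in> visual_boundary X. Inr \<xi> \<in> U}
        | U. openin (cone_topology X x0) U})"

definition limset_map ::
    "('g, 'm) monoid_scheme \<Rightarrow>
     'a::metric_space set \<Rightarrow> ('g \<Rightarrow> 'a \<Rightarrow> 'a) \<Rightarrow> 'a \<Rightarrow>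
     'b::metric_space set \<Rightarrow> ('g \<Rightarrow> 'b \<Rightarrow> 'b) \<Rightarrow> 'b \<Rightarrow>
     ((real \<Rightarrow> 'a) set \<Rightarrow> (real \<Rightarrow> 'b) set) \<Rightarrow> bool" where
  "limset_map G X \<phi> x0 Y \<psi> y0 f \<longleftrightarrow>
     f \<in> visual_boundary X \<rightarrow> visual_boundary Y \<and>
     (\<exists>F. continuous_map (compactification G X \<phi> x0) (compactification G Y \<psi> y0) F \<and>
          (\<forall>g\<in>carrier G. F (Inl g) = Inl g) \<and>
          (\<forall>\<xi>\<in>visual_boundary X. F (Inr \<xi>) = Inr (f \<xi>)))"

end

theory Submission
  imports Defs "HOL-Library.Sublist"
begin

text \<open>
  The boundaries are compact and Hausdorff and \<open>f\<close> is continuous, so it is enough that \<open>f\<close> is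
  bijective. Surjectivity follows from compactness, since every boundary point of \<open>Y\<close> is a limit of
  group elements.

  For injectivity let \<open>z\<close> generate the centre. A Busemann function \<open>b\<close> of the limit of \<open>z\<^sup>n x0\<close> is
  affine along geodesics up to a bounded error. A ray is polar if \<open>\<bar>b\<bar>\<close> grows with slope 1 along it;
  there are exactly two such directions, the limits of \<open>z\<^sup>n\<close> and \<open>z\<^sup>-\<^sup>n\<close>, and \<open>f\<close> preserves both these
  and their complement. A nonpolar ray passes close to \<open>v z\<^sup>n x0\<close> for every prefix \<open>v\<close> of an infinite
  reduced word (\<open>v z\<^sup>n x0\<close> with \<open>n\<close> ranging over the integers is the fibre of \<open>v\<close>), and \<open>f\<close>
  preserves that word because the fibres separate the space coarsely. Finally, two
  nonpolar points with the same word and the same image are limits of \<open>v z\<^sup>n\<close> and \<open>v z\<^sup>m\<close> such that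
  \<open>n\<close> and \<open>m\<close> give the same slope \<open>b / d\<close> in \<open>Y\<close>; hence \<open>n - m\<close> is sublinear in the length of
  \<open>v\<close>, and the two points agree already in \<open>X\<close>.
\<close>

section \<open>Geodesics in CAT(0) spaces\<close>

text \<open>The orbit map taking \<open>\<phi> g x0\<close> to \<open>\<psi> g y0\<close> is a
  quasi-isometry, but such maps need not extend to the boundaries of CAT(0) spaces, and they may
  distort the slope of a geodesic against the centre. Metric comparison is therefore combined with
  what \<open>f\<close> provides: geodesics to orbit points that follow a ray of \<open>X\<close>
  converge in \<open>Y\<close>, but only at each fixed radius \<open>r\<close>. Heights bridge the
  gap to infinity: since \<open>b\<close> is affine up to \<open>C\<close> along a geodesic from the
  base point, its value at radius \<open>r\<close> gives the slope \<open>b / d\<close> at the far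
  end up to an error of order \<open>1 / r\<close>. Two points of one fibre differ by a power
  \<open>z\<^sup>m\<close>, which changes the heights in \<open>X\<close> and \<open>Y\<close> by
  exactly \<open>m * l\<close> and \<open>m * l'\<close>; this makes the comparison independent of
  the distortion. Slopes must stay away from 1: near slope 1 height and distance grow together, so a
  shift along the fibre hardly changes the slope.\<close>

lemma comparison_triangle:
  fixes a b c :: real
  assumes "0 \<le> a" "0 \<le> b" "0 \<le> c" "a \<le> b + c" "b \<le> a + c" "c \<le> a + b"
  obtains p q r :: "real^2" where "dist p q = a" "dist q r = b" "dist p r = c"
proof (cases "a = 0")
  case True
  then have "b = c" using assms by simp
  show thesis
    by (rule that[of 0 0 "vector [c, 0]"])
      (use True \<open>b = c\<close> assms in \<open>simp_all add: dist_norm norm_vec_def L2_set_def sum_2\<close>)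
next
  case False
  then have a: "a > 0" using assms by simp
  \<comment> \<open>Law of cosines: \<open>u\<close> is the coordinate of \<open>r\<close> along the
    side from \<open>p\<close> to \<open>q\<close>. The triangle inequalities amount to
    \<open>\<bar>u\<bar> \<le> c\<close>, so the other coordinate is a real square root.\<close>
  define u where "u = (a\<^sup>2 + c\<^sup>2 - b\<^sup>2) / (2 * a)"
  have "(a - c)\<^sup>2 \<le> b\<^sup>2" "b\<^sup>2 \<le> (a + c)\<^sup>2"
    using assms by (auto simp: abs_le_square_iff[symmetric])
  then have "\<bar>u\<bar> \<le> c"
    using a by (simp add: u_def abs_le_iff field_simps power2_eq_square)
  then have uc: "u\<^sup>2 \<le> c\<^sup>2"
    using assms by (simp add: abs_le_square_iff[symmetric])
  have au: "2 * a * u = a\<^sup>2 + c\<^sup>2 - b\<^sup>2"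
    using a by (simp add: u_def)
  have "(a - u)\<^sup>2 + (sqrt (c\<^sup>2 - u\<^sup>2))\<^sup>2 = b\<^sup>2"
    using uc au by (simp add: power2_diff)
  then show thesis
    by (intro that[of 0 "vector [a, 0]" "vector [u, sqrt (c\<^sup>2 - u\<^sup>2)]"])
      (use assms uc in \<open>simp_all add: dist_norm norm_vec_def L2_set_def sum_2\<close>)
qed

lemma stewart_inner:
  fixes p q r :: "'a::real_inner"
  shows "(dist r (p + l *\<^sub>R (q - p)))\<^sup>2
       = (1 - l) * (dist r p)\<^sup>2 + l * (dist r q)\<^sup>2 - l * (1 - l) * (dist p q)\<^sup>2"
  unfolding dist_norm power2_norm_eq_inner
  by (simp add: algebra_simps inner_commute power2_eq_square)

text \<open>The comparison axiom is applied with the opposite vertex \<open>p\<close> as one of the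
  two points, and Stewart's theorem evaluates the planar side. All later metric estimates go through
  this inequality; the factor \<open>dist x y\<close> lets it cover degenerate triangles.\<close>

lemma cat0_stewart:
  assumes X: "CAT0_space X" and c: "geodesic_path X x y c" and xyp: "x \<in> X" "y \<in> X" "p \<in> X"
    and t: "0 \<le> t" "t \<le> dist x y"
  shows "dist x y * (dist p (c t))\<^sup>2
     \<le> (dist x y - t) * (dist p x)\<^sup>2 + t * (dist p y)\<^sup>2 - t * (dist x y - t) * dist x y"
proof (cases "dist x y = 0")
  case False
  let ?d = "dist x y"
  have d: "?d > 0" using False by simp
  obtain c2 where c2: "geodesic_path X x p c2"
    using X xyp unfolding CAT0_space_def geodesic_space_def by blast
  obtain p' q' r' :: "real^2" where tri:
    "dist p' q' = dist x y" "dist q' r' = dist y p" "dist p' r' = dist x p"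
    by (rule comparison_triangle[of "dist x y" "dist y p" "dist x p"])
      (use dist_triangle[of x y p] dist_triangle[of y p x] dist_triangle[of x p y] in
        \<open>auto simp: dist_commute\<close>)
  define l where "l = t / ?d"
  have l: "0 \<le> l" "l \<le> 1" "l * ?d = t" using t d by (auto simp: l_def)
  define m where "m = p' + l *\<^sub>R (q' - p')"
  have m: "m \<in> closed_segment p' q'"
    unfolding closed_segment_def m_def using l
    by (intro CollectI exI[of _ l]) (auto simp: algebra_simps)
  have "dist p' m = l * dist p' q'"
    using l by (simp add: m_def dist_norm norm_minus_commute)
  moreover have "dist x (c t) = t"
    using c t d unfolding geodesic_path_def by (metis abs_of_nonneg atLeastAtMost_iff
      diff_0 abs_minus_cancel order_refl zero_le_dist)
  ultimately have 1: "dist p' m = dist x (c t)" using l tri by simp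
  have "c t \<in> c ` {0..?d}" using t by auto
  moreover have "p \<in> c2 ` {0..dist x p}"
    using c2 unfolding geodesic_path_def by (metis atLeastAtMost_iff imageI order_refl zero_le_dist)
  ultimately have "dist (c t) p \<le> dist m r'"
    using X c c2 xyp tri m 1 unfolding CAT0_space_def by (meson ends_in_segment(2))
  then have "(dist p (c t))\<^sup>2 \<le> (dist r' m)\<^sup>2" by (simp add: dist_commute)
  also have "\<dots> = (1 - l) * (dist p x)\<^sup>2 + l * (dist p y)\<^sup>2 - l * (1 - l) * ?d\<^sup>2"
    unfolding m_def stewart_inner using tri by (simp add: dist_commute)
  finally have "?d * (dist p (c t))\<^sup>2 \<le> ?d * ((1 - l) * (dist p x)\<^sup>2 + l * (dist p y)\<^sup>2 - l * (1 - l) * ?d\<^sup>2)"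
    using d by simp
  also have "\<dots> = (?d - l * ?d) * (dist p x)\<^sup>2 + l * ?d * (dist p y)\<^sup>2 - l * ?d * (?d - l * ?d) * ?d"
    by (simp add: algebra_simps power2_eq_square)
  finally show ?thesis using l by simp
qed (use t in auto)

text \<open>Clamping the parameter makes the path constant beyond both ends, so that it is
  1-Lipschitz on the whole real line. The choice is harmless because geodesics turn out to be
  unique.\<close>

definition gd :: "'a::metric_space set \<Rightarrow> 'a \<Rightarrow> 'a \<Rightarrow> real \<Rightarrow> 'a" where
  "gd X x y t = (SOME c. geodesic_path X x y c) (max 0 (min t (dist x y)))"

locale cat0 =
  fixes X :: "'a::metric_space set"
  assumes cat0: "CAT0_space X" and proper: "proper_space X"
begin

lemma gd_raw: assumes "x \<in> X" "y \<in> X" shows "geodesic_path X x y (SOME c. geodesic_path X x y c)"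
proof -
  have "\<exists>c. geodesic_path X x y c"
    using cat0 assms unfolding CAT0_space_def geodesic_space_def by blast
  then show ?thesis by (rule someI_ex)
qed

lemma gd_path:
  assumes "x \<in> X" "y \<in> X" shows "geodesic_path X x y (gd X x y)"
  using gd_raw[OF assms] unfolding geodesic_path_def gd_def
  by (auto simp: min_def max_def)

lemma gd_in: "x \<in> X \<Longrightarrow> y \<in> X \<Longrightarrow> gd X x y t \<in> X"
  using gd_raw[of x y] unfolding geodesic_path_def gd_def
  by (auto simp: min_def max_def)

lemma gd_0: "x \<in> X \<Longrightarrow> y \<in> X \<Longrightarrow> t \<le> 0 \<Longrightarrow> gd X x y t = x"
  using gd_raw[of x y] unfolding geodesic_path_def gd_def by (simp add: min.coboundedI1 max.absorb1)

lemma gd_end: "x \<in> X \<Longrightarrow> y \<in> X \<Longrightarrow> dist x y \<le> t \<Longrightarrow> gd X x y t = y"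
  using gd_raw[of x y] zero_le_dist[of x y] unfolding geodesic_path_def gd_def
  by (auto simp: min_def max_def)

lemma gd_dist:
  assumes "x \<in> X" "y \<in> X" "s \<in> {0..dist x y}" "t \<in> {0..dist x y}"
  shows "dist (gd X x y s) (gd X x y t) = \<bar>s - t\<bar>"
  using gd_path[OF assms(1,2)] assms unfolding geodesic_path_def by blast

lemma gd_lip:
  assumes "x \<in> X" "y \<in> X" shows "dist (gd X x y s) (gd X x y t) \<le> \<bar>s - t\<bar>"
proof -
  have "dist (gd X x y s) (gd X x y t) = \<bar>max 0 (min s (dist x y)) - max 0 (min t (dist x y))\<bar>"
    using gd_raw[OF assms] unfolding geodesic_path_def gd_def by (simp add: min_def max_def)
  also have "\<dots> \<le> \<bar>s - t\<bar>" by (auto simp: min_def max_def)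
  finally show ?thesis .
qed

lemma gd_dist_start:
  assumes "x \<in> X" "y \<in> X" "0 \<le> t" "t \<le> dist x y" shows "dist x (gd X x y t) = t"
  using gd_dist[of x y 0 t] gd_0[of x y 0] assms by simp

lemma gd_dist_end:
  assumes "x \<in> X" "y \<in> X" "0 \<le> t" "t \<le> dist x y" shows "dist (gd X x y t) y = dist x y - t"
  using gd_dist[of x y t "dist x y"] gd_end[of x y "dist x y"] assms by simp

lemma stewart:
  assumes "x \<in> X" "y \<in> X" "p \<in> X" "0 \<le> t" "t \<le> dist x y"
  shows "dist x y * (dist p (gd X x y t))\<^sup>2
     \<le> (dist x y - t) * (dist p x)\<^sup>2 + t * (dist p y)\<^sup>2 - t * (dist x y - t) * dist x y"
  using cat0_stewart[OF cat0 gd_path[OF assms(1,2)]] assms by blast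

text \<open>With these two distances the right side of Stewart's inequality vanishes. Points are
  identified as lying on a geodesic by this criterion throughout.\<close>

lemma geodesic_unique:
  assumes "x \<in> X" "y \<in> X" "p \<in> X" "dist x p = t" "dist p y = dist x y - t"
  shows "p = gd X x y t"
proof (cases "dist x y = 0")
  case True
  then have "dist p y = 0" "t = 0"
    using assms(4,5) zero_le_dist[of x p] zero_le_dist[of p y] by linarith+
  then show ?thesis using assms by (simp add: gd_0)
next
  case False
  have t: "0 \<le> t" "t \<le> dist x y"
    using assms(4,5) zero_le_dist[of x p] zero_le_dist[of p y] by linarith+
  have "dist x y * (dist p (gd X x y t))\<^sup>2 \<le> (dist x y - t) * t\<^sup>2 + t * (dist x y - t)\<^sup>2
      - t * (dist x y - t) * dist x y"
    using stewart[OF assms(1-3) t] assms(4,5) by (simp add: dist_commute)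
  also have "\<dots> = 0" by (simp add: algebra_simps power2_eq_square)
  finally have "(dist p (gd X x y t))\<^sup>2 \<le> 0"
    using False by (metis mult_le_0_iff not_less zero_le_dist order_antisym)
  then show ?thesis by simp
qed

lemma path_eq_gd:
  assumes "x \<in> X" "y \<in> X" "geodesic_path X x y c" "0 \<le> t" "t \<le> dist x y"
  shows "c t = gd X x y t"
proof (rule geodesic_unique)
  have c: "dist (c s) (c t) = \<bar>s - t\<bar>" if "0 \<le> s" "s \<le> dist x y" for s
    using assms that unfolding geodesic_path_def by auto
  show "dist x (c t) = t" using c[of 0] assms unfolding geodesic_path_def by auto
  show "dist (c t) y = dist x y - t"
    using c[of "dist x y"] assms unfolding geodesic_path_def by (auto simp: dist_commute)
  show "c t \<in> X" using assms unfolding geodesic_path_def by auto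
qed (use assms in auto)

lemma gd_commute:
  assumes "x \<in> X" "y \<in> X" "0 \<le> t" "t \<le> dist x y"
  shows "gd X x y t = gd X y x (dist x y - t)"
  by (rule geodesic_unique)
    (use assms gd_dist_start[OF assms] gd_dist_end[OF assms] gd_in in \<open>auto simp: dist_commute\<close>)

lemma gd_gd:
  assumes "x \<in> X" "y \<in> X" "s \<le> t" "t \<le> dist x y"
  shows "gd X x (gd X x y t) s = gd X x y s"
proof (cases "s \<ge> 0")
  case True
  have *: "dist x (gd X x y t) = t" using assms True by (simp add: gd_dist_start)
  show ?thesis
    by (rule geodesic_unique[symmetric])
      (use assms True * in \<open>simp_all add: gd_in gd_dist_start gd_dist\<close>)
qed (use assms in \<open>simp add: gd_0 gd_in\<close>)

text \<open>Stewart's inequality twice: for \<open>n\<close> against the side \<open>[p, x]\<close>,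
  then for \<open>x\<close> against \<open>[p, y]\<close>. The terms in \<open>a\<close> and
  \<open>b\<close> cancel and leave \<open>(l * d)\<^sup>2\<close>.\<close>

lemma gd_scale:
  assumes X: "p \<in> X" "x \<in> X" "y \<in> X" and l: "0 \<le> l" "l \<le> 1"
  shows "dist (gd X p x (l * dist p x)) (gd X p y (l * dist p y)) \<le> l * dist x y"
proof -
  define a b d where "a = dist p x" "b = dist p y" "d = dist x y"
  define m n where "m = gd X p x (l * a)" "n = gd X p y (l * b)"
  have la: "0 \<le> l * a" "l * a \<le> a" "0 \<le> l * b" "l * b \<le> b"
    using l by (auto simp: a_b_d_def mult_left_le_one_le)
  have mn: "m \<in> X" "n \<in> X" using X by (auto simp: m_n_def gd_in)
  have np: "dist n p = l * b"
    using gd_dist_start[of p y "l * b"] X la by (simp add: a_b_d_def m_n_def dist_commute)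
  have st: "(dist q (gd X p z (l * dist p z)))\<^sup>2
       \<le> (1 - l) * (dist q p)\<^sup>2 + l * (dist q z)\<^sup>2 - l * (1 - l) * (dist p z)\<^sup>2"
    if "q \<in> X" "z \<in> X" for q z
  proof (cases "dist p z = 0")
    case True
    then show ?thesis using that X by (simp add: gd_0 algebra_simps)
  next
    case False
    then have pos: "dist p z > 0" by simp
    have "dist p z * (dist q (gd X p z (l * dist p z)))\<^sup>2 \<le>
       dist p z * ((1 - l) * (dist q p)\<^sup>2 + l * (dist q z)\<^sup>2 - l * (1 - l) * (dist p z)\<^sup>2)"
      using stewart[of p z q "l * dist p z"] that X l mult_left_le_one_le[of "dist p z" l]
      by (simp add: algebra_simps power2_eq_square)
    then show ?thesis using pos by simp
  qed
  have 1: "(dist n m)\<^sup>2 \<le> (1 - l) * (l * b)\<^sup>2 + l * (dist n x)\<^sup>2 - l * (1 - l) * a\<^sup>2"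
    using st[of n x] mn X np by (simp add: m_n_def a_b_d_def)
  have 2: "(dist x n)\<^sup>2 \<le> (1 - l) * a\<^sup>2 + l * d\<^sup>2 - l * (1 - l) * b\<^sup>2"
    using st[of x y] X by (simp add: m_n_def a_b_d_def dist_commute)
  have "(dist n m)\<^sup>2 \<le> (1 - l) * (l * b)\<^sup>2 + l * ((1 - l) * a\<^sup>2 + l * d\<^sup>2 - l * (1 - l) * b\<^sup>2)
      - l * (1 - l) * a\<^sup>2"
    using 1 mult_left_mono[OF 2 l(1)] by (simp add: dist_commute)
  also have "\<dots> = (l * d)\<^sup>2" by (simp add: algebra_simps power2_eq_square)
  finally have "dist n m \<le> l * d"
    using l by (simp add: abs_le_square_iff[symmetric] a_b_d_def)
  then show ?thesis by (simp add: m_n_def a_b_d_def dist_commute)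
qed

text \<open>The diagonal from \<open>x\<close> to \<open>y'\<close> cuts the quadrilateral into two
  triangles, and \<open>gd_scale\<close> applies to each.\<close>

lemma gd_convex:
  assumes X: "x \<in> X" "y \<in> X" "x' \<in> X" "y' \<in> X" and l: "0 \<le> l" "l \<le> 1"
  shows "dist (gd X x y (l * dist x y)) (gd X x' y' (l * dist x' y'))
       \<le> (1 - l) * dist x x' + l * dist y y'"
proof -
  have 1: "dist (gd X x y (l * dist x y)) (gd X x y' (l * dist x y')) \<le> l * dist y y'"
    by (rule gd_scale) (use assms in auto)
  have eq: "gd X u y' (l * dist u y') = gd X y' u ((1 - l) * dist y' u)" if "u \<in> X" for u
    using gd_commute[of u y' "l * dist u y'"] that X l mult_left_le_one_le[of "dist u y'" l]
    by (simp add: algebra_simps dist_commute)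
  have "dist (gd X x y' (l * dist x y')) (gd X x' y' (l * dist x' y')) \<le> (1 - l) * dist x x'"
    unfolding eq[OF X(1)] eq[OF X(3)] by (rule gd_scale) (use assms in auto)
  with 1 show ?thesis using dist_triangle[of "gd X x y (l * dist x y)"
    "gd X x' y' (l * dist x' y')" "gd X x y' (l * dist x y')"] by linarith
qed

lemma midpoint_ineq:
  assumes "x \<in> X" "y \<in> X" "p \<in> X"
  shows "4 * (dist p (gd X x y (dist x y / 2)))\<^sup>2 \<le> 2 * (dist p x)\<^sup>2 + 2 * (dist p y)\<^sup>2 - (dist x y)\<^sup>2"
proof (cases "dist x y = 0")
  case True
  then show ?thesis using assms by (simp add: gd_0)
next
  case False
  then have pos: "dist x y > 0" by simp
  have "dist x y * (4 * (dist p (gd X x y (dist x y / 2)))\<^sup>2)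
      \<le> dist x y * (2 * (dist p x)\<^sup>2 + 2 * (dist p y)\<^sup>2 - (dist x y)\<^sup>2)"
    using stewart[OF assms, of "dist x y / 2"]
    by (simp add: algebra_simps power2_eq_square)
  then show ?thesis using pos by simp
qed

text \<open>The vertices \<open>x2\<close> and \<open>x4\<close> are both compared with the midpoint
  of the other diagonal. It is needed for the long thin quadrilaterals spanned by two orbits of the
  centre.\<close>

lemma quadrilateral:
  assumes "x1 \<in> X" "x2 \<in> X" "x3 \<in> X" "x4 \<in> X"
  shows "(dist x1 x3)\<^sup>2 + (dist x2 x4)\<^sup>2
       \<le> (dist x1 x2)\<^sup>2 + (dist x2 x3)\<^sup>2 + (dist x3 x4)\<^sup>2 + (dist x4 x1)\<^sup>2"
proof -
  define m where "m = gd X x1 x3 (dist x1 x3 / 2)"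
  have "dist x2 x4 \<le> dist x2 m + dist x4 m"
    by (metis dist_commute dist_triangle)
  then have "(dist x2 x4)\<^sup>2 \<le> (dist x2 m + dist x4 m)\<^sup>2"
    by (simp add: power_mono)
  also have "\<dots> \<le> 2 * (dist x2 m)\<^sup>2 + 2 * (dist x4 m)\<^sup>2"
    using sum_squares_bound[of "dist x2 m" "dist x4 m"] by (simp add: power2_sum)
  finally show ?thesis
    using midpoint_ineq[of x1 x3 x2] midpoint_ineq[of x1 x3 x4] assms
    by (simp add: m_def dist_commute)
qed

text \<open>The geodesics may have different lengths: points at equal proportion are compared first,
  and correcting the parameter costs the same amount again, whence the factor 2.\<close>

lemma gd_close:
  assumes X: "p \<in> X" "x \<in> X" "y \<in> X" and r: "0 \<le> r" "r \<le> dist p x"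
  shows "dist p x * dist (gd X p x r) (gd X p y r) \<le> 2 * r * dist x y"
proof (cases "dist p x = 0")
  case False
  then have pos: "dist p x > 0" by simp
  define l where "l = r / dist p x"
  have l: "0 \<le> l" "l \<le> 1" "l * dist p x = r" using r pos by (auto simp: l_def)
  have "dist (gd X p x r) (gd X p y (l * dist p y)) \<le> l * dist x y"
    using gd_scale[OF X l(1,2)] l by simp
  moreover have "dist (gd X p y (l * dist p y)) (gd X p y r) \<le> \<bar>l * (dist p y - dist p x)\<bar>"
    using gd_lip[of p y "l * dist p y" r] X l by (simp add: algebra_simps)
  moreover have "\<bar>l * (dist p y - dist p x)\<bar> \<le> l * dist x y"
    using l dist_triangle[of p y x] dist_triangle[of p x y]
    by (auto simp: abs_mult dist_commute intro!: mult_left_mono)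
  ultimately have "dist (gd X p x r) (gd X p y r) \<le> 2 * (l * dist x y)"
    using dist_triangle[of "gd X p x r" "gd X p y r" "gd X p y (l * dist p y)"] by linarith
  then have "dist p x * dist (gd X p x r) (gd X p y r) \<le> dist p x * (2 * (l * dist x y))"
    using pos by simp
  also have "\<dots> = 2 * (l * dist p x) * dist x y" by simp
  finally show ?thesis using l by simp
qed (use r in simp)

lemma gd_mono:
  assumes X: "p \<in> X" "x \<in> X" "y \<in> X" and t: "0 \<le> t" "t \<le> T" "T \<le> dist p x" "T \<le> dist p y"
  shows "T * dist (gd X p x t) (gd X p y t) \<le> t * dist (gd X p x T) (gd X p y T)"
proof (cases "T = 0")
  case False
  then have T: "T > 0" using t by simp
  define l where "l = t / T"
  have l: "0 \<le> l" "l \<le> 1" "l * T = t" using t T by (auto simp: l_def)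
  have d: "dist p (gd X p z T) = T" if "z \<in> {x, y}" for z
    using that X t by (auto simp: gd_dist_start)
  have "dist (gd X p x t) (gd X p y t) \<le> l * dist (gd X p x T) (gd X p y T)"
    using gd_scale[of p "gd X p x T" "gd X p y T" l] X t l
    by (simp add: d gd_in gd_gd)
  then have "T * dist (gd X p x t) (gd X p y t) \<le> T * (l * dist (gd X p x T) (gd X p y T))"
    using T by simp
  also have "\<dots> = l * T * dist (gd X p x T) (gd X p y T)" by simp
  finally show ?thesis using l by simp
qed (use t in simp)

end

section \<open>Geodesic rays\<close>

context cat0
begin

lemma ray_in: "geodesic_ray X c \<Longrightarrow> 0 \<le> t \<Longrightarrow> c t \<in> X"
  unfolding geodesic_ray_def by auto

lemma ray_dist: "geodesic_ray X c \<Longrightarrow> 0 \<le> s \<Longrightarrow> 0 \<le> t \<Longrightarrow> dist (c s) (c t) = \<bar>s - t\<bar>"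
  unfolding geodesic_ray_def by blast

lemma ray_eq_gd:
  assumes c: "geodesic_ray X c" and t: "0 \<le> t" "t \<le> T"
  shows "c t = gd X (c 0) (c T) t"
  by (rule geodesic_unique) (use ray_in[OF c] ray_dist[OF c] t in auto)

lemma ray_scale:
  assumes c: "geodesic_ray X c" "geodesic_ray X c'" "c 0 = c' 0" and t: "0 \<le> t" "t \<le> T"
  shows "T * dist (c t) (c' t) \<le> t * dist (c T) (c' T)"
proof -
  have e: "dist (c' 0) (c T) = T" "dist (c' 0) (c' T) = T"
    using ray_dist[of c 0 T] ray_dist[of c' 0 T] c t by auto
  have X: "c' 0 \<in> X" "c T \<in> X" "c' T \<in> X" using c t ray_in by force+
  have "T * dist (gd X (c' 0) (c T) t) (gd X (c' 0) (c' T) t)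
      \<le> t * dist (gd X (c' 0) (c T) T) (gd X (c' 0) (c' T) T)"
    by (rule gd_mono) (use X t e in auto)
  moreover have "c t = gd X (c' 0) (c T) t" "c' t = gd X (c' 0) (c' T) t"
    "c T = gd X (c' 0) (c T) T" "c' T = gd X (c' 0) (c' T) T"
    using ray_eq_gd[of c t T] ray_eq_gd[of c' t T] X e c t by (auto simp: gd_end)
  ultimately show ?thesis by metis
qed

text \<open>By \<open>ray_scale\<close> the quotient \<open>dist (c t) (c' t) / t\<close> is
  nondecreasing, so smallness at arbitrarily large times suffices. The identification of polar
  points and that of nonpolar points both end here.\<close>

lemma ray_eq_sublinear:
  assumes c: "geodesic_ray X c" "geodesic_ray X c'" "c 0 = c' 0"
    and sub: "\<And>e T0. e > 0 \<Longrightarrow> \<exists>T\<ge>T0. dist (c T) (c' T) \<le> e * T"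
    and r: "0 \<le> r"
  shows "c r = c' r"
proof (rule ccontr)
  assume "c r \<noteq> c' r"
  then have d: "dist (c r) (c' r) > 0" by simp
  then have r0: "r > 0" using c r by (cases "r = 0") auto
  define e where "e = dist (c r) (c' r) / (2 * r)"
  have "e > 0" using d r0 by (simp add: e_def)
  then obtain T where T: "T \<ge> max 1 r" "dist (c T) (c' T) \<le> e * T" using sub by blast
  have "T * dist (c r) (c' r) \<le> r * dist (c T) (c' T)"
    by (rule ray_scale) (use c r T in auto)
  also have "\<dots> \<le> r * (e * T)" using T r by (simp add: mult_left_mono)
  also have "\<dots> = T * (dist (c r) (c' r) / 2)" using r0 by (simp add: e_def)
  finally have "T * dist (c r) (c' r) \<le> T * (dist (c r) (c' r) / 2)" .
  then have "dist (c r) (c' r) \<le> dist (c r) (c' r) / 2"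
    using T by (subst (asm) mult_le_cancel_left_pos) auto
  then show False using d by simp
qed

lemma ray_eq_bounded:
  assumes c: "geodesic_ray X c" "geodesic_ray X c'" "c 0 = c' 0"
    and bd: "\<And>t. 0 \<le> t \<Longrightarrow> dist (c t) (c' t) \<le> K" and r: "0 \<le> r"
  shows "c r = c' r"
proof (rule ray_eq_sublinear[OF c _ r])
  fix e T0 :: real assume e: "e > 0"
  define T where "T = max (max 0 T0) (K / e)"
  have "K / e \<le> T" by (simp add: T_def)
  then have "K \<le> e * T" using e by (simp add: field_simps)
  moreover have "dist (c T) (c' T) \<le> K" "T \<ge> T0" by (auto intro: bd simp: T_def)
  ultimately show "\<exists>T\<ge>T0. dist (c T) (c' T) \<le> e * T"
    by (intro exI[of _ T]) auto
qed

text \<open>Tychonoff's theorem for pointwise convergence; properness makes each factor compact. The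
  radius \<open>\<bar>t\<bar>\<close> is what a 1-Lipschitz path from \<open>x0\<close> can reach at
  time \<open>t\<close>.\<close>

lemma compact_paths:
  assumes "x0 \<in> X"
  shows "compact {c :: real \<Rightarrow> 'a. \<forall>t. c t \<in> cball x0 \<bar>t\<bar> \<inter> X}"
proof -
  have "compactin (product_topology (\<lambda>i. euclidean) UNIV) (PiE UNIV (\<lambda>t::real. cball x0 \<bar>t\<bar> \<inter> X))"
    using proper assms unfolding compactin_PiE proper_space_def by auto
  moreover have "PiE UNIV (\<lambda>t::real. cball x0 \<bar>t\<bar> \<inter> X) = {c. \<forall>t. c t \<in> cball x0 \<bar>t\<bar> \<inter> X}"
    by (auto simp: PiE_def Pi_def)
  ultimately show ?thesis
    by (simp add: euclidean_product_topology)
qed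

text \<open>The cluster point lives in a product over all real times, which is not first countable;
  hence a filter \<open>F\<close> finer than \<open>sequentially\<close> takes the place of a
  subsequence.\<close>

lemma cluster_ray:
  fixes a :: "nat \<Rightarrow> 'a"
  assumes x0: "x0 \<in> X" and a: "\<And>n. a n \<in> X" and lim: "filterlim (\<lambda>n. dist x0 (a n)) at_top sequentially"
  obtains c F where "geodesic_ray X c" "c 0 = x0" "F \<noteq> bot" "F \<le> sequentially"
    "\<And>t. ((\<lambda>n. gd X x0 (a n) t) \<longlongrightarrow> c t) F"
proof -
  let ?g = "\<lambda>n. gd X x0 (a n)"
  let ?U = "{c. \<forall>t. c t \<in> cball x0 \<bar>t\<bar> \<inter> X}"
  have "dist x0 (?g n t) \<le> \<bar>t\<bar>" for n t
    using gd_lip[of x0 "a n" 0 t] gd_0[of x0 "a n" 0] x0 a by simp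
  then have "eventually (\<lambda>c. c \<in> ?U) (filtermap ?g sequentially)"
    using gd_in x0 a by (auto simp: eventually_filtermap)
  moreover have "filtermap ?g sequentially \<noteq> bot" by (simp add: filtermap_bot_iff)
  ultimately obtain c where c: "c \<in> ?U" and nb: "inf (nhds c) (filtermap ?g sequentially) \<noteq> bot"
    using compact_paths[OF x0] unfolding compact_filter by blast
  \<comment> \<open>\<open>F\<close> concentrates on the large indices whose geodesics are close to
    \<open>c\<close>. It is proper because \<open>c\<close> is a cluster point.\<close>
  define F where "F = inf (filtercomap ?g (nhds c)) sequentially"
  have F: "F \<noteq> bot"
  proof
    assume "F = bot"
    then obtain P Q where PQ: "eventually P (filtercomap ?g (nhds c))" "eventually Q sequentially"
      "\<And>x. P x \<and> Q x \<Longrightarrow> False"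
      unfolding F_def trivial_limit_def eventually_inf by auto
    obtain P' where P': "eventually P' (nhds c)" "\<And>n. P' (?g n) \<Longrightarrow> P n"
      using PQ(1) unfolding eventually_filtercomap by blast
    have "eventually (\<lambda>h. \<not> P' h) (filtermap ?g sequentially)"
      unfolding eventually_filtermap using PQ(2) by eventually_elim (use P' PQ(3) in blast)
    then have "eventually (\<lambda>_. False) (inf (nhds c) (filtermap ?g sequentially))"
      unfolding eventually_inf using P'(1) by blast
    then show False using nb unfolding trivial_limit_def by simp
  qed
  have le: "F \<le> sequentially" by (simp add: F_def)
  have "filterlim ?g (nhds c) F"
    unfolding filterlim_def F_def
    by (meson filtermap_filtercomap filtermap_mono inf_le1 order_trans)
  then have lim1: "((\<lambda>n. ?g n t) \<longlongrightarrow> c t) F" for t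
    by (rule continuous_on_tendsto_compose[OF continuous_on_product_coordinates]) auto
  have inf: "eventually (\<lambda>n. dist x0 (a n) \<ge> T) F" for T
    using lim le unfolding filterlim_at_top by (meson filter_leD)
  have ray: "geodesic_ray X c" unfolding geodesic_ray_def
  proof (intro conjI allI impI)
    show "c ` {0..} \<subseteq> X" using c by auto
    fix s t :: real assume st: "0 \<le> s" "0 \<le> t"
    have 1: "((\<lambda>n. dist (?g n s) (?g n t)) \<longlongrightarrow> dist (c s) (c t)) F"
      by (intro tendsto_dist lim1)
    \<comment> \<open>The lengths tend to infinity, so at two fixed times the clamping in
      \<open>gd\<close> is eventually inactive.\<close>
    have "eventually (\<lambda>n. dist (?g n s) (?g n t) = \<bar>s - t\<bar>) F"
      using inf[of "max s t"] by eventually_elim (use st x0 a in \<open>auto simp: gd_dist\<close>)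
    then have "((\<lambda>n. dist (?g n s) (?g n t)) \<longlongrightarrow> \<bar>s - t\<bar>) F"
      by (rule tendsto_eventually)
    with 1 F show "dist (c s) (c t) = \<bar>s - t\<bar>"
      using tendsto_unique by blast
  qed
  have "dist x0 (c 0) \<le> \<bar>0\<bar>" using c unfolding mem_Collect_eq by (metis IntD1 mem_cball)
  then have "c 0 = x0" by simp
  then show thesis using that ray F le lim1 by blast
qed

text \<open>The ray is a limit of the geodesics from \<open>x0\<close> to \<open>c n\<close>.
  Comparison at equal proportion costs \<open>D\<close>, passing from proportion to arc length costs
  another \<open>D\<close>.\<close>

lemma ray_from:
  assumes x0: "x0 \<in> X" and c: "geodesic_ray X c"
  obtains c' where "geodesic_ray X c'" "c' 0 = x0" "\<And>t. 0 \<le> t \<Longrightarrow> dist (c t) (c' t) \<le> 2 * dist x0 (c 0)"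
proof -
  define D where "D = dist x0 (c 0)"
  have cX: "c t \<in> X" if "t \<ge> 0" for t using c that by (rule ray_in)
  have dn: "\<bar>dist x0 (c (real n)) - real n\<bar> \<le> D" for n
    using dist_triangle[of x0 "c (real n)" "c 0"] dist_triangle[of "c 0" "c (real n)" x0]
      ray_dist[OF c, of 0 "real n"] by (auto simp: D_def dist_commute)
  have lim: "filterlim (\<lambda>n. dist x0 (c (real n))) at_top sequentially"
  proof (rule filterlim_at_top_mono)
    show "filterlim (\<lambda>n. - D + real n) at_top sequentially"
      by (rule filterlim_tendsto_add_at_top[OF tendsto_const filterlim_real_sequentially])
    show "\<forall>\<^sub>F n in sequentially. - D + real n \<le> dist x0 (c (real n))"
      using dn by (intro always_eventually allI) (smt (verit))
  qed
  obtain c' F where c': "geodesic_ray X c'" "c' 0 = x0" and F: "F \<noteq> bot" "F \<le> sequentially"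
    and lim1: "\<And>t. ((\<lambda>n. gd X x0 (c (real n)) t) \<longlongrightarrow> c' t) F"
    using cluster_ray[of x0 "\<lambda>n. c (real n)"] x0 cX lim by auto
  have "dist (c t) (c' t) \<le> 2 * D" if t: "0 \<le> t" for t
  proof -
    have "eventually (\<lambda>n. real n \<ge> max 1 t) F"
      using filterlim_real_sequentially F(2) unfolding filterlim_at_top by (meson filter_leD)
    then have "eventually (\<lambda>n. dist (c t) (gd X x0 (c (real n)) t) \<le> 2 * D) F"
    proof eventually_elim
      fix n assume n: "real n \<ge> max 1 t"
      define l where "l = t / real n"
      have l: "0 \<le> l" "l \<le> 1" "l * real n = t" using n t by (auto simp: l_def)
      have "dist (c 0) (c (real n)) = real n" using ray_dist[OF c, of 0 "real n"] by simp
      then have "c t = gd X (c 0) (c (real n)) (l * dist (c 0) (c (real n)))"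
        using ray_eq_gd[OF c, of t "real n"] n t l by simp
      then have "dist (c t) (gd X x0 (c (real n)) (l * dist x0 (c (real n)))) \<le> (1 - l) * dist (c 0) x0 + l * 0"
        using gd_convex[of "c 0" "c (real n)" x0 "c (real n)" l] x0 cX l by simp
      also have "\<dots> \<le> D" using l by (simp add: D_def dist_commute mult_left_le_one_le)
      finally have 1: "dist (c t) (gd X x0 (c (real n)) (l * dist x0 (c (real n)))) \<le> D" .
      have "\<bar>l * dist x0 (c (real n)) - t\<bar> = l * \<bar>dist x0 (c (real n)) - real n\<bar>"
        using l by (simp flip: l(3) right_diff_distrib add: abs_mult)
      also have "\<dots> \<le> 1 * D" using dn[of n] l by (intro mult_mono) auto
      finally have "dist (gd X x0 (c (real n)) (l * dist x0 (c (real n)))) (gd X x0 (c (real n)) t) \<le> D"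
        using gd_lip[of x0 "c (real n)" "l * dist x0 (c (real n))" t] x0 cX by fastforce
      with 1 show "dist (c t) (gd X x0 (c (real n)) t) \<le> 2 * D"
        using dist_triangle[of "c t" "gd X x0 (c (real n)) t" "gd X x0 (c (real n)) (l * dist x0 (c (real n)))"]
        by linarith
    qed
    then show ?thesis
      by (intro tendsto_upperbound[OF tendsto_dist[OF tendsto_const lim1] _ F(1)])
  qed
  then show thesis using that c' by (simp add: D_def)
qed

lemma asymptotic_relD:
  "(c, c') \<in> asymptotic_rel X \<Longrightarrow> geodesic_ray X c \<and> geodesic_ray X c' \<and> (\<exists>K. \<forall>t\<ge>0. dist (c t) (c' t) \<le> K)"
  unfolding asymptotic_rel_def by auto

lemma equiv_asymptotic: "equiv {c. geodesic_ray X c} (asymptotic_rel X)"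
proof (rule equivI)
  show "sym (asymptotic_rel X)"
    by (auto simp: sym_def asymptotic_rel_def dist_commute)
  show "trans (asymptotic_rel X)"
  proof (rule transI)
    fix a b c assume "(a, b) \<in> asymptotic_rel X" "(b, c) \<in> asymptotic_rel X"
    then obtain K L where r: "geodesic_ray X a" "geodesic_ray X c"
      and KL: "\<forall>t\<ge>0. dist (a t) (b t) \<le> K" "\<forall>t\<ge>0. dist (b t) (c t) \<le> L"
      unfolding asymptotic_rel_def by auto
    have "\<forall>t\<ge>0. dist (a t) (c t) \<le> K + L"
      using KL dist_triangle_le add_mono by (meson dist_triangle order_trans)
    then show "(a, c) \<in> asymptotic_rel X" using r unfolding asymptotic_rel_def by blast
  qed
  show "refl_on {c. geodesic_ray X c} (asymptotic_rel X)"
    by (auto simp: refl_on_def asymptotic_rel_def intro!: exI[of _ 0])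
  show "asymptotic_rel X \<subseteq> {c. geodesic_ray X c} \<times> {c. geodesic_ray X c}"
    by (auto simp: asymptotic_rel_def)
qed

lemma boundary_ray: "\<xi> \<in> visual_boundary X \<Longrightarrow> c \<in> \<xi> \<Longrightarrow> geodesic_ray X c"
  unfolding visual_boundary_def by (auto simp: quotient_def asymptotic_rel_def)

lemma boundary_asymptotic:
  "\<xi> \<in> visual_boundary X \<Longrightarrow> c \<in> \<xi> \<Longrightarrow> c' \<in> \<xi> \<Longrightarrow> (c, c') \<in> asymptotic_rel X"
  unfolding visual_boundary_def using equiv_asymptotic quotient_eq_iff by metis

lemma boundary_eqI:
  assumes "\<xi> \<in> visual_boundary X" "\<eta> \<in> visual_boundary X" "c \<in> \<xi>" "c' \<in> \<eta>"
    "\<And>t. t \<ge> 0 \<Longrightarrow> dist (c t) (c' t) \<le> K"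
  shows "\<xi> = \<eta>"
proof -
  have "(c, c') \<in> asymptotic_rel X"
    using assms boundary_ray unfolding asymptotic_rel_def by blast
  then show ?thesis
    using assms equiv_asymptotic quotient_eq_iff unfolding visual_boundary_def by metis
qed

lemma boundary_ray_unique:
  assumes "\<xi> \<in> visual_boundary X" "c \<in> \<xi>" "c' \<in> \<xi>" "c 0 = c' 0" "0 \<le> t"
  shows "c t = c' t"
  using asymptotic_relD[OF boundary_asymptotic[OF assms(1-3)]] ray_eq_bounded assms(4,5) by blast

lemma ray_class_in: "geodesic_ray X c \<Longrightarrow> asymptotic_rel X `` {c} \<in> visual_boundary X"
  unfolding visual_boundary_def by (auto simp: quotient_def)

lemma ray_in_class: "geodesic_ray X c \<Longrightarrow> c \<in> asymptotic_rel X `` {c}"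
  unfolding asymptotic_rel_def by (auto intro!: exI[of _ 0])

lemma boundary_ray_exists:
  assumes x0: "x0 \<in> X" and \<xi>: "\<xi> \<in> visual_boundary X"
  obtains c where "c \<in> \<xi>" "geodesic_ray X c" "c 0 = x0"
proof -
  obtain b where b: "geodesic_ray X b" "\<xi> = asymptotic_rel X `` {b}"
    using \<xi> unfolding visual_boundary_def quotient_def by auto
  obtain c where c: "geodesic_ray X c" "c 0 = x0" "\<And>t. 0 \<le> t \<Longrightarrow> dist (b t) (c t) \<le> 2 * dist x0 (b 0)"
    by (rule ray_from[OF x0 b(1)]) blast
  then have "c \<in> \<xi>" using b unfolding asymptotic_rel_def by auto
  then show thesis using that c by blast
qed

end

section \<open>The boundary and the compactification\<close>

context cat0
begin

lemma cone_nbhd_Inr_iff: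
  assumes "geodesic_ray X c" "\<xi> \<in> visual_boundary X" "b \<in> \<xi>" "b 0 = c 0" "0 < r"
  shows "Inr \<xi> \<in> cone_nbhd X c r e \<longleftrightarrow> dist (b r) (c r) < e"
proof
  assume "Inr \<xi> \<in> cone_nbhd X c r e"
  then obtain \<gamma> where "\<gamma> \<in> \<xi>" "\<gamma> 0 = c 0" "dist (\<gamma> r) (c r) < e"
    unfolding cone_nbhd_def by auto
  moreover from this have "\<gamma> r = b r"
    using boundary_ray_unique[of \<xi> \<gamma> b r] assms by auto
  ultimately show "dist (b r) (c r) < e" by simp
next
  assume "dist (b r) (c r) < e"
  then show "Inr \<xi> \<in> cone_nbhd X c r e"
    using assms unfolding cone_nbhd_def by auto
qed

lemma cone_nbhd_Inl_iff:
  assumes "c 0 \<in> X" "x \<in> X" "0 \<le> r"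
  shows "Inl x \<in> cone_nbhd X c r e \<longleftrightarrow> r < dist (c 0) x \<and> dist (gd X (c 0) x r) (c r) < e"
proof -
  have "\<gamma> r = gd X (c 0) x r" if "geodesic_path X (c 0) x \<gamma>" "r < dist (c 0) x" for \<gamma>
    using path_eq_gd[of "c 0" x \<gamma> r] assms that by simp
  then have "(\<exists>\<gamma>. geodesic_path X (c 0) x \<gamma> \<and> dist (\<gamma> r) (c r) < e) \<longleftrightarrow> dist (gd X (c 0) x r) (c r) < e"
    if "r < dist (c 0) x"
    using gd_path[OF assms(1,2)] that by metis
  moreover have "Inl x \<in> cone_nbhd X c r e \<longleftrightarrow>
      r < dist (c 0) x \<and> (\<exists>\<gamma>. geodesic_path X (c 0) x \<gamma> \<and> dist (\<gamma> r) (c r) < e)"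
    using assms(2) unfolding cone_nbhd_def by (simp add: image_iff dist_commute[of "c 0"])
  ultimately show ?thesis by blast
qed

lemma openin_cone_nbhd:
  assumes "geodesic_ray X c" "c 0 = x0" "r > 0" "e > 0"
  shows "openin (cone_topology X x0) (cone_nbhd X c r e)"
  unfolding cone_topology_def by (rule topology_generated_by_Basis) (use assms in blast)

lemma boundary_subset_cone:
  assumes "x0 \<in> X" shows "Inr ` visual_boundary X \<subseteq> topspace (cone_topology X x0)"
proof clarify
  fix \<xi> assume \<xi>: "\<xi> \<in> visual_boundary X"
  obtain c where c: "c \<in> \<xi>" "geodesic_ray X c" "c 0 = x0"
    using boundary_ray_exists[OF assms \<xi>] .
  then have "Inr \<xi> \<in> cone_nbhd X c 1 1"
    using cone_nbhd_Inr_iff[OF c(2) \<xi> c(1)] by simp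
  then show "Inr \<xi> \<in> topspace (cone_topology X x0)"
    using openin_subset[OF openin_cone_nbhd[OF c(2,3), of 1 1]] by auto
qed

lemma topspace_boundary:
  "x0 \<in> X \<Longrightarrow> topspace (boundary_topology X x0) = visual_boundary X"
  using boundary_subset_cone unfolding boundary_topology_def topspace_pullback_topology by fastforce

lemma Hausdorff_boundary:
  assumes x0: "x0 \<in> X" shows "Hausdorff_space (boundary_topology X x0)"
  unfolding Hausdorff_space_def topspace_boundary[OF x0]
proof (intro allI impI, elim conjE)
  fix \<xi> \<eta> assume b: "\<xi> \<in> visual_boundary X" "\<eta> \<in> visual_boundary X" and ne: "\<xi> \<noteq> \<eta>"
  obtain c where c: "c \<in> \<xi>" "geodesic_ray X c" "c 0 = x0" using boundary_ray_exists[OF x0 b(1)] .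
  obtain c' where c': "c' \<in> \<eta>" "geodesic_ray X c'" "c' 0 = x0" using boundary_ray_exists[OF x0 b(2)] .
  have "\<exists>r>0. c r \<noteq> c' r"
  proof (rule ccontr)
    assume "\<not> ?thesis"
    then have "dist (c t) (c' t) \<le> 0" if "t \<ge> 0" for t
      using that c c' by (cases "t = 0") auto
    then show False using boundary_eqI[OF b c(1) c'(1)] ne by blast
  qed
  then obtain r where r: "r > 0" "c r \<noteq> c' r" by blast
  define e where "e = dist (c r) (c' r) / 2"
  have e: "e > 0" using r by (simp add: e_def)
  let ?U = "\<lambda>c. Inr -` cone_nbhd X c r e \<inter> visual_boundary X"
  have "openin (boundary_topology X x0) (?U b)" if "geodesic_ray X b" "b 0 = x0" for b
    unfolding boundary_topology_def openin_pullback_topology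
    using openin_cone_nbhd[OF that r(1) e] by blast
  then have op: "openin (boundary_topology X x0) (?U c)" "openin (boundary_topology X x0) (?U c')"
    using c c' by auto
  have mem: "\<xi> \<in> ?U c" "\<eta> \<in> ?U c'"
    using cone_nbhd_Inr_iff[OF c(2) b(1) c(1)] cone_nbhd_Inr_iff[OF c'(2) b(2) c'(1)] b r e by auto
  have "disjnt (?U c) (?U c')"
    unfolding disjnt_iff
  proof (intro allI notI)
    fix \<zeta> assume z: "\<zeta> \<in> ?U c \<and> \<zeta> \<in> ?U c'"
    then obtain b where b: "b \<in> \<zeta>" "b 0 = x0" using boundary_ray_exists[OF x0] by blast
    have "dist (b r) (c r) < e" "dist (b r) (c' r) < e"
      using cone_nbhd_Inr_iff[OF c(2) _ b(1)] cone_nbhd_Inr_iff[OF c'(2) _ b(1)] z b c c' r by auto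
    then show False using dist_triangle2[of "c r" "c' r" "b r"] by (simp add: e_def dist_commute)
  qed
  then show "\<exists>U V. openin (boundary_topology X x0) U \<and> openin (boundary_topology X x0) V \<and>
      \<xi> \<in> U \<and> \<eta> \<in> V \<and> disjnt U V"
    using op mem by blast
qed

text \<open>The boundary is a continuous image of the set of rays from \<open>x0\<close>, which is
  closed in a compact space of paths.\<close>

lemma compact_boundary:
  assumes x0: "x0 \<in> X" shows "compact_space (boundary_topology X x0)"
proof -
  let ?P = "{c :: real \<Rightarrow> 'a. \<forall>t. c t \<in> cball x0 \<bar>t\<bar> \<inter> X}"
  let ?D = "\<Inter>s\<in>{0..}. \<Inter>t\<in>{0..}. {c :: real \<Rightarrow> 'a. dist (c s) (c t) = \<bar>s - t\<bar>}"
  define R where "R = ?P \<inter> ?D"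
  have ev: "continuous_on UNIV (\<lambda>c :: real \<Rightarrow> 'a. c t)" for t
    by (rule continuous_on_product_coordinates)
  have "closed ?D"
    by (intro closed_INT ballI closed_Collect_eq continuous_on_dist ev continuous_on_const)
  then have R: "compact R" unfolding R_def using compact_paths[OF x0] by (rule compact_Int_closed[rotated])
  have R_ray: "geodesic_ray X c \<and> c 0 = x0" if "c \<in> R" for c
  proof -
    have "dist x0 (c 0) \<le> \<bar>0\<bar>" using that unfolding R_def mem_Collect_eq Int_iff by (metis mem_cball)
    then show ?thesis using that unfolding geodesic_ray_def R_def by auto
  qed
  let ?q = "\<lambda>c. asymptotic_rel X `` {c}"
  have ext: "\<exists>c\<in>R. \<xi> = ?q c" if \<xi>: "\<xi> \<in> visual_boundary X" for \<xi>
  proof -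
    obtain c where c: "c \<in> \<xi>" "geodesic_ray X c" "c 0 = x0" using boundary_ray_exists[OF x0 \<xi>] .
    \<comment> \<open>A representative may take any values at negative times; freezing it there puts
      it into the compact product without changing its class.\<close>
    define b where "b = (\<lambda>t. c (max 0 t))"
    have bd: "dist (b s) (b t) = \<bar>s - t\<bar>" if "0 \<le> s" "0 \<le> t" for s t
      using ray_dist[OF c(2)] that by (simp add: b_def)
    have "dist x0 (b t) \<le> \<bar>t\<bar>" for t
      using ray_dist[OF c(2), of 0 "max 0 t"] c by (simp add: b_def max_def)
    then have bR: "b \<in> R" using ray_in[OF c(2)] bd by (auto simp: b_def R_def)
    have "?q b = \<xi>"
      by (rule boundary_eqI[of _ _ b c 0])
        (use ray_class_in ray_in_class R_ray[OF bR] \<xi> c in \<open>auto simp: b_def\<close>)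
    then show ?thesis using bR by blast
  qed
  have "continuous_map (top_of_set R) (boundary_topology X x0) ?q"
    unfolding boundary_topology_def
  proof (rule continuous_map_pullback')
    show "topspace (top_of_set R) \<subseteq> ?q -` visual_boundary X"
      using R_ray ray_class_in by auto
    show "continuous_map (top_of_set R) (cone_topology X x0) (Inr \<circ> ?q)"
      unfolding cone_topology_def
    proof (rule continuous_on_generated_topo)
      show "(Inr \<circ> ?q) ` topspace (top_of_set R) \<subseteq>
        \<Union> ({Inl ` (ball x r \<inter> X) |x r. x \<in> X \<and> 0 < r} \<union>
            {cone_nbhd X c r e |c r e. geodesic_ray X c \<and> c 0 = x0 \<and> 0 < r \<and> 0 < e})"
      proof (rule subset_trans)
        show "(Inr \<circ> ?q) ` topspace (top_of_set R) \<subseteq> Inr ` visual_boundary X"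
          unfolding image_comp[symmetric] topspace_euclidean_subtopology
          by (intro image_mono image_subsetI ray_class_in) (use R_ray in blast)
      qed (use boundary_subset_cone[OF x0] in
        \<open>simp only: cone_topology_def topology_generated_by_topspace\<close>)
      fix U :: "('a + (real \<Rightarrow> 'a) set) set" assume U: "U \<in> {Inl ` (ball x r \<inter> X) |x r. x \<in> X \<and> 0 < r} \<union>
            {cone_nbhd X c r e |c r e. geodesic_ray X c \<and> c 0 = x0 \<and> 0 < r \<and> 0 < e}"
      show "openin (top_of_set R) ((Inr \<circ> ?q) -` U \<inter> topspace (top_of_set R))"
      proof (cases "\<exists>x r. U = Inl ` (ball x r \<inter> X)")
        case True
        then have "(Inr \<circ> ?q) -` U = {}" by auto
        then show ?thesis by simp
      next
        case False
        then obtain c r e where c: "geodesic_ray X c" "c 0 = x0" "r > 0" "e > 0" "U = cone_nbhd X c r e"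
          using U by blast
        have "Inr (?q b) \<in> U \<longleftrightarrow> dist (b r) (c r) < e" if "b \<in> R" for b
          using cone_nbhd_Inr_iff[OF c(1), of "?q b" b r] R_ray[OF that] ray_class_in ray_in_class c by auto
        then have "(Inr \<circ> ?q) -` U \<inter> topspace (top_of_set R) = R \<inter> {b. dist (b r) (c r) < e}"
          by auto
        moreover have "open {b. dist (b r) (c r) < e}"
          by (intro open_Collect_less continuous_on_dist ev continuous_on_const)
        ultimately show ?thesis by (metis openin_open_Int)
      qed
    qed
  qed
  then have "compactin (boundary_topology X x0) (?q ` R)"
    by (rule image_compactin[rotated]) (use R in \<open>simp add: compactin_subtopology\<close>)
  moreover have "?q ` R = topspace (boundary_topology X x0)"
    unfolding topspace_boundary[OF x0]
  proof (rule equalityI)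
    show "?q ` R \<subseteq> visual_boundary X" using R_ray ray_class_in by (intro image_subsetI) blast
    show "visual_boundary X \<subseteq> ?q ` R" using ext by (intro subsetI) (simp add: image_iff)
  qed
  ultimately show ?thesis by (simp add: compact_space_def)
qed

lemma boundary_in_compactification:
  assumes x0: "x0 \<in> X" and \<phi>: "\<And>g. g \<in> carrier G \<Longrightarrow> \<phi> g x0 \<in> X"
  shows "continuous_map (boundary_topology X x0) (compactification G X \<phi> x0) Inr"
  unfolding compactification_def
proof (rule continuous_on_generated_topo)
  let ?B = "{{Inl g} | g. g \<in> carrier G} \<union>
      {Inl ` {g \<in> carrier G. Inl (\<phi> g x0) \<in> U} \<union> Inr ` {\<xi> \<in> visual_boundary X. Inr \<xi> \<in> U}
        | U. openin (cone_topology X x0) U}"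
  have "Inl ` {g \<in> carrier G. Inl (\<phi> g x0) \<in> topspace (cone_topology X x0)} \<union>
      Inr ` {\<xi> \<in> visual_boundary X. Inr \<xi> \<in> topspace (cone_topology X x0)} \<in> ?B"
    using openin_topspace by blast
  then show "Inr ` topspace (boundary_topology X x0) \<subseteq> \<Union> ?B"
    unfolding topspace_boundary[OF x0]
    by (rule subset_trans[OF _ Union_upper, rotated]) (use boundary_subset_cone[OF x0] in auto)
  fix V assume "V \<in> ?B"
  then consider g where "V = {Inl g}" | U where "openin (cone_topology X x0) U"
    "V = Inl ` {g \<in> carrier G. Inl (\<phi> g x0) \<in> U} \<union> Inr ` {\<xi> \<in> visual_boundary X. Inr \<xi> \<in> U}"
    by blast
  then show "openin (boundary_topology X x0) (Inr -` V \<inter> topspace (boundary_topology X x0))"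
  proof cases
    case 1
    then have "Inr -` V = {}" by auto
    then show ?thesis by simp
  next
    case 2
    then have "Inr -` V \<inter> topspace (boundary_topology X x0) = Inr -` U \<inter> visual_boundary X"
      unfolding topspace_boundary[OF x0] by auto
    then show ?thesis using 2 unfolding boundary_topology_def openin_pullback_topology by auto
  qed
qed

text \<open>Open sets are built from generators by finite intersections and unions, and among the
  generators only cone neighbourhoods matter: balls and singletons contain no point at infinity. The
  filter is arbitrary because limits of geodesics are obtained along filters.\<close>

lemma compactification_tendsto:
  assumes \<phi>: "\<And>i. a i \<in> carrier G" "\<And>i. \<phi> (a i) x0 \<in> X" and x0: "x0 \<in> X"
    and \<xi>: "\<xi> \<in> visual_boundary X" "c \<in> \<xi>" "c 0 = x0"
    and far: "filterlim (\<lambda>i. dist x0 (\<phi> (a i) x0)) at_top F"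
    and lim: "\<And>r. r > 0 \<Longrightarrow> ((\<lambda>i. gd X x0 (\<phi> (a i) x0) r) \<longlongrightarrow> c r) F"
    and W: "openin (compactification G X \<phi> x0) W" "Inr \<xi> \<in> W"
  shows "eventually (\<lambda>i. Inl (a i) \<in> W) F"
proof -
  have cone: "eventually (\<lambda>i. Inl (\<phi> (a i) x0) \<in> U) F"
    if U: "openin (cone_topology X x0) U" "Inr \<xi> \<in> U" for U
  proof -
    have "generate_topology_on ({Inl ` (ball x r \<inter> X) | x r. x \<in> X \<and> r > 0} \<union>
      {cone_nbhd X c r e | c r e. geodesic_ray X c \<and> c 0 = x0 \<and> r > 0 \<and> e > 0}) U"
      using U(1) unfolding cone_topology_def by (rule openin_topology_generated_by)
    then show ?thesis using U(2)
    proof induction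
      case (Int A B)
      then show ?case by (auto intro: eventually_conj)
    next
      case (UN K)
      then obtain k where k: "k \<in> K" "Inr \<xi> \<in> k" by blast
      show ?case using UN.IH[OF k] by eventually_elim (use k in blast)
    next
      case (Basis s)
      then obtain b r e where b: "geodesic_ray X b" "b 0 = x0" "r > 0" "e > 0" "s = cone_nbhd X b r e"
        by blast
      have "dist (c r) (b r) < e"
        using cone_nbhd_Inr_iff[OF b(1) \<xi>(1,2)] \<xi> b Basis by auto
      then have "eventually (\<lambda>i. dist (gd X x0 (\<phi> (a i) x0) r) (b r) < e) F"
        using order_tendstoD(2)[OF tendsto_dist[OF lim[OF b(3)] tendsto_const]] by blast
      moreover have "eventually (\<lambda>i. r < dist x0 (\<phi> (a i) x0)) F"
        using far by (simp add: filterlim_at_top_dense)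
      ultimately show ?case
        by eventually_elim (use cone_nbhd_Inl_iff[of b] \<phi> x0 b in auto)
    qed auto
  qed
  have "generate_topology_on ({{Inl g} | g. g \<in> carrier G} \<union>
      {Inl ` {g \<in> carrier G. Inl (\<phi> g x0) \<in> U} \<union> Inr ` {\<xi> \<in> visual_boundary X. Inr \<xi> \<in> U}
        | U. openin (cone_topology X x0) U}) W"
    using W(1) unfolding compactification_def by (rule openin_topology_generated_by)
  then show ?thesis using W(2)
  proof induction
    case (Int A B)
    then show ?case by (auto intro: eventually_conj)
  next
    case (UN K)
    then obtain k where k: "k \<in> K" "Inr \<xi> \<in> k" by blast
    show ?case using UN.IH[OF k] by eventually_elim (use k in blast)
  next
    case (Basis s)
    then obtain U where U: "openin (cone_topology X x0) U" "Inr \<xi> \<in> U"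
      "s = Inl ` {g \<in> carrier G. Inl (\<phi> g x0) \<in> U} \<union> Inr ` {\<xi> \<in> visual_boundary X. Inr \<xi> \<in> U}"
      by blast
    show ?case using cone[OF U(1,2)] by eventually_elim (use \<phi> U in auto)
  qed auto
qed

lemma compactification_nbhd:
  assumes "geodesic_ray X c" "c 0 = x0" "r > 0" "e > 0"
  shows "openin (compactification G X \<phi> x0)
    (Inl ` {g \<in> carrier G. Inl (\<phi> g x0) \<in> cone_nbhd X c r e}
      \<union> Inr ` {\<xi> \<in> visual_boundary X. Inr \<xi> \<in> cone_nbhd X c r e})"
  unfolding compactification_def
  by (rule topology_generated_by_Basis) (use openin_cone_nbhd[OF assms] in blast)

end

lemma limset_map_continuous:
  assumes "cat0 X" "cat0 Y" "x0 \<in> X" "y0 \<in> Y" "\<And>g. g \<in> carrier G \<Longrightarrow> \<phi> g x0 \<in> X"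
    and f: "limset_map G X \<phi> x0 Y \<psi> y0 f"
  shows "continuous_map (boundary_topology X x0) (boundary_topology Y y0) f"
proof -
  interpret X: cat0 X by fact
  interpret Y: cat0 Y by fact
  obtain F where F: "continuous_map (compactification G X \<phi> x0) (compactification G Y \<psi> y0) F"
    and Ff: "\<And>\<xi>. \<xi> \<in> visual_boundary X \<Longrightarrow> F (Inr \<xi>) = Inr (f \<xi>)"
    using f unfolding limset_map_def by blast
  have fim: "f \<in> visual_boundary X \<rightarrow> visual_boundary Y" using f unfolding limset_map_def by blast
  have FI: "continuous_map (boundary_topology X x0) (compactification G Y \<psi> y0) (F \<circ> Inr)"
    using X.boundary_in_compactification[of x0 G \<phi>] assms F by (blast intro: continuous_map_compose)
  show ?thesis
    unfolding continuous_map_def X.topspace_boundary[OF assms(3)] Y.topspace_boundary[OF assms(4)]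
  proof (intro conjI allI impI fim)
    fix V assume "openin (boundary_topology Y y0) V"
    then obtain U where U: "openin (cone_topology Y y0) U" "V = Inr -` U \<inter> visual_boundary Y"
      unfolding boundary_topology_def openin_pullback_topology by blast
    let ?W = "Inl ` {g \<in> carrier G. Inl (\<psi> g y0) \<in> U} \<union> Inr ` {\<xi> \<in> visual_boundary Y. Inr \<xi> \<in> U}"
    have "openin (compactification G Y \<psi> y0) ?W"
      unfolding compactification_def by (rule topology_generated_by_Basis) (use U(1) in blast)
    then have "openin (boundary_topology X x0) {\<xi> \<in> visual_boundary X. (F \<circ> Inr) \<xi> \<in> ?W}"
      by (rule openin_continuous_map_preimage[OF FI, unfolded X.topspace_boundary[OF assms(3)]])
    moreover have "{\<xi> \<in> visual_boundary X. (F \<circ> Inr) \<xi> \<in> ?W} = {\<xi> \<in> visual_boundary X. f \<xi> \<in> V}"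
      using Ff fim U(2) by auto
    ultimately show "openin (boundary_topology X x0) {\<xi> \<in> visual_boundary X. f \<xi> \<in> V}" by simp
  qed
qed

text \<open>Preimages of cone neighbourhoods under the extension are open, and the extension fixes
  group elements. Besides continuity on the boundary, this is the only information about the limset
  map that the argument exploits.\<close>

lemma limset_map_tendsto:
  assumes XY: "cat0 X" "cat0 Y" "x0 \<in> X" "y0 \<in> Y"
    and im: "\<And>g. g \<in> carrier G \<Longrightarrow> \<phi> g x0 \<in> X" "\<And>g. g \<in> carrier G \<Longrightarrow> \<psi> g y0 \<in> Y"
    and f: "limset_map G X \<phi> x0 Y \<psi> y0 f"
    and a: "\<And>i. a i \<in> carrier G"
    and \<xi>: "\<xi> \<in> visual_boundary X" "c \<in> \<xi>" "c 0 = x0"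
    and far: "filterlim (\<lambda>i. dist x0 (\<phi> (a i) x0)) at_top F"
    and lim: "\<And>r. r > 0 \<Longrightarrow> ((\<lambda>i. gd X x0 (\<phi> (a i) x0) r) \<longlongrightarrow> c r) F"
    and b: "b \<in> f \<xi>" "b 0 = y0" and r: "r > 0"
  shows "((\<lambda>i. gd Y y0 (\<psi> (a i) y0) r) \<longlongrightarrow> b r) F" "eventually (\<lambda>i. r < dist y0 (\<psi> (a i) y0)) F"
proof -
  interpret X: cat0 X by fact
  interpret Y: cat0 Y by fact
  obtain H where H: "continuous_map (compactification G X \<phi> x0) (compactification G Y \<psi> y0) H"
    and Hg: "\<And>g. g \<in> carrier G \<Longrightarrow> H (Inl g) = Inl g" and Hf: "H (Inr \<xi>) = Inr (f \<xi>)"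
    using f \<xi> unfolding limset_map_def by blast
  have f\<xi>: "f \<xi> \<in> visual_boundary Y" using f \<xi> unfolding limset_map_def by blast
  have ray: "geodesic_ray Y b" using Y.boundary_ray f\<xi> b by blast
  have ev: "eventually (\<lambda>i. r < dist y0 (\<psi> (a i) y0) \<and> dist (gd Y y0 (\<psi> (a i) y0) r) (b r) < e) F"
    if e: "e > 0" for e
  proof -
    let ?W = "Inl ` {g \<in> carrier G. Inl (\<psi> g y0) \<in> cone_nbhd Y b r e}
      \<union> Inr ` {\<xi> \<in> visual_boundary Y. Inr \<xi> \<in> cone_nbhd Y b r e}"
    let ?V = "{z \<in> topspace (compactification G X \<phi> x0). H z \<in> ?W}"
    have "openin (compactification G X \<phi> x0) ?V"
      by (rule openin_continuous_map_preimage[OF H Y.compactification_nbhd[OF ray b(2) r e]])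
    moreover have "Inr \<xi> \<in> ?V"
    proof -
      have "Inr \<xi> \<in> topspace (compactification G X \<phi> x0)"
        using continuous_map_image_subset_topspace[OF X.boundary_in_compactification[of x0 G \<phi>]]
          XY im \<xi> X.topspace_boundary[OF XY(3)] by blast
      then show ?thesis using Hf f\<xi> Y.cone_nbhd_Inr_iff[OF ray f\<xi> b(1) _ r, of e] e by auto
    qed
    ultimately have "eventually (\<lambda>i. Inl (a i) \<in> ?V) F"
      using X.compactification_tendsto[of a G \<phi> x0 \<xi> c F ?V] a im XY \<xi> far lim by blast
    then show ?thesis
    proof eventually_elim
      case (elim i)
      then have "Inl (\<psi> (a i) y0) \<in> cone_nbhd Y b r e" using Hg[OF a] by auto
      then show ?case using Y.cone_nbhd_Inl_iff[of b "\<psi> (a i) y0" r e] XY im a b r by auto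
    qed
  qed
  show "((\<lambda>i. gd Y y0 (\<psi> (a i) y0) r) \<longlongrightarrow> b r) F"
    unfolding tendsto_iff using ev by (intro allI impI) (rule eventually_mono, blast+)
  show "eventually (\<lambda>i. r < dist y0 (\<psi> (a i) y0)) F"
    using ev[OF zero_less_one] by (rule eventually_mono) blast
qed

section \<open>Words and orbits\<close>

text \<open>Otherwise the simplifier turns \<open>{0, 1}\<close> inside \<open>F2\<close> into \<open>{0, Suc 0}\<close>.\<close>

declare One_nat_def [simp del]

lemma finite_bounded_above:
  fixes f :: "'a \<Rightarrow> real"
  assumes "finite A" obtains K where "\<And>a. a \<in> A \<Longrightarrow> f a \<le> K"
  by (rule that[of "Max (f ` A)"]) (simp add: assms)

section \<open>Reduced words as vertices of the Cayley tree\<close>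

text \<open>Since \<open>push\<close> works at the left end, multiplication by a letter on the right
  needs its own description: it is a step along an edge of the Cayley tree.\<close>

lemma foldr_push_letter:
  assumes "reduced_word w"
  shows "foldr push w [l] = (if w \<noteq> [] \<and> last w = inv_letter l then butlast w else w @ [l])"
proof (cases w rule: rev_cases)
  case (snoc v m)
  have v: "reduced_word v" using assms snoc unfolding reduced_word_def
    by (simp add: successively_append_iff)
  have eq: "l = inv_letter m \<longleftrightarrow> m = inv_letter l" by (metis inv_letter_inv_letter)
  show ?thesis
  proof (cases "l = inv_letter m")
    case True
    then show ?thesis using snoc v foldr_push_Nil by (simp add: eq)
  next
    case False
    then have "reduced_word (v @ [m, l])" using assms snoc unfolding reduced_word_def
      by (simp add: successively_append_iff)
    then show ?thesis using foldr_push_Nil[of "v @ [m, l]"] snoc False eq by simp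
  qed
qed simp

lemma reduced_prefix: "reduced_word w \<Longrightarrow> prefix u w \<Longrightarrow> reduced_word u"
  unfolding reduced_word_def prefix_def by (auto simp: successively_append_iff)

text \<open>The products of \<open>w\<close> with the prefixes of \<open>s\<close> form a path in
  the Cayley tree. The words with prefix \<open>u\<close> form a branch that can be entered only at
  \<open>u\<close>.\<close>

lemma foldr_push_crossing:
  assumes "reduced_word w" "reduced_word s" "prefix u (foldr push w s)" "\<not> prefix u w"
  obtains t where "prefix t s" "foldr push w t = u"
proof -
  have "\<exists>t. prefix t s \<and> foldr push w t = u"
    using assms(2,3)
  proof (induction s rule: rev_induct)
    case Nil
    then show ?case using assms(4) foldr_push_Nil[OF assms(1)] by simp
  next
    case (snoc l s)
    have s: "reduced_word s" using snoc.prems(1) reduced_prefix by (meson prefixI)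
    let ?v = "foldr push w s"
    have "foldr push s [l] = s @ [l]" using foldr_push_Nil[OF snoc.prems(1)] by simp
    then have eq: "foldr push w (s @ [l]) = foldr push ?v [l]"
      using foldr_push_assoc[of "[l]" w s] by (simp add: reduced_word_Cons)
    have "reduced_word ?v" using s by (rule reduced_foldr_push)
    note eq = eq[unfolded foldr_push_letter[OF this]]
    have "prefix u ?v \<or> foldr push w (s @ [l]) = u"
    proof (cases "?v \<noteq> [] \<and> last ?v = inv_letter l")
      case True
      have "prefix u (butlast ?v)" using snoc.prems(2) unfolding eq if_P[OF True] .
      then show ?thesis using prefixeq_butlast prefix_order.trans by blast
    next
      case False
      have "foldr push w (s @ [l]) = ?v @ [l]" using eq unfolding if_not_P[OF False] .
      then show ?thesis using snoc.prems(2) prefix_snoc[of u ?v l] by auto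
    qed
    then show ?case
    proof
      assume "prefix u ?v"
      then obtain t where "prefix t s" "foldr push w t = u" using snoc.IH s by blast
      then show ?thesis by (metis prefix_prefix)
    qed blast
  qed
  then show thesis using that by blast
qed

lemma F2_mult: "u \<otimes>\<^bsub>F2\<^esub> v = foldr push u v"
  by (simp add: free_group_def)

lemma F2_one: "\<one>\<^bsub>F2\<^esub> = []"
  by (simp add: free_group_def)

lemma Nil_F2 [simp]: "[] \<in> carrier F2"
  by (simp add: free_group_def)

lemma F2_reduced: "w \<in> carrier F2 \<Longrightarrow> reduced_word w"
  by (simp add: free_group_def)

lemma F2_prefix: "w \<in> carrier F2 \<Longrightarrow> prefix u w \<Longrightarrow> u \<in> carrier F2"
  using reduced_prefix[of w u] set_mono_prefix[of u w] by (auto simp: free_group_def)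

lemma F2_append:
  assumes "u @ v \<in> carrier F2" shows "v \<in> carrier F2" "foldr push u v = u @ v"
proof -
  show "v \<in> carrier F2"
    using assms by (auto simp: free_group_def reduced_word_def successively_append_iff)
  have "foldr push u (foldr push v []) = u @ v"
    using foldr_push_Nil[of "u @ v"] assms F2_reduced by fastforce
  then show "foldr push u v = u @ v"
    using foldr_push_Nil[of v] F2_reduced[OF \<open>v \<in> carrier F2\<close>] by simp
qed

lemma F2_quotient:
  assumes "u \<in> carrier F2" "w \<in> carrier F2"
  obtains v where "v \<in> carrier F2" "foldr push u v = w"
proof -
  interpret group F2 by (rule group_free_group)
  have "inv\<^bsub>F2\<^esub> u \<otimes>\<^bsub>F2\<^esub> w \<in> carrier F2" using assms by simp
  moreover have "u \<otimes>\<^bsub>F2\<^esub> (inv\<^bsub>F2\<^esub> u \<otimes>\<^bsub>F2\<^esub> w) = w"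
    using assms by (simp add: m_assoc[symmetric])
  ultimately show thesis using that[of "inv\<^bsub>F2\<^esub> u \<otimes>\<^bsub>F2\<^esub> w"] by (simp add: F2_mult)
qed

text \<open>Weak enough to include geodesics with clamped parameter and pieces of rays run in either
  direction, yet enough for sampling at unit steps.\<close>

definition (in cat0) lipschitz_path :: "real \<Rightarrow> real \<Rightarrow> (real \<Rightarrow> 'a) \<Rightarrow> bool" where
  "lipschitz_path s t c \<longleftrightarrow> s \<le> t \<and> c ` {s..t} \<subseteq> X \<and>
     (\<forall>a\<in>{s..t}. \<forall>b\<in>{s..t}. dist (c a) (c b) \<le> \<bar>a - b\<bar>)"

lemma (in cat0) lipschitz_path_gd:
  "x \<in> X \<Longrightarrow> y \<in> X \<Longrightarrow> s \<le> t \<Longrightarrow> lipschitz_path s t (gd X x y)"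
  unfolding lipschitz_path_def using gd_in gd_lip by auto

lemma (in cat0) lipschitz_path_ray:
  "geodesic_ray X c \<Longrightarrow> 0 \<le> s \<Longrightarrow> s \<le> t \<Longrightarrow> lipschitz_path s t c"
  unfolding lipschitz_path_def geodesic_ray_def by auto

section \<open>Orbits of a geometric action\<close>

locale F2Z_action = cat0 X for X :: "'a::metric_space set" +
  fixes \<phi> :: "(nat \<times> bool) list \<times> int \<Rightarrow> 'a \<Rightarrow> 'a" and x0 :: 'a
  assumes x0: "x0 \<in> X" and action: "geometric_action (F2 \<times>\<times> integer_group) X \<phi>"
begin

lemma group_action: "group_action (F2 \<times>\<times> integer_group) X \<phi>"
  using action unfolding geometric_action_def by blast

lemma act_in: "u \<in> carrier F2 \<Longrightarrow> x \<in> X \<Longrightarrow> \<phi> (u, n) x \<in> X"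
  using group_action.element_image[OF group_action, of "(u, n)" x] by simp

lemma act_mult:
  assumes "u \<in> carrier F2" "v \<in> carrier F2" "x \<in> X"
  shows "\<phi> (u, m) (\<phi> (v, n) x) = \<phi> (foldr push u v, m + n) x"
  using group_action.composition_rule[OF group_action assms(3), of "(u, m)" "(v, n)"] assms
  by (simp add: F2_mult)

lemma act_one: "x \<in> X \<Longrightarrow> \<phi> ([], 0) x = x"
  using group_action.id_eq_one[OF group_action] by (simp add: F2_one) (metis restrict_apply')

lemma act_central:
  assumes "u \<in> carrier F2" "x \<in> X"
  shows "\<phi> ([], m) (\<phi> (u, n) x) = \<phi> (u, m + n) x" "\<phi> (u, n) (\<phi> ([], m) x) = \<phi> (u, m + n) x"
  using act_mult[of "[]" u x m n] act_mult[of u "[]" x n m] assms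
  by (simp_all add: foldr_push_Nil F2_reduced add.commute)

lemma act_isom:
  "u \<in> carrier F2 \<Longrightarrow> x \<in> X \<Longrightarrow> y \<in> X \<Longrightarrow> dist (\<phi> (u, n) x) (\<phi> (u, n) y) = dist x y"
  using action unfolding geometric_action_def by auto

lemma act_gd:
  assumes "u \<in> carrier F2" "x \<in> X" "y \<in> X" "0 \<le> t" "t \<le> dist x y"
  shows "\<phi> (u, n) (gd X x y t) = gd X (\<phi> (u, n) x) (\<phi> (u, n) y) t"
  by (rule geodesic_unique)
    (use assms in \<open>simp_all add: act_in act_isom gd_in gd_dist_start gd_dist_end\<close>)

text \<open>Powers of \<open>z\<close> commute with the whole group, so their displacement functions
  descend to the compact quotient.\<close>

lemma displacement_invariant:
  assumes "u \<in> carrier F2" "x \<in> X"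
  shows "dist (\<phi> (u, n) x) (\<phi> ([], m) (\<phi> (u, n) x)) = dist x (\<phi> ([], m) x)"
  using act_isom[of u x "\<phi> ([], m) x" n] assms by (simp add: act_central act_in)

lemma cocompact_set:
  "\<exists>K. K \<subseteq> X \<and> compact K \<and> (\<Union>g\<in>carrier (F2 \<times>\<times> integer_group). \<phi> g ` K) = X"
  using action unfolding geometric_action_def by (elim conjE)

lemma act_proper:
  "compact K \<Longrightarrow> K \<subseteq> X \<Longrightarrow> finite {g \<in> carrier (F2 \<times>\<times> integer_group). \<phi> g ` K \<inter> K \<noteq> {}}"
  using action unfolding geometric_action_def by (elim conjE) simp

lemma cocompact:
  obtains R where "R \<ge> 0" "\<forall>x\<in>X. \<exists>g\<in>carrier F2 \<times> UNIV. dist x (\<phi> g x0) \<le> R"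
proof -
  obtain K where K: "K \<subseteq> X" "compact K" "(\<Union>g\<in>carrier (F2 \<times>\<times> integer_group). \<phi> g ` K) = X"
    using cocompact_set by (elim exE conjE)
  obtain R where R: "\<And>k. k \<in> K \<Longrightarrow> dist k x0 \<le> R"
    using compact_imp_bounded[OF K(2)] unfolding bounded_any_center[of _ x0] by (metis dist_commute)
  have "\<exists>g\<in>carrier F2 \<times> UNIV. dist x (\<phi> g x0) \<le> max 0 R" if x: "x \<in> X" for x
  proof -
    obtain u n k where u: "u \<in> carrier F2" and k: "k \<in> K" "x = \<phi> (u, n) k"
      using x unfolding K(3)[symmetric] by auto
    have "dist x (\<phi> (u, n) x0) \<le> R" using act_isom[of u k x0 n] R[OF k(1)] u k K(1) x0 by auto
    then show ?thesis using u by (intro bexI[of _ "(u, n)"]) auto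
  qed
  then show thesis using that[of "max 0 R"] by auto
qed

lemma finite_ball: "finite {g \<in> carrier F2 \<times> UNIV. dist x0 (\<phi> g x0) \<le> D}"
proof -
  let ?K = "cball x0 (max 0 D) \<inter> X"
  have "compact ?K" using proper x0 unfolding proper_space_def by blast
  then have fin: "finite {g \<in> carrier (F2 \<times>\<times> integer_group). \<phi> g ` ?K \<inter> ?K \<noteq> {}}"
    by (rule act_proper) simp
  have "\<phi> (u, n) ` ?K \<inter> ?K \<noteq> {}" if "u \<in> carrier F2" "dist x0 (\<phi> (u, n) x0) \<le> D" for u n
  proof -
    have "\<phi> (u, n) x0 \<in> ?K" using that act_in x0 by auto
    moreover have "\<phi> (u, n) x0 \<in> \<phi> (u, n) ` ?K" using x0 by auto
    ultimately show ?thesis by blast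
  qed
  then show ?thesis by (intro finite_subset[OF _ fin]) auto
qed

text \<open>The path is sampled at unit steps and every sample is replaced by an orbit point within
  \<open>R\<close>; jumps are then at most \<open>R + 1 + R\<close>.\<close>

lemma chain:
  assumes g: "g \<in> carrier F2 \<times> UNIV" "h \<in> carrier F2 \<times> UNIV"
    and path: "lipschitz_path s t c"
    and R: "\<forall>x\<in>X. \<exists>g\<in>carrier F2 \<times> UNIV. dist x (\<phi> g x0) \<le> R"
    and ends: "dist (c s) (\<phi> g x0) \<le> R" "dist (c t) (\<phi> h x0) \<le> R"
  obtains N e where "real N \<le> t - s + 2" "e 0 = g" "e N = h" "\<And>i. e i \<in> carrier F2 \<times> UNIV"
    "\<And>i. dist (\<phi> (e i) x0) (\<phi> (e (Suc i)) x0) \<le> 2 * R + 1"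
    "\<And>i. \<exists>r\<in>{s..t}. dist (c r) (\<phi> (e i) x0) \<le> R"
proof -
  have c: "s \<le> t" "\<And>a. a \<in> {s..t} \<Longrightarrow> c a \<in> X"
    "\<And>a b. a \<in> {s..t} \<Longrightarrow> b \<in> {s..t} \<Longrightarrow> dist (c a) (c b) \<le> \<bar>a - b\<bar>"
    using path unfolding lipschitz_path_def by auto
  \<comment> \<open>The \<open>Suc\<close> keeps \<open>N\<close> positive, so the values prescribed
    at 0 and at \<open>N\<close> cannot clash even if \<open>s = t\<close>.\<close>
  define N where "N = Suc (nat \<lceil>t - s\<rceil>)"
  define r where "r = (\<lambda>i. min (s + real i) t)"
  have N: "real N \<le> t - s + 2" using c(1) unfolding N_def by linarith
  have rN: "r i = t" if "i \<ge> N" for i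
  proof -
    have "t - s \<le> real N" unfolding N_def by linarith
    also have "\<dots> \<le> real i" using that by simp
    finally show ?thesis by (simp add: r_def)
  qed
  have r: "r i \<in> {s..t}" for i using c(1) by (auto simp: r_def)
  have "\<exists>e\<in>carrier F2 \<times> UNIV. dist (c (r i)) (\<phi> e x0) \<le> R \<and> (i = 0 \<longrightarrow> e = g) \<and> (i \<ge> N \<longrightarrow> e = h)" for i
  proof -
    consider "i = 0" | "i \<ge> N" | "i \<noteq> 0" "\<not> i \<ge> N" by blast
    then show ?thesis
    proof cases
      case 1
      then have "r i = s" using c(1) by (simp add: r_def)
      then show ?thesis using 1 g ends by (intro bexI[of _ g]) (auto simp: N_def)
    next
      case 2
      then show ?thesis using g ends rN[OF 2] by (intro bexI[of _ h]) (auto simp: N_def)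
    next
      case 3
      then show ?thesis using R c(2) r by meson
    qed
  qed
  then obtain e where e: "\<And>i. e i \<in> carrier F2 \<times> UNIV" "\<And>i. dist (c (r i)) (\<phi> (e i) x0) \<le> R"
    "\<And>i. i = 0 \<longrightarrow> e i = g" "\<And>i. i \<ge> N \<longrightarrow> e i = h" by metis
  have "dist (\<phi> (e i) x0) (\<phi> (e (Suc i)) x0) \<le> 2 * R + 1" for i
  proof -
    have "dist (c (r i)) (c (r (Suc i))) \<le> 1"
      using c(3)[OF r r, of i "Suc i"] by (auto simp: r_def min_def split: if_splits)
    then show ?thesis
      using e(2)[of i] e(2)[of "Suc i"] dist_triangle[of "\<phi> (e i) x0" "\<phi> (e (Suc i)) x0" "c (r i)"]
        dist_triangle[of "c (r i)" "\<phi> (e (Suc i)) x0" "c (r (Suc i))"] by (simp add: dist_commute)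
  qed
  moreover have "e 0 = g" "e N = h" using e by auto
  moreover have "\<exists>r\<in>{s..t}. dist (c r) (\<phi> (e i) x0) \<le> R" for i using e(2) r by blast
  ultimately show thesis using that N e(1) by blast
qed

text \<open>A vertex \<open>p\<close> of the Cayley tree separates its branch from the rest. A
  coarse path enters the branch by one jump from a finite set of group elements, and the tree path
  of that jump runs through \<open>p\<close>.\<close>

lemma bottleneck:
  obtains B where "\<And>u m v n c s t p. u \<in> carrier F2 \<Longrightarrow> v \<in> carrier F2
     \<Longrightarrow> lipschitz_path s t c \<Longrightarrow> dist (c s) (\<phi> (u, m) x0) \<le> R \<Longrightarrow> dist (c t) (\<phi> (v, n) x0) \<le> R
     \<Longrightarrow> prefix p v \<Longrightarrow> \<not> prefix p u
     \<Longrightarrow> \<exists>r\<in>{s..t}. \<exists>k. dist (c r) (\<phi> (p, k) x0) \<le> B"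
proof -
  obtain R0 where R0: "\<forall>x\<in>X. \<exists>g\<in>carrier F2 \<times> UNIV. dist x (\<phi> g x0) \<le> R0"
    using cocompact by blast
  define R1 where "R1 = max R R0"
  have R1: "\<forall>x\<in>X. \<exists>g\<in>carrier F2 \<times> UNIV. dist x (\<phi> g x0) \<le> R1"
    using R0 unfolding R1_def by (meson max.coboundedI2)
  let ?S = "{g \<in> carrier F2 \<times> UNIV. dist x0 (\<phi> g x0) \<le> 2 * R1 + 1}"
  \<comment> \<open>The prefixes of all possible jumps; \<open>K\<close> bounds how far the crossing
    point is from the start of the jump.\<close>
  have "finite (\<Union>g\<in>?S. set (prefixes (fst g)))" using finite_ball by simp
  then obtain K where K: "\<And>q. q \<in> (\<Union>g\<in>?S. set (prefixes (fst g))) \<Longrightarrow> dist x0 (\<phi> (q, 0) x0) \<le> K"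
    by (rule finite_bounded_above[where f = "\<lambda>q. dist x0 (\<phi> (q, 0) x0)"]) blast
  show thesis
  proof (rule that[of "R1 + K"])
    fix u m v n c s t p
    assume u: "u \<in> carrier F2" "v \<in> carrier F2" and path: "lipschitz_path s t c"
      and ends: "dist (c s) (\<phi> (u, m) x0) \<le> R" "dist (c t) (\<phi> (v, n) x0) \<le> R"
      and p: "prefix p v" "\<not> prefix p u"
    have gm: "(u, m) \<in> carrier F2 \<times> UNIV" "(v, n) \<in> carrier F2 \<times> UNIV" using u by simp_all
    have ends1: "dist (c s) (\<phi> (u, m) x0) \<le> R1" "dist (c t) (\<phi> (v, n) x0) \<le> R1"
      using ends by (auto simp: R1_def)
    obtain N e where "real N \<le> t - s + 2" and e: "e 0 = (u, m)" "e N = (v, n)" "\<And>i. e i \<in> carrier F2 \<times> UNIV"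
      "\<And>i. dist (\<phi> (e i) x0) (\<phi> (e (Suc i)) x0) \<le> 2 * R1 + 1"
      "\<And>i. \<exists>r\<in>{s..t}. dist (c r) (\<phi> (e i) x0) \<le> R1"
      by (rule chain[OF gm path R1 ends1]) (rule that; assumption)
    \<comment> \<open>The first entry of the chain into the branch of \<open>p\<close>.\<close>
    have "\<exists>i<N. (\<forall>j\<le>i. \<not> prefix p (fst (e j))) \<and> prefix p (fst (e (Suc i)))"
      by (rule ex_least_nat_less) (use e p in auto)
    then obtain i where i: "\<not> prefix p (fst (e i))" "prefix p (fst (e (Suc i)))" by blast
    obtain a k where ak: "e i = (a, k)" "a \<in> carrier F2" using e(3)[of i] by (cases "e i") auto
    obtain b l where bl: "e (Suc i) = (b, l)" "b \<in> carrier F2" using e(3)[of "Suc i"] by (cases "e (Suc i)") auto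
    obtain q where q: "q \<in> carrier F2" "foldr push a q = b" using F2_quotient[OF ak(2) bl(2)] .
    have "\<phi> (e (Suc i)) x0 = \<phi> (a, k) (\<phi> (q, l - k) x0)"
      using act_mult[OF ak(2) q(1) x0] q bl by simp
    then have "dist x0 (\<phi> (q, l - k) x0) \<le> 2 * R1 + 1"
      using e(4)[of i] ak act_isom[of a x0 "\<phi> (q, l - k) x0" k] act_in[OF q(1) x0] x0 by simp
    then have qS: "(q, l - k) \<in> ?S" using q by simp
    obtain q' where q': "prefix q' q" "foldr push a q' = p"
      using foldr_push_crossing[of a q p] i ak bl q F2_reduced by auto
    have "q' \<in> (\<Union>g\<in>?S. set (prefixes (fst g)))"
      using qS q'(1) by (intro UN_I[OF qS]) simp
    then have "dist x0 (\<phi> (q', 0) x0) \<le> K" by (rule K)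
    moreover have q'F: "q' \<in> carrier F2" using q q' F2_prefix by blast
    moreover have "\<phi> (p, k) x0 = \<phi> (a, k) (\<phi> (q', 0) x0)"
      using act_mult[OF ak(2) q'F x0] q' by simp
    ultimately have "dist (\<phi> (e i) x0) (\<phi> (p, k) x0) \<le> K"
      using act_isom[of a x0 "\<phi> (q', 0) x0" k] act_in x0 ak by simp
    moreover obtain r where "r \<in> {s..t}" "dist (c r) (\<phi> (e i) x0) \<le> R1" using e(5) by blast
    ultimately show "\<exists>r\<in>{s..t}. \<exists>k. dist (c r) (\<phi> (p, k) x0) \<le> R1 + K"
      using dist_triangle[of _ "\<phi> (p, k) x0" "\<phi> (e i) x0"] by (meson add_mono order_trans)
  qed
qed

text \<open>The displacement of the generator \<open>z\<close> of the centre is invariant, so it attains its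
  minimum; comparing midpoints of \<open>x, z x\<close> shows that the minimal displacement is multiplicative
  in powers of \<open>z\<close>.\<close>

lemma minimal_displacement:
  obtains p l where "p \<in> X" "l > 0" "\<And>n. dist p (\<phi> ([], n) p) = \<bar>real_of_int n\<bar> * l"
proof -
  define \<delta> where "\<delta> = (\<lambda>n x. dist x (\<phi> ([], n) x))"
  obtain K where K: "K \<subseteq> X" "compact K" "(\<Union>g\<in>carrier (F2 \<times>\<times> integer_group). \<phi> g ` K) = X"
    using cocompact_set by (elim exE conjE)
  have "K \<noteq> {}" using K(3) x0 by auto
  moreover have "continuous_on K (\<delta> 1)"
    unfolding \<delta>_def
  proof (intro continuous_on_dist continuous_on_id)
    show "continuous_on K (\<phi> ([], 1))"
      unfolding continuous_on_iff using K(1) act_isom[of "[]" _ _ 1] by (metis Nil_F2 subsetD)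
  qed
  ultimately obtain p where p: "p \<in> K" "\<And>x. x \<in> K \<Longrightarrow> \<delta> 1 p \<le> \<delta> 1 x"
    using continuous_attains_inf[OF K(2), of "\<delta> 1"] by auto
  define l where "l = \<delta> 1 p"
  have pX: "p \<in> X" using p K by auto
  have min: "l \<le> \<delta> 1 x" if x: "x \<in> X" for x
  proof -
    obtain u n k where "u \<in> carrier F2" "k \<in> K" "x = \<phi> (u, n) k"
      using x unfolding K(3)[symmetric] by auto
    then show ?thesis using p(2)[of k] displacement_invariant[of u k n 1] K(1) unfolding \<delta>_def l_def by auto
  qed
  have double: "2 * L \<le> \<delta> (2 * m) x" if L: "\<And>x. x \<in> X \<Longrightarrow> L \<le> \<delta> m x" and x: "x \<in> X" for L m x
  proof -
    define y where "y = \<phi> ([], m) x"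
    define z where "z = \<phi> ([], m) y"
    have X: "y \<in> X" "z \<in> X" using x by (auto simp: y_def z_def act_in)
    have z: "z = \<phi> ([], 2 * m) x" using x by (simp add: y_def z_def act_central)
    have d: "dist y z = dist x y" using act_isom[of "[]" x y m] x X by (simp add: y_def z_def)
    define q where "q = gd X x y (dist x y / 2)"
    have "q \<in> X" using x X by (simp add: q_def gd_in)
    then have "L \<le> dist q (\<phi> ([], m) q)" using L by (simp add: \<delta>_def)
    also have "\<phi> ([], m) q = gd X y z (dist x y / 2)"
      using act_gd[of "[]" x y "dist x y / 2" m] x X by (simp add: q_def y_def z_def)
    also have "q = gd X y x (1/2 * dist y x)"
      using gd_commute[of x y "dist x y / 2"] x X by (simp add: q_def dist_commute)
    also have "dist x y / 2 = 1/2 * dist y z" using d by simp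
    also have "dist (gd X y x (1/2 * dist y x)) (gd X y z (1/2 * dist y z)) \<le> 1/2 * dist x z"
      by (rule gd_scale) (use x X in auto)
    finally show ?thesis using z by (simp add: \<delta>_def)
  qed
  have pow: "2 ^ k * l \<le> \<delta> (2 ^ k) x" if "x \<in> X" for k x
    using that
  proof (induction k arbitrary: x)
    case (Suc k)
    then show ?case using double[of "2 ^ k * l" "2 ^ k" x] by simp
  qed (use min in simp)
  have upper: "dist (\<phi> ([], m) p) (\<phi> ([], m + int n) p) \<le> real n * l" for m n
  proof (induction n)
    case (Suc n)
    have "\<phi> ([], m + int (Suc n)) p = \<phi> ([], m + int n) (\<phi> ([], 1) p)"
      using pX by (simp add: act_central algebra_simps)
    then have "dist (\<phi> ([], m + int n) p) (\<phi> ([], m + int (Suc n)) p) = l"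
      using act_isom[of "[]" p "\<phi> ([], 1) p" "m + int n"] pX act_in by (simp add: l_def \<delta>_def)
    then show ?case using Suc dist_triangle[of "\<phi> ([], m) p" "\<phi> ([], m + int (Suc n)) p" "\<phi> ([], m + int n) p"]
      by (simp add: algebra_simps)
  qed simp
  \<comment> \<open>Doubling only yields powers of two. A general \<open>n\<close> is squeezed:
    going on from \<open>n\<close> to \<open>2 ^ n\<close> adds at most
    \<open>(2 ^ n - n) * l\<close>, so nothing can have been lost up to \<open>n\<close>.\<close>
  have nat: "dist p (\<phi> ([], int n) p) = real n * l" for n
  proof (rule antisym)
    show "dist p (\<phi> ([], int n) p) \<le> real n * l" using upper[of 0 n] pX by (simp add: act_one)
    have n: "int n + int (2 ^ n - n) = 2 ^ n" using less_exp[of n] by (simp add: of_nat_diff)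
    have "2 ^ n * l \<le> dist p (\<phi> ([], 2 ^ n) p)" using pow[OF pX, of n] by (simp add: \<delta>_def)
    also have "\<dots> \<le> dist p (\<phi> ([], int n) p) + real (2 ^ n - n) * l"
      using upper[of "int n" "2 ^ n - n"] dist_triangle[of p "\<phi> ([], 2 ^ n) p" "\<phi> ([], int n) p"]
      unfolding n by linarith
    also have "real (2 ^ n - n) = 2 ^ n - real n" using less_exp[of n] by (simp add: of_nat_diff)
    finally show "real n * l \<le> dist p (\<phi> ([], int n) p)" by (simp add: algebra_simps)
  qed
  have all: "dist p (\<phi> ([], n) p) = \<bar>real_of_int n\<bar> * l" for n
  proof (cases "n \<ge> 0")
    case True
    then show ?thesis using nat[of "nat n"] by simp
  next
    case False
    have "\<phi> ([], - n) (\<phi> ([], n) p) = p" using pX by (simp add: act_central act_one)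
    then have "dist p (\<phi> ([], n) p) = dist (\<phi> ([], - n) p) p"
      using act_isom[of "[]" p "\<phi> ([], n) p" "- n"] pX act_in by simp
    then show ?thesis using nat[of "nat (- n)"] False by (simp add: dist_commute)
  qed
  have "l \<noteq> 0"
  proof
    assume "l = 0"
    then have "\<phi> ([], n) p = p" for n using all[of n] by simp
    then have "Pair [] ` (UNIV :: int set) \<subseteq> {g \<in> carrier (F2 \<times>\<times> integer_group). \<phi> g ` {p} \<inter> {p} \<noteq> {}}"
      by auto
    moreover have "finite {g \<in> carrier (F2 \<times>\<times> integer_group). \<phi> g ` {p} \<inter> {p} \<noteq> {}}"
      by (rule act_proper) (use pX in simp_all)
    ultimately have "finite (Pair ([] :: (nat \<times> bool) list) ` (UNIV :: int set))" by (rule finite_subset)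
    then have "finite (UNIV :: int set)" by (rule finite_imageD) (simp add: inj_on_def)
    then show False by simp
  qed
  then have "l > 0" using zero_le_dist unfolding l_def \<delta>_def by (metis less_eq_real_def)
  then show thesis using that pX all by blast
qed

end

text \<open>One half of the Svarc-Milnor lemma: a geodesic in \<open>X\<close> becomes a chain whose
  jumps lie in a finite set, and each jump moves \<open>y0\<close> by a bounded amount. Exchanging
  \<open>X\<close> and \<open>Y\<close> gives the other half.\<close>

lemma orbit_maps_lipschitz:
  assumes "F2Z_action X \<phi> x0" "F2Z_action Y \<psi> y0"
  obtains L where "L > 0" "\<And>g h. g \<in> carrier F2 \<times> UNIV \<Longrightarrow> h \<in> carrier F2 \<times> UNIV
    \<Longrightarrow> dist (\<psi> g y0) (\<psi> h y0) \<le> L * dist (\<phi> g x0) (\<phi> h x0) + L"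
proof -
  interpret X: F2Z_action X \<phi> x0 by fact
  interpret Y: F2Z_action Y \<psi> y0 by fact
  obtain R where R: "R \<ge> 0" "\<forall>x\<in>X. \<exists>g\<in>carrier F2 \<times> UNIV. dist x (\<phi> g x0) \<le> R"
    using X.cocompact by blast
  let ?S = "{g \<in> carrier F2 \<times> UNIV. dist x0 (\<phi> g x0) \<le> 2 * R + 1}"
  have "finite ?S" by (rule X.finite_ball)
  then obtain K where K: "\<And>g. g \<in> ?S \<Longrightarrow> dist y0 (\<psi> g y0) \<le> K"
    by (rule finite_bounded_above[where f = "\<lambda>g. dist y0 (\<psi> g y0)"]) blast
  define L where "L = 2 * max 1 K"
  have step: "dist (\<psi> (a, k) y0) (\<psi> (b, m) y0) \<le> max 1 K"
    if a: "a \<in> carrier F2" "b \<in> carrier F2" and d: "dist (\<phi> (a, k) x0) (\<phi> (b, m) x0) \<le> 2 * R + 1" for a k b m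
  proof -
    obtain q where q: "q \<in> carrier F2" "foldr push a q = b" using F2_quotient[OF a] .
    have "\<phi> (b, m) x0 = \<phi> (a, k) (\<phi> (q, m - k) x0)" using X.act_mult[OF a(1) q(1) X.x0] q by simp
    then have "(q, m - k) \<in> ?S"
      using d X.act_isom[of a x0 "\<phi> (q, m - k) x0" k] X.act_in[OF q(1) X.x0] X.x0 a q by simp
    then have "dist y0 (\<psi> (q, m - k) y0) \<le> K" by (rule K)
    moreover have "\<psi> (b, m) y0 = \<psi> (a, k) (\<psi> (q, m - k) y0)"
      using Y.act_mult[OF a(1) q(1) Y.x0] q by simp
    ultimately show ?thesis
      using Y.act_isom[of a y0 "\<psi> (q, m - k) y0" k] Y.act_in[OF q(1) Y.x0] Y.x0 a by simp
  qed
  show thesis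
  proof (rule that[of L])
    show "L > 0" by (simp add: L_def)
    fix g h :: "(nat \<times> bool) list \<times> int"
    assume gh: "g \<in> carrier F2 \<times> UNIV" "h \<in> carrier F2 \<times> UNIV"
    have gX: "\<phi> g x0 \<in> X" "\<phi> h x0 \<in> X" using gh X.act_in X.x0 by auto
    let ?d = "dist (\<phi> g x0) (\<phi> h x0)"
    obtain N e where e: "real N \<le> ?d - 0 + 2" "e 0 = g" "e N = h" "\<And>i. e i \<in> carrier F2 \<times> UNIV"
      "\<And>i. dist (\<phi> (e i) x0) (\<phi> (e (Suc i)) x0) \<le> 2 * R + 1"
      by (rule X.chain[OF gh X.lipschitz_path_gd[OF gX, of 0 ?d] R(2)])
        (use gX R in \<open>auto simp: X.gd_0 X.gd_end\<close>)
    have "dist (\<psi> (e 0) y0) (\<psi> (e n) y0) \<le> real n * max 1 K" for n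
    proof (induction n)
      case (Suc n)
      have "dist (\<psi> (e n) y0) (\<psi> (e (Suc n)) y0) \<le> max 1 K"
        using step[of "fst (e n)" "fst (e (Suc n))" "snd (e n)" "snd (e (Suc n))"] e(4)[of n] e(4)[of "Suc n"] e(5)[of n]
        by auto
      then show ?case using Suc dist_triangle[of "\<psi> (e 0) y0" "\<psi> (e (Suc n)) y0" "\<psi> (e n) y0"]
        by (simp add: algebra_simps)
    qed simp
    from this[of N] have "dist (\<psi> g y0) (\<psi> h y0) \<le> real N * max 1 K" using e by simp
    also have "\<dots> \<le> (?d + 2) * max 1 K" using e(1) by (intro mult_right_mono) auto
    also have "\<dots> \<le> L * ?d + L" by (simp add: L_def algebra_simps)
    finally show "dist (\<psi> g y0) (\<psi> h y0) \<le> L * ?d + L" .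
  qed
qed

section \<open>The height function\<close>

text \<open>\<open>b\<close> is a Busemann function of the attracting point of the centre \<open>\<langle>z\<rangle>\<close>. It takes the place of the
  projection to the line factor of the minimal set of \<open>z\<close>; being affine up to a bounded error
  is all that is used of the product structure.\<close>

locale height_action = F2Z_action X \<phi> x0
  for X :: "'a::metric_space set" and \<phi> :: "(nat \<times> bool) list \<times> int \<Rightarrow> 'a \<Rightarrow> 'a" and x0 :: 'a +
  fixes b :: "'a \<Rightarrow> real" and l C :: real
  assumes l: "l > 0" and C: "C \<ge> 0" and b0: "b x0 = 0"
    and b_lip: "x \<in> X \<Longrightarrow> y \<in> X \<Longrightarrow> \<bar>b x - b y\<bar> \<le> dist x y"
    and b_shift: "x \<in> X \<Longrightarrow> b (\<phi> ([], n) x) = b x + of_int n * l"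
    and b_affine: "x \<in> X \<Longrightarrow> y \<in> X \<Longrightarrow> 0 \<le> t \<Longrightarrow> t \<le> 1 \<Longrightarrow>
      \<bar>b (gd X x y (t * dist x y)) - ((1 - t) * b x + t * b y)\<bar> \<le> C"
    and orbit_z: "dist x0 (\<phi> ([], n) x0) \<le> \<bar>of_int n\<bar> * l + C"
    and orbit_quasiconvex: "x \<in> X \<Longrightarrow> y \<in> X \<Longrightarrow> u \<in> carrier F2 \<Longrightarrow> dist x (\<phi> (u, i) x0) \<le> R \<Longrightarrow>
      dist y (\<phi> (u, j) x0) \<le> R \<Longrightarrow> 0 \<le> t \<Longrightarrow> t \<le> 1 \<Longrightarrow>
      \<exists>k. dist (gd X x y (t * dist x y)) (\<phi> (u, k) x0) \<le> R + C"

section \<open>Construction of the height function\<close>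

context F2Z_action
begin

text \<open>Successive points of the axis are at distance \<open>l\<close>, so the sequence
  increases; it is bounded by \<open>dist x p\<close> in absolute value.\<close>

lemma busemann_limit:
  assumes p: "p \<in> X" "\<And>n. dist p (\<phi> ([], n) p) = \<bar>real_of_int n\<bar> * l" and s: "s \<in> {1, -1 :: int}"
    and x: "x \<in> X"
  shows "convergent (\<lambda>n. real n * l - dist x (\<phi> ([], s * int n) p))"
proof (rule Bseq_monoseq_convergent)
  let ?q = "\<lambda>n. \<phi> ([], s * int n) p"
  have d: "dist (?q n) (?q (Suc n)) = l" for n
  proof -
    have "?q (Suc n) = \<phi> ([], s * int n) (\<phi> ([], s) p)"
      using p(1) act_central(1)[of "[]" p "s * int n" s] by (simp add: algebra_simps)
    then show ?thesis
      using act_isom[of "[]" p "\<phi> ([], s) p" "s * int n"] p act_in s by auto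
  qed
  have inc: "incseq (\<lambda>n. real n * l - dist x (?q n))"
  proof (rule incseq_SucI)
    fix n show "real n * l - dist x (?q n) \<le> real (Suc n) * l - dist x (?q (Suc n))"
      using d[of n] dist_triangle[of x "?q (Suc n)" "?q n"] by (simp add: algebra_simps)
  qed
  then show "monoseq (\<lambda>n. real n * l - dist x (?q n))" by (rule incseq_imp_monoseq)
  have up: "real n * l - dist x (?q n) \<le> dist x p" for n
    using dist_triangle[of p "?q n" x] p(2)[of "s * int n"] s by (auto simp: dist_commute)
  have "- dist x p \<le> real n * l - dist x (?q n)" for n
    using incseqD[OF inc, of 0 n] act_one p by simp
  with up have "\<bar>real n * l - dist x (?q n)\<bar> \<le> dist x p" for n
    by (simp add: abs_le_iff) (metis minus_le_iff minus_diff_eq)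
  then show "Bseq (\<lambda>n. real n * l - dist x (?q n))" by (intro BseqI'[of _ "dist x p"]) simp
qed

text \<open>The translates of \<open>p\<close> are spaced by \<open>l\<close> along a geodesic, and
  \<open>k\<close> rounds the parameter down to a multiple of \<open>l\<close>.\<close>

lemma axis_quasiconvex:
  assumes p: "p \<in> X" "l > 0" "\<And>n. dist p (\<phi> ([], n) p) = \<bar>real_of_int n\<bar> * l"
    and t: "0 \<le> t" "t \<le> 1"
  shows "\<exists>k. dist (gd X (\<phi> ([], i) p) (\<phi> ([], j) p) (t * dist (\<phi> ([], i) p) (\<phi> ([], j) p))) (\<phi> ([], k) p) \<le> l"
proof -
  let ?q = "\<lambda>n. \<phi> ([], n) p"
  have q: "?q n \<in> X" for n using p act_in by simp
  have d: "dist (?q m) (?q n) = \<bar>real_of_int (n - m)\<bar> * l" for m n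
  proof -
    have "?q n = \<phi> ([], m) (?q (n - m))" using act_central(1)[of "[]" p m "n - m"] p by simp
    then show ?thesis using act_isom[of "[]" p "?q (n - m)" m] p q by simp
  qed
  have up: "\<exists>k. dist (gd X (?q i) (?q j) (t * dist (?q i) (?q j))) (?q k) \<le> l"
    if t: "0 \<le> t" "t \<le> 1" and ij: "i \<le> j" for t i j
  proof -
    let ?d = "dist (?q i) (?q j)"
    define k where "k = i + \<lfloor>t * ?d / l\<rfloor>"
    have dij: "?d = of_int (j - i) * l" using d ij by simp
    have fl: "of_int (k - i) * l \<le> t * ?d" "t * ?d < of_int (k - i) * l + l"
      using p(2) floor_divide_lower[of l "t * ?d"] floor_divide_upper[of l "t * ?d"]
      by (simp_all add: k_def algebra_simps)
    have ki: "k \<ge> i" using t p(2) by (simp add: k_def)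
    have td: "t * ?d \<le> ?d" "0 \<le> t * ?d" using t by (simp_all add: mult_left_le_one_le)
    have "of_int (k - i) * l \<le> of_int (j - i) * l" using fl td dij by linarith
    then have kj: "k \<le> j" using p(2) by simp
    have k: "?q k = gd X (?q i) (?q j) (of_int (k - i) * l)"
      by (rule geodesic_unique) (use q d ki kj ij in \<open>auto simp: algebra_simps\<close>)
    have "dist (gd X (?q i) (?q j) (t * ?d)) (?q k) = \<bar>t * ?d - of_int (k - i) * l\<bar>"
      unfolding k by (rule gd_dist) (use q fl td ki p(2) in auto)
    then show ?thesis using fl by (intro exI[of _ k]) auto
  qed
  show ?thesis
  proof (cases "i \<le> j")
    case True
    then show ?thesis using up t by blast
  next
    case False
    let ?d = "dist (?q i) (?q j)"
    have "gd X (?q i) (?q j) (t * ?d) = gd X (?q j) (?q i) ((1 - t) * dist (?q j) (?q i))"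
      using gd_commute[of "?q i" "?q j" "t * ?d"] q t
      by (simp add: mult_left_le_one_le algebra_simps dist_commute)
    then show ?thesis using up[of "1 - t" j i] t False by simp
  qed
qed

text \<open>The functions \<open>h 1\<close> and \<open>h (-1)\<close> of the two ends of the axis
  are concave, and their sum is bounded. So \<open>h 1\<close> is concave and, up to a constant, the
  negative of a concave function, hence affine up to that constant.\<close>

lemma height_exists:
  obtains b l C where "height_action X \<phi> x0 b l C"
proof -
  obtain p l where p: "p \<in> X" and l: "l > 0" and pl: "\<And>n. dist p (\<phi> ([], n) p) = \<bar>real_of_int n\<bar> * l"
    using minimal_displacement by blast
  let ?q = "\<lambda>n. \<phi> ([], n) p"
  have q: "?q n \<in> X" for n using p act_in by simp
  have dq: "dist (?q m) (?q n) = \<bar>real_of_int (n - m)\<bar> * l" for m n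
  proof -
    have "?q n = \<phi> ([], m) (?q (n - m))" using act_central(1)[of "[]" p m "n - m"] p by simp
    then show ?thesis using act_isom[of "[]" p "?q (n - m)" m] p pl q by simp
  qed
  \<comment> \<open>The negative of the usual Busemann function, so that the height increases
    towards the end of the axis and is concave.\<close>
  define h where "h = (\<lambda>s x. lim (\<lambda>n. real n * l - dist x (?q (s * int n))))"
  have h: "(\<lambda>n. real n * l - dist x (?q (s * int n))) \<longlonglongrightarrow> h s x"
    if "s \<in> {1, -1}" "x \<in> X" for s x
    using busemann_limit[OF p pl that] unfolding h_def by (simp add: convergent_LIMSEQ_iff)
  have lip1: "h s x \<le> h s y + dist x y" if s: "s \<in> {1, -1}" and "x \<in> X" "y \<in> X" for s x y
  proof (rule LIMSEQ_le[OF h[OF s that(2)] tendsto_add[OF h[OF s that(3)] tendsto_const]])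
    show "\<exists>N. \<forall>n\<ge>N. real n * l - dist x (?q (s * int n)) \<le> real n * l - dist y (?q (s * int n)) + dist x y"
      using dist_triangle[of y "?q (s * int _)" x] by (auto simp: dist_commute algebra_simps)
  qed
  have concave: "(1 - t) * h s x + t * h s y \<le> h s (gd X x y (t * dist x y))"
    if s: "s \<in> {1, -1}" and xy: "x \<in> X" "y \<in> X" and t: "0 \<le> t" "t \<le> 1" for s x y t
  proof (rule LIMSEQ_le)
    show "(\<lambda>n. (1 - t) * (real n * l - dist x (?q (s * int n))) + t * (real n * l - dist y (?q (s * int n))))
        \<longlonglongrightarrow> (1 - t) * h s x + t * h s y"
      by (intro tendsto_intros h s xy)
    show "(\<lambda>n. real n * l - dist (gd X x y (t * dist x y)) (?q (s * int n))) \<longlonglongrightarrow> h s (gd X x y (t * dist x y))"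
      by (intro h s gd_in xy)
    have "dist (gd X x y (t * dist x y)) z \<le> (1 - t) * dist x z + t * dist y z" if "z \<in> X" for z
      using gd_convex[of x y z z t] xy t that by (simp add: gd_0)
    from this[OF q] show "\<exists>N. \<forall>n\<ge>N. (1 - t) * (real n * l - dist x (?q (s * int n))) + t * (real n * l - dist y (?q (s * int n)))
        \<le> real n * l - dist (gd X x y (t * dist x y)) (?q (s * int n))"
      by (simp add: algebra_simps)
  qed
  have shift_nat: "h 1 (\<phi> ([], int m) x) = h 1 x + real m * l" if x: "x \<in> X" for m x
  proof (rule LIMSEQ_unique)
    have "(\<lambda>n. real (n + m) * l - dist (\<phi> ([], int m) x) (?q (1 * int (n + m)))) \<longlonglongrightarrow> h 1 (\<phi> ([], int m) x)"
      by (rule LIMSEQ_ignore_initial_segment[OF h]) (use x act_in in auto)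
    moreover have "dist (\<phi> ([], int m) x) (?q (1 * int (n + m))) = dist x (?q (1 * int n))" for n
    proof -
      have "?q (1 * int (n + m)) = \<phi> ([], int m) (?q (int n))"
        using act_central(1)[of "[]" p "int m" "int n"] p by (simp add: add.commute)
      then show ?thesis using act_isom[of "[]" x "?q (int n)" "int m"] x q by simp
    qed
    ultimately show "(\<lambda>n. (real n * l - dist x (?q (1 * int n))) + real m * l) \<longlonglongrightarrow> h 1 (\<phi> ([], int m) x)"
      by (simp add: algebra_simps)
    show "(\<lambda>n. (real n * l - dist x (?q (1 * int n))) + real m * l) \<longlonglongrightarrow> h 1 x + real m * l"
      by (intro tendsto_intros h x) simp
  qed
  have shift: "h 1 (\<phi> ([], n) x) = h 1 x + of_int n * l" if x: "x \<in> X" for n x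
  proof (cases "n \<ge> 0")
    case True
    then show ?thesis using shift_nat[OF x, of "nat n"] by simp
  next
    case False
    have "\<phi> ([], - n) (\<phi> ([], n) x) = x" using act_central(1)[of "[]" x "- n" n] x act_one by simp
    then show ?thesis using shift_nat[of "\<phi> ([], n) x" "nat (- n)"] x act_in False by simp
  qed
  have sum_le: "h 1 x + h (-1) x \<le> 0" if x: "x \<in> X" for x
  proof (rule LIMSEQ_le[OF tendsto_add[OF h h] tendsto_const])
    show "\<exists>N. \<forall>n\<ge>N. real n * l - dist x (?q (1 * int n)) + (real n * l - dist x (?q (- 1 * int n))) \<le> 0"
    proof (intro exI allI impI)
      fix n :: nat
      have "dist (?q (1 * int n)) (?q (- 1 * int n)) = 2 * (real n * l)" using dq by simp
      then show "real n * l - dist x (?q (1 * int n)) + (real n * l - dist x (?q (- 1 * int n))) \<le> 0"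
        using dist_triangle3[of "?q (1 * int n)" "?q (- 1 * int n)" x] by linarith
    qed
  qed (use x in auto)
  \<comment> \<open>A translate \<open>x\<close> of \<open>p\<close> is displaced by
    \<open>z\<^sup>n\<close> as far as \<open>p\<close> is. So the quadrilateral \<open>x\<close>,
    \<open>z\<^sup>n x\<close>, \<open>z\<^sup>n p\<close>, \<open>p\<close> has two sides of length
    \<open>N = l * n\<close> and two of length \<open>D\<close>; the sum of its diagonals exceeds
    \<open>2 * N\<close> by at most \<open>D\<^sup>2 / N\<close>, which tends to 0.\<close>
  have sum_orbit: "0 \<le> h 1 (\<phi> (u, m) p) + h (-1) (\<phi> (u, m) p)" if u: "u \<in> carrier F2" for u m
  proof -
    define x where "x = \<phi> (u, m) p"
    have x: "x \<in> X" using u p act_in by (simp add: x_def)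
    define D where "D = dist x p"
    have "0 \<le> h 1 x + h (-1) x"
    proof (rule LIMSEQ_le[OF _ tendsto_add[OF h h]])
      have "filterlim (\<lambda>n. l * real n) at_top sequentially"
        by (intro filterlim_tendsto_pos_mult_at_top[OF tendsto_const l filterlim_real_sequentially])
      then have "(\<lambda>n. D\<^sup>2 / (l * real n)) \<longlonglongrightarrow> 0"
        by (intro tendsto_divide_0[OF tendsto_const]) (rule filterlim_at_top_imp_at_infinity)
      then show "(\<lambda>n. - (D\<^sup>2 / (l * real n))) \<longlonglongrightarrow> 0" using tendsto_minus by fastforce
      show "\<exists>N. \<forall>n\<ge>N. - (D\<^sup>2 / (l * real n)) \<le>
          real n * l - dist x (?q (1 * int n)) + (real n * l - dist x (?q (- 1 * int n)))"
      proof (intro exI[of _ 1] allI impI)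
        fix n :: nat assume n: "n \<ge> 1"
        define N where "N = l * real n"
        have N: "N > 0" using n l by (simp add: N_def)
        define \<alpha> where "\<alpha> = dist x (?q (int n))"
        define \<beta> where "\<beta> = dist x (?q (- int n))"
        let ?zx = "\<phi> ([], int n) x"
        have zx: "?zx \<in> X" using x act_in by simp
        have s1: "dist x ?zx = N"
          using displacement_invariant[OF u p, of m "int n"] pl[of "int n"] by (simp add: x_def N_def mult.commute)
        have s2: "dist ?zx (?q (int n)) = D" using act_isom[of "[]" x p "int n"] x p by (simp add: D_def)
        have s3: "dist (?q (int n)) p = N" using pl[of "int n"] by (simp add: N_def dist_commute mult.commute)
        have "\<phi> ([], int n) (?q (- int n)) = p" using act_central(1)[of "[]" p "int n" "- int n"] p act_one by simp
        then have s4: "dist ?zx p = \<beta>" using act_isom[of "[]" x "?q (- int n)" "int n"] x q by (simp add: \<beta>_def)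
        have "\<alpha>\<^sup>2 + \<beta>\<^sup>2 \<le> N\<^sup>2 + D\<^sup>2 + N\<^sup>2 + D\<^sup>2"
          using quadrilateral[of x ?zx "?q (int n)" p] x zx q p
          by (simp add: s1 s2 s3 s4 \<alpha>_def[symmetric] D_def[symmetric] dist_commute[of p x])
        then have "(\<alpha> + \<beta>)\<^sup>2 \<le> 4 * (N\<^sup>2 + D\<^sup>2)"
          using sum_squares_bound[of \<alpha> \<beta>] by (simp add: power2_sum)
        also have "\<dots> \<le> (2 * N + D\<^sup>2 / N)\<^sup>2"
          using N by (simp add: power2_sum power_mult_distrib)
        finally have "\<alpha> + \<beta> \<le> 2 * N + D\<^sup>2 / N"
          by (rule power2_le_imp_le) (use N in simp)
        then show "- (D\<^sup>2 / (l * real n)) \<le>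
          real n * l - dist x (?q (1 * int n)) + (real n * l - dist x (?q (- 1 * int n)))"
          by (simp add: \<alpha>_def \<beta>_def N_def algebra_simps)
      qed
    qed (use x in auto)
    then show ?thesis by (simp add: x_def)
  qed
  obtain R where R: "R \<ge> 0" "\<forall>x\<in>X. \<exists>g\<in>carrier F2 \<times> UNIV. dist x (\<phi> g x0) \<le> R"
    using cocompact by blast
  define D0 where "D0 = dist x0 p"
  define R' where "R' = R + D0"
  have R': "R' \<ge> 0" using R by (simp add: R'_def D0_def)
  have sum_ge: "- 2 * R' \<le> h 1 x + h (-1) x" if x: "x \<in> X" for x
  proof -
    obtain u m where u: "u \<in> carrier F2" "dist x (\<phi> (u, m) x0) \<le> R" using R x by blast
    have y: "\<phi> (u, m) p \<in> X" using u p act_in by simp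
    have "dist x (\<phi> (u, m) p) \<le> R'"
      using u dist_triangle[of x "\<phi> (u, m) p" "\<phi> (u, m) x0"] act_isom[of u x0 p m] x0 p
      by (simp add: R'_def D0_def)
    then show ?thesis
      using sum_orbit[OF u(1), of m] lip1[of 1 "\<phi> (u, m) p" x] lip1[of "-1" "\<phi> (u, m) p" x] x y
      by (simp add: dist_commute)
  qed
  \<comment> \<open>One constant for all error terms: \<open>2 * R'\<close> for affinity,
    \<open>2 * D0\<close> for the passage between \<open>p\<close> and \<open>x0\<close>, and
    \<open>l\<close> for rounding on the axis.\<close>
  define C where "C = 2 * R' + 2 * D0 + l"
  define b where "b = (\<lambda>x. h 1 x - h 1 x0)"
  have "height_action X \<phi> x0 b l C"
  proof unfold_locales
    show "l > 0" by (rule l)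
    show "C \<ge> 0" using R' l by (simp add: C_def D0_def)
    show "b x0 = 0" by (simp add: b_def)
    show "\<bar>b x - b y\<bar> \<le> dist x y" if "x \<in> X" "y \<in> X" for x y
      using lip1[of 1 x y] lip1[of 1 y x] that by (simp add: b_def dist_commute)
    show "b (\<phi> ([], n) x) = b x + of_int n * l" if "x \<in> X" for x n
      using shift[OF that] by (simp add: b_def)
    show "\<bar>b (gd X x y (t * dist x y)) - ((1 - t) * b x + t * b y)\<bar> \<le> C"
      if "x \<in> X" "y \<in> X" "0 \<le> t" "t \<le> 1" for x y t
    proof -
      let ?m = "gd X x y (t * dist x y)"
      have 1: "(1 - t) * h 1 x + t * h 1 y \<le> h 1 ?m" "(1 - t) * h (-1) x + t * h (-1) y \<le> h (-1) ?m"
        using concave that by auto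
      have 2: "h 1 ?m + h (-1) ?m \<le> 0" using sum_le gd_in that by blast
      have "(1 - t) * (- 2 * R' - h 1 x) + t * (- 2 * R' - h 1 y) \<le> (1 - t) * h (-1) x + t * h (-1) y"
        using sum_ge[OF that(1)] sum_ge[OF that(2)] that(3,4) by (intro add_mono mult_left_mono) auto
      then have "- 2 * R' - ((1 - t) * h 1 x + t * h 1 y) \<le> h (-1) ?m" using 1 by (simp add: algebra_simps)
      then have 3: "h 1 ?m \<le> (1 - t) * h 1 x + t * h 1 y + 2 * R'" using 2 by linarith
      have "b ?m - ((1 - t) * b x + t * b y) = h 1 ?m - ((1 - t) * h 1 x + t * h 1 y)"
        by (simp add: b_def algebra_simps)
      then have "\<bar>b ?m - ((1 - t) * b x + t * b y)\<bar> \<le> 2 * R'" using 1 3 R' by (simp add: abs_le_iff)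
      also have "\<dots> \<le> C" using l by (simp add: C_def D0_def)
      finally show ?thesis .
    qed
    show "dist x0 (\<phi> ([], n) x0) \<le> \<bar>of_int n\<bar> * l + C" for n
      using dist_triangle[of x0 "\<phi> ([], n) x0" p] dist_triangle[of p "\<phi> ([], n) x0" "\<phi> ([], n) p"]
        act_isom[of "[]" p x0 n] pl[of n] x0 p R' l
      by (simp add: C_def D0_def dist_commute)
    show "\<exists>k. dist (gd X x y (t * dist x y)) (\<phi> (u, k) x0) \<le> R + C"
      if xy: "x \<in> X" "y \<in> X" and u: "u \<in> carrier F2" and d: "dist x (\<phi> (u, i) x0) \<le> R" "dist y (\<phi> (u, j) x0) \<le> R"
        and t: "0 \<le> t" "t \<le> 1" for x y u i j t R
    proof -
      have up: "\<phi> (u, n) p = \<phi> (u, 0) (?q n)" for n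
        using act_central(2)[of u p 0 n] act_mult[of u "[]" p 0 n] u p by (simp add: foldr_push_Nil F2_reduced)
      have px: "dist (\<phi> (u, n) p) (\<phi> (u, n) x0) = D0" for n
        using act_isom[of u p x0 n] u p x0 by (simp add: D0_def dist_commute)
      obtain k where k: "dist (gd X (?q i) (?q j) (t * dist (?q i) (?q j))) (?q k) \<le> l"
        using axis_quasiconvex[OF p l pl t] by blast
      let ?w = "gd X (?q i) (?q j) (t * dist (?q i) (?q j))"
      have wX: "?w \<in> X" using q gd_in by blast
      have "\<phi> (u, 0) ?w = gd X (\<phi> (u, i) p) (\<phi> (u, j) p) (t * dist (\<phi> (u, i) p) (\<phi> (u, j) p))"
        using act_gd[of u "?q i" "?q j" "t * dist (?q i) (?q j)" 0] act_isom[of u "?q i" "?q j" 0] u q t up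
        by (simp add: mult_left_le_one_le)
      moreover have "dist (gd X x y (t * dist x y)) (gd X (\<phi> (u, i) p) (\<phi> (u, j) p) (t * dist (\<phi> (u, i) p) (\<phi> (u, j) p)))
          \<le> (1 - t) * dist x (\<phi> (u, i) p) + t * dist y (\<phi> (u, j) p)"
        by (rule gd_convex) (use xy u p t act_in in auto)
      moreover have "\<dots> \<le> (1 - t) * (R + D0) + t * (R + D0)"
        using dist_triangle[of x "\<phi> (u, i) p" "\<phi> (u, i) x0"] dist_triangle[of y "\<phi> (u, j) p" "\<phi> (u, j) x0"]
          d px[of i] px[of j] t by (intro add_mono mult_left_mono) (auto simp: dist_commute)
      ultimately have 1: "dist (gd X x y (t * dist x y)) (\<phi> (u, 0) ?w) \<le> R + D0"
        by (simp add: algebra_simps)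
      have "dist (\<phi> (u, 0) ?w) (\<phi> (u, k) p) \<le> l"
        using k act_isom[of u ?w "?q k" 0] u q wX up by simp
      then have "dist (gd X x y (t * dist x y)) (\<phi> (u, k) x0) \<le> R + D0 + l + D0"
        using 1 px[of k] dist_triangle[of "gd X x y (t * dist x y)" "\<phi> (u, k) x0" "\<phi> (u, k) p"]
          dist_triangle[of "gd X x y (t * dist x y)" "\<phi> (u, k) p" "\<phi> (u, 0) ?w"] by linarith
      then show ?thesis using R' by (intro exI[of _ k]) (simp add: C_def)
    qed
  qed
  then show thesis using that by blast
qed

end

section \<open>Heights along geodesics; polar and nonpolar rays\<close>

context height_action
begin

lemma abs_height: "x \<in> X \<Longrightarrow> \<bar>b x\<bar> \<le> dist x0 x"
  using b_lip[of x x0] b0 x0 by (simp add: dist_commute)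

lemma b_orbit_z: "b (\<phi> ([], n) x0) = of_int n * l"
  using b_shift[OF x0] b0 by simp

text \<open>\<open>b_affine\<close> from the base point, where \<open>b\<close> vanishes, cleared of
  denominators: the slopes at radius \<open>r\<close> and at the end differ by at most
  \<open>C / r\<close>.\<close>

lemma b_gd:
  assumes "a \<in> X" "0 \<le> r" "r \<le> dist x0 a"
  shows "\<bar>dist x0 a * b (gd X x0 a r) - r * b a\<bar> \<le> C * dist x0 a"
proof (cases "dist x0 a = 0")
  case False
  let ?d = "dist x0 a"
  have d: "?d > 0" using False by simp
  define t where "t = r / ?d"
  have t: "0 \<le> t" "t \<le> 1" "t * ?d = r" using assms d by (auto simp: t_def)
  have "\<bar>b (gd X x0 a r) - t * b a\<bar> \<le> C" using b_affine[OF x0 assms(1) t(1,2)] t b0 by simp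
  then have "?d * \<bar>b (gd X x0 a r) - t * b a\<bar> \<le> ?d * C" using d by simp
  also have "?d * \<bar>b (gd X x0 a r) - t * b a\<bar> = \<bar>?d * b (gd X x0 a r) - (t * ?d) * b a\<bar>"
    using d by (simp add: abs_mult[of ?d, simplified, symmetric] algebra_simps)
  finally show ?thesis using t by (simp add: mult.commute)
qed (use assms in simp)

text \<open>Both the difference of heights and the difference of distances from \<open>x0\<close>
  bound \<open>dist a (\<phi> ([], j) x0)\<close> from below. In the sum of the two bounds
  \<open>j\<close> cancels, which accounts for the factor 2.\<close>

lemma far_from_centre:
  assumes a: "a \<in> X" and bd: "\<bar>b a\<bar> \<le> \<kappa> * dist x0 a + K"
  shows "(1 - \<kappa>) * dist x0 a - K - C \<le> 2 * dist a (\<phi> ([], j) x0)"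
proof -
  let ?e = "\<phi> ([], j) x0"
  have e: "?e \<in> X" using act_in x0 by simp
  have "\<bar>of_int j\<bar> * l - \<bar>b a\<bar> \<le> \<bar>b a - of_int j * l\<bar>"
    using l by (simp add: abs_mult[of _ l, simplified, symmetric])
  also have "\<dots> \<le> dist a ?e" using b_lip[OF a e] b_orbit_z by simp
  finally have "\<bar>of_int j\<bar> * l - \<bar>b a\<bar> \<le> dist a ?e" .
  moreover have "dist x0 a \<le> \<bar>of_int j\<bar> * l + C + dist a ?e"
    using orbit_z[of j] dist_triangle[of x0 a ?e] by (simp add: dist_commute)
  ultimately show ?thesis using bd by (simp add: algebra_simps)
qed

text \<open>A point whose height is almost its distance from the base point is close to \<open>\<langle>z\<rangle> x0\<close>:
  both have almost maximal height, hence so has their midpoint, which is therefore far away.\<close>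

lemma near_centre:
  obtains K where "K > 0" "\<And>a s. a \<in> X \<Longrightarrow> s \<in> {1, -1 :: int} \<Longrightarrow>
    (dist a (\<phi> ([], s * \<lfloor>dist x0 a / l\<rfloor>) x0))\<^sup>2
      \<le> K * (dist x0 a + K) * (dist x0 a - of_int s * b a + K)"
proof (rule that[of "4 + l + 4 * C"])
  show "4 + l + 4 * C > 0" using l C by simp
  fix a s assume a: "a \<in> X" and s: "s \<in> {1, -1 :: int}"
  define d where "d = dist x0 a"
  define j where "j = \<lfloor>d / l\<rfloor>"
  define e where "e = \<phi> ([], s * j) x0"
  define D where "D = dist a e"
  define \<beta> where "\<beta> = of_int s * b a"
  have d0: "d \<ge> 0" by (simp add: d_def)
  have j: "of_int j * l \<le> d" "d < of_int j * l + l" "j \<ge> 0"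
    using l d0 floor_divide_lower[of l d] floor_divide_upper[of l d] by (simp_all add: j_def algebra_simps)
  have e: "e \<in> X" using act_in x0 by (simp add: e_def)
  have "\<bar>real_of_int (s * j)\<bar> = of_int j" using s j by auto
  then have ed: "dist x0 e \<le> d + C" using orbit_z[of "s * j"] j by (simp add: e_def)
  have be: "of_int s * b e = of_int j * l" using b_orbit_z[of "s * j"] s by (auto simp: e_def)
  have \<beta>: "\<beta> \<le> d" using abs_height[OF a] s by (auto simp: \<beta>_def d_def)
  define m where "m = gd X a e (D / 2)"
  have m: "m \<in> X" using a e gd_in by (simp add: m_def)
  have "\<bar>b m - ((1 - 1/2) * b a + 1/2 * b e)\<bar> \<le> C"
    using b_affine[OF a e, of "1/2"] by (simp add: m_def D_def)
  then have "of_int s * b m \<ge> of_int s * b a / 2 + of_int s * b e / 2 - C"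
    using s by (auto simp: abs_le_iff)
  then have M: "2 * (of_int s * b m) \<ge> \<beta> + d - l - 2 * C" using be j by (simp add: \<beta>_def)
  have "of_int s * b m \<le> dist x0 m" using abs_height[OF m] s by auto
  then have M2: "2 * dist x0 m \<ge> \<beta> + d - l - 2 * C" using M by linarith
  have mid: "4 * (dist x0 m)\<^sup>2 \<le> 2 * d\<^sup>2 + 2 * (dist x0 e)\<^sup>2 - D\<^sup>2"
    using midpoint_ineq[OF a e x0] by (simp add: m_def D_def d_def)
  have "(dist x0 e)\<^sup>2 \<le> (d + C)\<^sup>2" "d\<^sup>2 \<le> (d + C)\<^sup>2" using ed C d0 by (auto intro!: power_mono)
  then have D2: "D\<^sup>2 \<le> 4 * (d + C)\<^sup>2 - (2 * dist x0 m)\<^sup>2" using mid by (simp add: power_mult_distrib)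
  have main: "D\<^sup>2 \<le> 4 * (d + C) * (d - \<beta> + l + 4 * C)"
  proof (cases "\<beta> + d - l - 2 * C \<ge> 0")
    case True
    then have "(\<beta> + d - l - 2 * C)\<^sup>2 \<le> (2 * dist x0 m)\<^sup>2" using M2 by (intro power_mono)
    then have "D\<^sup>2 \<le> 4 * (d + C)\<^sup>2 - (\<beta> + d - l - 2 * C)\<^sup>2" using D2 by linarith
    \<comment> \<open>A difference of squares, whose second factor is the defect
      \<open>d - \<beta>\<close> up to constants.\<close>
    also have "\<dots> = (2 * (d + C) + (\<beta> + d - l - 2 * C)) * (d - \<beta> + l + 4 * C)"
      by (simp add: power2_eq_square algebra_simps)
    also have "\<dots> \<le> 4 * (d + C) * (d - \<beta> + l + 4 * C)"
      using \<beta> l C by (intro mult_right_mono) auto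
    finally show ?thesis .
  next
    case False
    have "D\<^sup>2 \<le> 4 * (d + C)\<^sup>2" using D2 zero_le_power2[of "2 * dist x0 m"] by linarith
    also have "\<dots> = 4 * (d + C) * (d + C)" by (simp add: power2_eq_square)
    also have "\<dots> \<le> 4 * (d + C) * (d - \<beta> + l + 4 * C)"
      using False d0 C by (intro mult_left_mono) auto
    finally show ?thesis .
  qed
  also have "\<dots> \<le> (4 + l + 4 * C) * (d + (4 + l + 4 * C)) * (d - \<beta> + (4 + l + 4 * C))"
    using \<beta> l C d0 by (intro mult_mono) auto
  finally show "(dist a (\<phi> ([], s * \<lfloor>dist x0 a / l\<rfloor>) x0))\<^sup>2
      \<le> (4 + l + 4 * C) * (dist x0 a + (4 + l + 4 * C)) * (dist x0 a - of_int s * b a + (4 + l + 4 * C))"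
    by (simp add: D_def e_def j_def d_def \<beta>_def)
qed

text \<open>The additive constants make both notions stable under bounded errors. Polarity asks for
  a bounded defect and not only for asymptotic slope 1, so it is not evident that one of the two
  always holds.\<close>

definition nonpolar :: "(real \<Rightarrow> 'a) \<Rightarrow> bool" where
  "nonpolar c \<longleftrightarrow> (\<exists>\<kappa> K. \<kappa> < 1 \<and> (\<forall>t\<ge>0. \<bar>b (c t)\<bar> \<le> \<kappa> * t + K))"

definition polar :: "int \<Rightarrow> (real \<Rightarrow> 'a) \<Rightarrow> bool" where
  "polar s c \<longleftrightarrow> (\<exists>K. \<forall>t\<ge>0. t - K \<le> of_int s * b (c t))"

lemma b_ray:
  assumes c: "geodesic_ray X c" "c 0 = x0" and t: "0 \<le> t" "t \<le> T"
  shows "\<bar>T * b (c t) - t * b (c T)\<bar> \<le> C * T"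
  using b_gd[of "c T" t] ray_eq_gd[OF c(1) t] ray_in[OF c(1), of T] ray_dist[OF c(1), of 0 T] c t
  by simp

text \<open>If \<open>\<bar>b\<bar> + C < T\<close> at a single time \<open>T\<close>, almost
  linearity keeps the slope below \<open>(\<bar>b (c T)\<bar> + C) / T\<close> at all later times.
  Otherwise the defect is at most \<open>C\<close> at every positive time, and only the sign remains
  to be fixed.\<close>

lemma polar_or_nonpolar:
  assumes c: "geodesic_ray X c" "c 0 = x0"
  shows "nonpolar c \<or> (\<exists>s\<in>{1, -1}. polar s c)"
proof (cases "\<exists>T>0. \<bar>b (c T)\<bar> + C < T")
  case True
  then obtain T where T: "T > 0" "\<bar>b (c T)\<bar> + C < T" by blast
  define \<kappa> where "\<kappa> = (\<bar>b (c T)\<bar> + C) / T"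
  have \<kappa>: "0 \<le> \<kappa>" "\<kappa> < 1" "\<kappa> * T = \<bar>b (c T)\<bar> + C" using T C by (auto simp: \<kappa>_def)
  have "\<bar>b (c t)\<bar> \<le> \<kappa> * t + T" if t: "t \<ge> 0" for t
  proof (cases "t \<le> T")
    case True
    have "\<bar>b (c t)\<bar> \<le> t" using abs_height[of "c t"] ray_in[OF c(1) t] ray_dist[OF c(1), of 0 t] c t by simp
    also have "\<dots> \<le> \<kappa> * t + T" using True \<kappa> t mult_nonneg_nonneg[of \<kappa> t] by linarith
    finally show ?thesis .
  next
    case False
    have "T * \<bar>b (c t)\<bar> = \<bar>T * b (c t)\<bar>" using T by (simp add: abs_mult)
    also have "\<dots> \<le> \<bar>t * b (c T)\<bar> + C * t" using b_ray[OF c, of T t] T False by (simp add: abs_minus_commute)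
    also have "\<dots> = t * (\<kappa> * T)" using t \<kappa> by (simp add: abs_mult algebra_simps)
    finally have "T * \<bar>b (c t)\<bar> \<le> T * (\<kappa> * t)" by (simp add: algebra_simps)
    then have "\<bar>b (c t)\<bar> \<le> \<kappa> * t" using T by simp
    then show ?thesis using T by simp
  qed
  then show ?thesis using \<kappa> unfolding nonpolar_def by blast
next
  case False
  then have big: "T - C \<le> \<bar>b (c T)\<bar>" if "T > 0" for T using that by fastforce
  \<comment> \<open>A small defect at arbitrarily large times is carried back to every earlier time
    by \<open>b_ray\<close>.\<close>
  have pol: "polar s c" if s: "s \<in> {1, -1}" and ev: "\<And>T0. \<exists>T\<ge>T0. T - C \<le> of_int s * b (c T)" for s
    unfolding polar_def
  proof (intro exI[of _ "2 * C"] allI impI)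
    fix t :: real assume t: "t \<ge> 0"
    obtain T where T: "T \<ge> max 1 t" "T - C \<le> of_int s * b (c T)" using ev by blast
    have T0: "T > 0" "t \<le> T" using T by auto
    have "t * (T - C) \<le> t * (of_int s * b (c T))" using T t by (intro mult_left_mono)
    also have "\<dots> \<le> T * (of_int s * b (c t)) + C * T"
      using b_ray[OF c, of t T] t T0 s by (auto simp: abs_le_iff)
    finally have "T * t \<le> T * (of_int s * b (c t)) + C * T + C * t" by (simp add: algebra_simps)
    also have "\<dots> \<le> T * (of_int s * b (c t)) + C * T + C * T" using T0 C by (simp add: mult_left_mono)
    finally have "T * (t - 2 * C) \<le> T * (of_int s * b (c t))" by (simp add: algebra_simps)
    then show "t - 2 * C \<le> of_int s * b (c t)" using T0 by simp
  qed
  show ?thesis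
  proof (cases "\<forall>T0. \<exists>T\<ge>T0. T - C \<le> b (c T)")
    case True
    then show ?thesis using pol[of 1] by auto
  next
    case False
    then obtain T0 where T0: "\<And>T. T \<ge> T0 \<Longrightarrow> b (c T) < T - C" by fastforce
    have "\<exists>T\<ge>T1. T - C \<le> of_int (-1) * b (c T)" for T1
    proof -
      define T where "T = max (max T0 T1) 1"
      have "T \<ge> T0" "T > 0" "T \<ge> T1" by (auto simp: T_def)
      then show ?thesis using T0[of T] big[of T] by (intro exI[of _ T]) auto
    qed
    then show ?thesis using pol[of "-1"] by auto
  qed
qed

lemma sqrt_sublinear:
  fixes M e T0 :: real
  assumes "M \<ge> 0" "e > 0"
  shows "eventually (\<lambda>T. M * (T + M) \<le> (e * T)\<^sup>2) at_top"
  unfolding eventually_at_top_linorder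
proof (intro exI allI impI)
  fix T assume T: "max 1 (M * (1 + M) / e\<^sup>2) \<le> T"
  have "M * (1 + M) \<le> e\<^sup>2 * T" using T assms(2) by (simp add: field_simps)
  then have "M * (1 + M) * T \<le> e\<^sup>2 * T * T" using T by (intro mult_right_mono) auto
  moreover have "M * M \<le> M * M * T" using T assms by (simp add: mult_le_cancel_left1)
  ultimately show "M * (T + M) \<le> (e * T)\<^sup>2" by (simp add: power2_eq_square algebra_simps)
qed

text \<open>On a polar ray the last factor of \<open>near_centre\<close> is bounded, so the distance
  grows at most like a square root.\<close>

lemma polar_near_centre:
  assumes c: "geodesic_ray X c" "c 0 = x0" and s: "s \<in> {1, -1}" and pol: "polar s c"
  obtains M where "M \<ge> 0" "\<And>t. 0 \<le> t \<Longrightarrow> (dist (c t) (\<phi> ([], s * \<lfloor>t / l\<rfloor>) x0))\<^sup>2 \<le> M * (t + M)"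
proof -
  obtain K where K: "K > 0" "\<And>a s. a \<in> X \<Longrightarrow> s \<in> {1, -1 :: int} \<Longrightarrow>
    (dist a (\<phi> ([], s * \<lfloor>dist x0 a / l\<rfloor>) x0))\<^sup>2 \<le> K * (dist x0 a + K) * (dist x0 a - of_int s * b a + K)"
    using near_centre by blast
  obtain K' where K': "\<And>t. t \<ge> 0 \<Longrightarrow> t - K' \<le> of_int s * b (c t)" using pol unfolding polar_def by blast
  have K'0: "K' \<ge> 0" using K'[of 0] c b0 by simp
  define M where "M = K * (K' + K) + K"
  show thesis
  proof (rule that[of M])
    show "M \<ge> 0" using K K'0 by (simp add: M_def)
    fix t :: real assume t: "0 \<le> t"
    have ct: "c t \<in> X" "dist x0 (c t) = t" using ray_in[OF c(1) t] ray_dist[OF c(1), of 0 t] c t by auto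
    have "(dist (c t) (\<phi> ([], s * \<lfloor>t / l\<rfloor>) x0))\<^sup>2 \<le> K * (t + K) * (t - of_int s * b (c t) + K)"
      using K(2)[OF ct(1) s] ct by simp
    also have "\<dots> \<le> K * (t + K) * (K' + K)" using K'[OF t] K t by (intro mult_left_mono) auto
    also have "\<dots> = K * (K' + K) * (t + K)" by simp
    also have "\<dots> \<le> M * (t + M)" using K K'0 t by (intro mult_mono) (auto simp: M_def)
    finally show "(dist (c t) (\<phi> ([], s * \<lfloor>t / l\<rfloor>) x0))\<^sup>2 \<le> M * (t + M)" .
  qed
qed

text \<open>Both rays follow the same points of the centre orbit at sublinear distance.\<close>

lemma polar_unique:
  assumes c: "geodesic_ray X c" "c 0 = x0" and c': "geodesic_ray X c'" "c' 0 = x0"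
    and s: "s \<in> {1, -1}" and pol: "polar s c" "polar s c'" and r: "0 \<le> r"
  shows "c r = c' r"
proof (rule ray_eq_sublinear[OF c(1) c'(1) _ _ r])
  fix e T0 :: real assume e: "e > 0"
  obtain M where M: "M \<ge> 0" "\<And>t. 0 \<le> t \<Longrightarrow> (dist (c t) (\<phi> ([], s * \<lfloor>t / l\<rfloor>) x0))\<^sup>2 \<le> M * (t + M)"
    using polar_near_centre[OF c s pol(1)] by blast
  obtain M' where M': "M' \<ge> 0" "\<And>t. 0 \<le> t \<Longrightarrow> (dist (c' t) (\<phi> ([], s * \<lfloor>t / l\<rfloor>) x0))\<^sup>2 \<le> M' * (t + M')"
    using polar_near_centre[OF c' s pol(2)] by blast
  have "eventually (\<lambda>T. M * (T + M) \<le> (e / 2 * T)\<^sup>2 \<and> M' * (T + M') \<le> (e / 2 * T)\<^sup>2 \<and> max 0 T0 \<le> T) at_top"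
    by (intro eventually_conj sqrt_sublinear eventually_ge_at_top) (use M M' e in auto)
  then obtain T where T: "M * (T + M) \<le> (e / 2 * T)\<^sup>2" "M' * (T + M') \<le> (e / 2 * T)\<^sup>2" "max 0 T0 \<le> T"
    unfolding eventually_at_top_linorder by blast
  have "dist (c T) (\<phi> ([], s * \<lfloor>T / l\<rfloor>) x0) \<le> e / 2 * T"
    by (rule power2_le_imp_le[OF order_trans[OF M(2) T(1)]]) (use T e in auto)
  moreover have "dist (c' T) (\<phi> ([], s * \<lfloor>T / l\<rfloor>) x0) \<le> e / 2 * T"
    by (rule power2_le_imp_le[OF order_trans[OF M'(2) T(2)]]) (use T e in auto)
  ultimately have "dist (c T) (c' T) \<le> e * T"
    using dist_triangle2[of "c T" "c' T" "\<phi> ([], s * \<lfloor>T / l\<rfloor>) x0"] by simp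
  then show "\<exists>T\<ge>T0. dist (c T) (c' T) \<le> e * T" using T by auto
qed (use c c' in simp)

end

section \<open>Injectivity and surjectivity of limset maps\<close>

context cat0
begin

text \<open>By \<open>gd_close\<close> the geodesics differ at radius \<open>r\<close> by at most
  \<open>2 * r * R / t k\<close>.\<close>

lemma near_ray_tendsto:
  assumes c: "geodesic_ray X c" "c 0 = x0" and a: "\<And>k. a k \<in> X" and t: "filterlim t at_top F"
    and near: "\<And>k. dist (c (t k)) (a k) \<le> R"
  shows "filterlim (\<lambda>k. dist x0 (a k)) at_top F" "r > 0 \<Longrightarrow> ((\<lambda>k. gd X x0 (a k) r) \<longlongrightarrow> c r) F"
proof -
  have x0: "x0 \<in> X" using ray_in[OF c(1), of 0] c by simp
  have pos: "eventually (\<lambda>k. t k \<ge> T) F" for T using t by (simp add: filterlim_at_top)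
  show "filterlim (\<lambda>k. dist x0 (a k)) at_top F"
  proof (rule filterlim_at_top_mono)
    show "filterlim (\<lambda>k. - R + t k) at_top F" by (rule filterlim_tendsto_add_at_top[OF tendsto_const t])
    show "eventually (\<lambda>k. - R + t k \<le> dist x0 (a k)) F"
      using pos[of 0]
    proof eventually_elim
      case (elim k)
      then show ?case
        using near[of k] ray_dist[OF c(1), of 0 "t k"] dist_triangle2[of x0 "c (t k)" "a k"] c(2) by simp
    qed
  qed
  assume r: "r > 0"
  show "((\<lambda>k. gd X x0 (a k) r) \<longlongrightarrow> c r) F"
  proof (rule metric_tendsto_imp_tendsto[OF _ eventually_mono])
    show "((\<lambda>k. 2 * r * R / t k) \<longlongrightarrow> 0) F"
      by (intro tendsto_divide_0[OF tendsto_const] filterlim_at_top_imp_at_infinity t)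
    show "eventually (\<lambda>k. t k \<ge> r) F" by (rule pos)
    fix k assume k: "t k \<ge> r"
    have ct: "c (t k) \<in> X" "dist x0 (c (t k)) = t k"
      using ray_in[OF c(1), of "t k"] ray_dist[OF c(1), of 0 "t k"] c r k by auto
    have "t k * dist (gd X x0 (c (t k)) r) (gd X x0 (a k) r) \<le> 2 * r * dist (c (t k)) (a k)"
      using gd_close[of x0 "c (t k)" "a k" r] x0 ct a r k by simp
    also have "\<dots> \<le> 2 * r * R" using near r by simp
    finally have "dist (c r) (gd X x0 (a k) r) \<le> 2 * r * R / t k"
      using ray_eq_gd[OF c(1), of r "t k"] c r k by (simp add: field_simps)
    also have "\<dots> \<le> dist (2 * r * R / t k) 0" by (simp only: dist_real_def diff_0_right abs_ge_self)
    finally show "dist (gd X x0 (a k) r) (c r) \<le> dist (2 * r * R / t k) 0"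
      by (simp only: dist_commute)
  qed
qed

end

lemma (in F2Z_action) ray_near_orbit:
  obtains R where "R \<ge> 0" "\<And>c. geodesic_ray X c \<Longrightarrow>
    \<exists>g. \<forall>k::nat. g k \<in> carrier F2 \<times> UNIV \<and> dist (c (real k)) (\<phi> (g k) x0) \<le> R"
proof -
  obtain R where R: "R \<ge> 0" "\<forall>x\<in>X. \<exists>g\<in>carrier F2 \<times> UNIV. dist x (\<phi> g x0) \<le> R"
    using cocompact by blast
  show thesis
  proof (rule that[OF R(1)])
    fix c assume "geodesic_ray X c"
    then have "\<forall>k. \<exists>g. g \<in> carrier F2 \<times> UNIV \<and> dist (c (real k)) (\<phi> g x0) \<le> R"
      using R(2) ray_in by (meson of_nat_0_le_iff)
    then show "\<exists>g. \<forall>k::nat. g k \<in> carrier F2 \<times> UNIV \<and> dist (c (real k)) (\<phi> (g k) x0) \<le> R"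
      by (rule choice)
  qed
qed

lemma (in F2Z_action) orbit_in: "g \<in> carrier F2 \<times> UNIV \<Longrightarrow> \<phi> g x0 \<in> X"
  using act_in x0 by auto

context height_action
begin

lemma polar_not_nonpolar:
  assumes s: "s \<in> {1, -1}" and pol: "polar s c" shows "\<not> nonpolar c"
proof
  assume "nonpolar c"
  then obtain \<kappa> K where K: "\<kappa> < 1" "\<And>t. t \<ge> 0 \<Longrightarrow> \<bar>b (c t)\<bar> \<le> \<kappa> * t + K" unfolding nonpolar_def by blast
  obtain K' where K': "\<And>t. t \<ge> 0 \<Longrightarrow> t - K' \<le> of_int s * b (c t)" using pol unfolding polar_def by blast
  define t where "t = (\<bar>K\<bar> + \<bar>K'\<bar> + 1) / (1 - \<kappa>)"
  have t: "t \<ge> 0" using K(1) by (simp add: t_def)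
  have "of_int s * b (c t) \<le> \<bar>b (c t)\<bar>" using s by auto
  then have "t - K' \<le> \<kappa> * t + K" using K(2)[OF t] K'[OF t] by linarith
  then have "(1 - \<kappa>) * t \<le> K + K'" by (simp add: algebra_simps)
  moreover have "(1 - \<kappa>) * t = \<bar>K\<bar> + \<bar>K'\<bar> + 1" using K(1) by (simp add: t_def)
  ultimately show False by linarith
qed

lemma polar_opposite:
  assumes "polar 1 c" shows "\<not> polar (-1) c"
proof
  assume "polar (-1) c"
  then obtain K where K: "\<And>t. t \<ge> 0 \<Longrightarrow> t - K \<le> - b (c t)" unfolding polar_def by auto
  obtain K' where K': "\<And>t. t \<ge> 0 \<Longrightarrow> t - K' \<le> b (c t)" using assms unfolding polar_def by auto
  have "\<bar>K\<bar> + \<bar>K'\<bar> + 1 \<ge> 0" by simp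
  from K[OF this] K'[OF this] show False by linarith
qed

lemma finite_short_words: "finite {w \<in> carrier F2. length w \<le> n}"
  by (rule finite_subset[OF _ finite_lists_length_le[of "{0, 1} \<times> UNIV" n]])
    (auto simp: free_group_def)

lemma act_fibre:
  assumes "w \<in> carrier F2"
  shows "dist (\<phi> (w, n) x0) (\<phi> ([], n) x0) = dist x0 (\<phi> (w, 0) x0)"
proof -
  have "\<phi> (w, n) x0 = \<phi> ([], n) (\<phi> (w, 0) x0)" using act_central(1)[OF assms x0, of n 0] by simp
  then show ?thesis
    using act_isom[of "[]" "\<phi> (w, 0) x0" x0 n] act_in assms x0 by (simp add: dist_commute)
qed

lemma long_words:
  obtains M where "\<And>w n. w \<in> carrier F2 \<Longrightarrow> dist x0 (\<phi> (w, n) x0) \<le> D \<Longrightarrow> length w < M"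
proof -
  let ?S = "{g \<in> carrier F2 \<times> UNIV. dist x0 (\<phi> g x0) \<le> D}"
  have fin: "finite ((length \<circ> fst) ` ?S)" using finite_ball by simp
  show thesis
  proof (rule that[of "Suc (Max ((length \<circ> fst) ` ?S))"])
    fix w n assume "w \<in> carrier F2" "dist x0 (\<phi> (w, n) x0) \<le> D"
    then have "(w, n) \<in> ?S" by simp
    then have "(length \<circ> fst) (w, n) \<in> (length \<circ> fst) ` ?S" by (rule imageI)
    then show "length w < Suc (Max ((length \<circ> fst) ` ?S))"
      using Max_ge[OF fin] by (simp add: less_Suc_eq_le)
  qed
qed

text \<open>A ray that passes near the fibres of two long words visits the fibre of every prefix of
  each of them; a prefix of one word only would be visited before and after the ray comes close
  to the fibre of that word, against quasiconvexity of the fibres.\<close>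

lemma ray_prefix_unique:
  obtains M where "\<And>d N v n t v' n' t'. geodesic_ray X d \<Longrightarrow> d 0 = x0 \<Longrightarrow> v \<in> carrier F2 \<Longrightarrow> v' \<in> carrier F2
    \<Longrightarrow> length v = N + M \<Longrightarrow> length v' = N + M \<Longrightarrow> 0 \<le> t \<Longrightarrow> 0 \<le> t'
    \<Longrightarrow> dist (d t) (\<phi> (v, n) x0) \<le> B \<Longrightarrow> dist (d t') (\<phi> (v', n') x0) \<le> B \<Longrightarrow> take N v = take N v'"
proof -
  obtain B2 where B2: "\<And>u m v n c s t p. u \<in> carrier F2 \<Longrightarrow> v \<in> carrier F2 \<Longrightarrow> lipschitz_path s t c
     \<Longrightarrow> dist (c s) (\<phi> (u, m) x0) \<le> max 0 B \<Longrightarrow> dist (c t) (\<phi> (v, n) x0) \<le> max 0 B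
     \<Longrightarrow> prefix p v \<Longrightarrow> \<not> prefix p u
     \<Longrightarrow> \<exists>r\<in>{s..t}. \<exists>k. dist (c r) (\<phi> (p, k) x0) \<le> B2"
    using bottleneck[of "max 0 B"] by blast
  obtain M where M: "\<And>w n. w \<in> carrier F2 \<Longrightarrow> dist x0 (\<phi> (w, n) x0) \<le> B + (B2 + C) \<Longrightarrow> length w < M"
    using long_words[of "B + (B2 + C)"] by blast
  have main: "take N v = take N v'"
    if d: "geodesic_ray X d" "d 0 = x0" and v: "v \<in> carrier F2" "v' \<in> carrier F2"
      and len: "length v = N + M" "length v' = N + M" and t: "0 \<le> t" "t \<le> t'"
      and near: "dist (d t) (\<phi> (v, n) x0) \<le> B" "dist (d t') (\<phi> (v', n') x0) \<le> B" for d N v n t v' n' t'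
  proof (rule ccontr)
    assume ne: "take N v \<noteq> take N v'"
    define p where "p = take N v"
    have lp: "length p = N" using len by (simp add: p_def)
    have "take N v' = p" if "prefix p v'" using that lp by (auto simp: prefix_def)
    moreover have "take N v' = p" if "prefix p []" using that lp by auto
    ultimately have p: "prefix p v" "\<not> prefix p v'" "\<not> prefix p []"
      using ne take_is_prefix[of N v] unfolding p_def by metis+
    have pF: "p \<in> carrier F2" using F2_prefix v p by blast
    have near': "dist (d t) (\<phi> (v, n) x0) \<le> max 0 B" "dist (d t') (\<phi> (v', n') x0) \<le> max 0 B"
      using near by auto
    have start: "dist (d 0) (\<phi> ([], 0) x0) \<le> max 0 B" using act_one[OF x0] d by simp
    obtain r0 k0 where r0: "r0 \<in> {0..t}" "dist (d r0) (\<phi> (p, k0) x0) \<le> B2"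
      using B2[OF Nil_F2 v(1) lipschitz_path_ray[OF d(1) order_refl t(1)] start near'(1) p(1) p(3)] by blast
    \<comment> \<open>\<open>bottleneck\<close> needs a path that leads into the branch of
      \<open>p\<close>; from \<open>v'\<close> to \<open>v\<close> the ray runs backwards.\<close>
    have "lipschitz_path (- t') (- t) (\<lambda>s. d (- s))"
      unfolding lipschitz_path_def
    proof (intro conjI ballI)
      show "(\<lambda>s. d (- s)) ` {- t'..- t} \<subseteq> X" using ray_in[OF d(1)] t by auto
      fix a b assume "a \<in> {- t'..- t}" "b \<in> {- t'..- t}"
      then show "dist (d (- a)) (d (- b)) \<le> \<bar>a - b\<bar>" using ray_dist[OF d(1), of "- a" "- b"] t by auto
    qed (use t in auto)
    from B2[OF v(2) v(1) this _ _ p(1,2)] near'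
    obtain r1 k1 where r1': "r1 \<in> {- t'..- t}" "dist (d (- r1)) (\<phi> (p, k1) x0) \<le> B2"
      by fastforce
    define r where "r = - r1"
    have r1: "t \<le> r" "dist (d r) (\<phi> (p, k1) x0) \<le> B2" using r1' by (auto simp: r_def)
    \<comment> \<open>The position of \<open>t\<close> between the two visits \<open>r0\<close> and
      \<open>r\<close> to the fibre of \<open>p\<close>. If these coincide, then \<open>t\<close>
      equals both and 0 is a valid choice.\<close>
    define \<tau> where "\<tau> = (if r = r0 then 0 else (t - r0) / (r - r0))"
    have \<tau>: "0 \<le> \<tau>" "\<tau> \<le> 1" "\<tau> * (r - r0) = t - r0"
      using r0 r1 by (auto simp: \<tau>_def)
    have X: "d r0 \<in> X" "d r \<in> X" "d t \<in> X" using ray_in[OF d(1)] r0 r1 t by auto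
    have dr: "dist (d r0) (d r) = r - r0" using ray_dist[OF d(1), of r0 r] r0 r1 by auto
    have "d t = gd X (d r0) (d r) (t - r0)"
      by (rule geodesic_unique) (use X dr ray_dist[OF d(1)] r0 r1 in auto)
    then have "d t = gd X (d r0) (d r) (\<tau> * dist (d r0) (d r))" using dr \<tau> by simp
    then obtain k where k: "dist (d t) (\<phi> (p, k) x0) \<le> B2 + C"
      using orbit_quasiconvex[OF X(1,2) pF r0(2) r1(2) \<tau>(1,2)] by auto
    \<comment> \<open>At time \<open>t\<close> the ray is near the fibres of both \<open>p\<close>
      and \<open>v\<close>, so the remainder \<open>q\<close> moves \<open>x0\<close> only
      boundedly. Its length is \<open>M\<close>, which was chosen to exclude this.\<close>
    define q where "q = drop N v"
    have v_eq: "p @ q = v" by (simp add: p_def q_def)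
    have q: "q \<in> carrier F2" "foldr push p q = v" using F2_append[of p q] v v_eq by auto
    have "dist (\<phi> (p, k) x0) (\<phi> (v, n) x0) = dist x0 (\<phi> (q, n - k) x0)"
      using act_mult[OF pF q(1) x0, of k "n - k"] act_isom[OF pF x0, of "\<phi> (q, n - k) x0" k] act_in q x0 by simp
    then have "dist x0 (\<phi> (q, n - k) x0) \<le> B + (B2 + C)"
      using near(1) k dist_triangle3[of "\<phi> (p, k) x0" "\<phi> (v, n) x0" "d t"] by linarith
    then have "length q < M" using M q by blast
    then show False using len by (simp add: q_def)
  qed
  show thesis
  proof (rule that[of M])
    fix d N v n t v' n' t'
    assume *: "geodesic_ray X d" "d 0 = x0" "v \<in> carrier F2" "v' \<in> carrier F2"
      "length v = N + M" "length v' = N + M" "0 \<le> t" "0 \<le> t'"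
      "dist (d t) (\<phi> (v, n) x0) \<le> B" "dist (d t') (\<phi> (v', n') x0) \<le> B"
    show "take N v = take N v'"
    proof (cases "t \<le> t'")
      case True
      then show ?thesis using main[OF *(1-7) _ *(9,10)] by blast
    next
      case False
      then have "t' \<le> t" by simp
      then show ?thesis using main[OF *(1,2,4,3,6,5,8) _ *(10,9)] by simp
    qed
  qed
qed

end

section \<open>Passing polarity, slopes and words from X to Y\<close>

locale limset_pair = X: height_action X \<phi> x0 b l C + Y: height_action Y \<psi> y0 b' l' C'
  for X :: "'a::metric_space set" and \<phi> x0 b l C
    and Y :: "'b::metric_space set" and \<psi> y0 b' l' C' +
  fixes f :: "(real \<Rightarrow> 'a) set \<Rightarrow> (real \<Rightarrow> 'b) set"
  assumes f: "limset_map (F2 \<times>\<times> integer_group) X \<phi> x0 Y \<psi> y0 f"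
begin

lemma f_boundary: "\<xi> \<in> visual_boundary X \<Longrightarrow> f \<xi> \<in> visual_boundary Y"
  using f unfolding limset_map_def by blast

lemma limset_tendsto:
  assumes a: "\<And>i. a i \<in> carrier F2 \<times> UNIV"
    and \<xi>: "\<xi> \<in> visual_boundary X" "c \<in> \<xi>" "c 0 = x0"
    and far: "filterlim (\<lambda>i. dist x0 (\<phi> (a i) x0)) at_top F"
    and lim: "\<And>r. r > 0 \<Longrightarrow> ((\<lambda>i. gd X x0 (\<phi> (a i) x0) r) \<longlongrightarrow> c r) F"
    and d: "d \<in> f \<xi>" "d 0 = y0" and r: "r > 0"
  shows "((\<lambda>i. gd Y y0 (\<psi> (a i) y0) r) \<longlongrightarrow> d r) F" "eventually (\<lambda>i. r < dist y0 (\<psi> (a i) y0)) F"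
proof -
  have *: "\<phi> g x0 \<in> X" "\<psi> g y0 \<in> Y" if "g \<in> carrier (F2 \<times>\<times> integer_group)" for g
    using that X.orbit_in Y.orbit_in by auto
  have a': "a i \<in> carrier (F2 \<times>\<times> integer_group)" for i using a[of i] by auto
  show "((\<lambda>i. gd Y y0 (\<psi> (a i) y0) r) \<longlongrightarrow> d r) F" "eventually (\<lambda>i. r < dist y0 (\<psi> (a i) y0)) F"
    using limset_map_tendsto[OF X.cat0_axioms Y.cat0_axioms X.x0 Y.x0 * f a' \<xi> far lim d r] by auto
qed

text \<open>Applies to every sequence of group elements that accompanies the ray, whatever the
  times; this freedom allows sampling at multiples of \<open>l\<close> or at visits to
  fibres.\<close>

lemma limset_near_ray:
  assumes \<xi>: "\<xi> \<in> visual_boundary X" "c \<in> \<xi>" "c 0 = x0" and d: "d \<in> f \<xi>" "d 0 = y0"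
    and a: "\<And>k. a k \<in> carrier F2 \<times> UNIV" and t: "filterlim t at_top F"
    and near: "\<And>k. dist (c (t k)) (\<phi> (a k) x0) \<le> R" and r: "r > 0" and e: "e > 0"
  shows "eventually (\<lambda>k. r < dist y0 (\<psi> (a k) y0) \<and> dist (gd Y y0 (\<psi> (a k) y0) r) (d r) < e) F"
proof -
  have ray: "geodesic_ray X c" using X.boundary_ray \<xi> by blast
  have aX: "\<phi> (a k) x0 \<in> X" for k using X.orbit_in a by blast
  note lim = limset_tendsto[OF a \<xi> X.near_ray_tendsto(1)[OF ray \<xi>(3) aX t near]
    X.near_ray_tendsto(2)[OF ray \<xi>(3) aX t near] d r]
  show ?thesis
    using lim(2) tendstoD[OF lim(1) e] by (rule eventually_conj)
qed

text \<open>A polar ray stays within sublinear distance of \<open>\<langle>z\<rangle> x0\<close>, and this passes to \<open>Y\<close>.\<close>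

lemma polar_image:
  assumes \<xi>: "\<xi> \<in> visual_boundary X" "c \<in> \<xi>" "c 0 = x0" and d: "d \<in> f \<xi>" "d 0 = y0"
    and s: "s \<in> {1, -1}" and pol: "X.polar s c"
  shows "Y.polar s d"
  unfolding Y.polar_def
\<comment> \<open>\<open>C'\<close> stems from \<open>b_gd\<close>, one unit from the error of the
  slope, and one from replacing the approximating geodesic by \<open>d\<close>.\<close>
proof (intro exI[of _ "C' + 2"] allI impI)
  fix r :: real assume r0: "0 \<le> r"
  have ray: "geodesic_ray X c" using X.boundary_ray \<xi> by blast
  have ray': "geodesic_ray Y d" using Y.boundary_ray f_boundary \<xi> d by blast
  show "r - (C' + 2) \<le> of_int s * b' (d r)"
  proof (cases "r = 0")
    case True
    then show ?thesis using d Y.b0 Y.C by simp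
  next
    case False
    then have r: "r > 0" using r0 by simp
    obtain L where L: "L > 0" "\<And>g h. g \<in> carrier F2 \<times> UNIV \<Longrightarrow> h \<in> carrier F2 \<times> UNIV
      \<Longrightarrow> dist (\<psi> g y0) (\<psi> h y0) \<le> L * dist (\<phi> g x0) (\<phi> h x0) + L"
      using orbit_maps_lipschitz[OF X.F2Z_action_axioms Y.F2Z_action_axioms] by blast
    obtain M where M: "M \<ge> 0" "\<And>t. 0 \<le> t \<Longrightarrow> (dist (c t) (\<phi> ([], s * \<lfloor>t / l\<rfloor>) x0))\<^sup>2 \<le> M * (t + M)"
      using X.polar_near_centre[OF ray \<xi>(3) s pol] by blast
    obtain R where R: "R \<ge> 0" "\<forall>x\<in>X. \<exists>g\<in>carrier F2 \<times> UNIV. dist x (\<phi> g x0) \<le> R"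
      using X.cocompact by blast
    \<comment> \<open>At times \<open>n * l\<close> the floor in the bound by \<open>M\<close> is
      just \<open>n\<close>.\<close>
    have "\<exists>g. g \<in> carrier F2 \<times> UNIV \<and> dist (c (real n * l)) (\<phi> g x0) \<le> R" for n
      using R(2) X.ray_in[OF ray, of "real n * l"] X.l by (meson mult_nonneg_nonneg of_nat_0_le_iff less_imp_le)
    then obtain g where g: "\<And>n. g n \<in> carrier F2 \<times> UNIV" "\<And>n. dist (c (real n * l)) (\<phi> (g n) x0) \<le> R"
      by metis
    have T: "filterlim (\<lambda>n. real n * l) at_top sequentially"
      using filterlim_tendsto_pos_mult_at_top[OF tendsto_const X.l filterlim_real_sequentially]
      by (simp add: mult.commute)
    \<comment> \<open>The orbit point \<open>a\<close> below will have signed height at least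
      \<open>n * l' - e * n\<close> and distance at most \<open>n * l' + 2 * e * n\<close>, hence a
      defect of at most \<open>3 * e * n\<close>. The choice makes \<open>r\<close> times this at
      most \<open>dist y0 a\<close>, a loss of 1 at radius \<open>r\<close>.\<close>
    define e where "e = l' / (6 * (r + 1))"
    have e: "e > 0" "e \<le> l' / 6" "3 * e * r \<le> l' / 2"
      using Y.l r by (auto simp: e_def field_simps)
    define e1 where "e1 = e / (2 * L * l)"
    have e1: "e1 > 0" "L * e1 * l = e / 2" using e L X.l by (auto simp: e1_def)
    have 1: "eventually (\<lambda>n. M * (real n * l + M) \<le> (e1 * (real n * l))\<^sup>2) sequentially"
      using X.sqrt_sublinear[OF M(1) e1(1)] T by (rule eventually_compose_filterlim)
    have 2: "eventually (\<lambda>n. real n \<ge> max 1 (max (L * (R + 1) / (e / 2)) (C' / e))) sequentially"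
      using filterlim_real_sequentially by (simp only: filterlim_at_top)
    have 3: "eventually (\<lambda>n. r < dist y0 (\<psi> (g n) y0) \<and> dist (gd Y y0 (\<psi> (g n) y0) r) (d r) < 1) sequentially"
      by (rule limset_near_ray[OF \<xi> d g(1) T g(2) r]) simp
    obtain n where n: "M * (real n * l + M) \<le> (e1 * (real n * l))\<^sup>2"
      "real n \<ge> max 1 (max (L * (R + 1) / (e / 2)) (C' / e))"
      "r < dist y0 (\<psi> (g n) y0)" "dist (gd Y y0 (\<psi> (g n) y0) r) (d r) < 1"
      using eventually_happens'[OF _ eventually_conj[OF 1 eventually_conj[OF 2 3]]] by auto
    have n1: "L * (R + 1) \<le> e / 2 * real n" "C' \<le> e * real n" "real n \<ge> 1"
      using n(2) e by (auto simp: field_simps)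
    define z where "z = \<psi> ([], s * int n) y0"
    define a where "a = \<psi> (g n) y0"
    have zY: "z \<in> Y" "a \<in> Y" using Y.act_in Y.x0 Y.orbit_in g by (auto simp: z_def a_def)
    have "(dist (c (real n * l)) (\<phi> ([], s * int n) x0))\<^sup>2 \<le> (e1 * (real n * l))\<^sup>2"
      using M(2)[of "real n * l"] n(1) X.l by simp
    then have "dist (c (real n * l)) (\<phi> ([], s * int n) x0) \<le> e1 * (real n * l)"
      by (rule power2_le_imp_le) (use e1 X.l in simp)
    then have "dist (\<phi> (g n) x0) (\<phi> ([], s * int n) x0) \<le> R + e1 * (real n * l)"
      using g(2)[of n] dist_triangle3[of "\<phi> (g n) x0" "\<phi> ([], s * int n) x0" "c (real n * l)"] by linarith
    then have "dist a z \<le> L * (R + e1 * (real n * l)) + L"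
      using L(2)[OF g(1)[of n], of "([], s * int n)"] L(1) Nil_F2
      by (simp add: a_def z_def) (meson add_right_mono mult_left_mono less_imp_le order_trans)
    also have "\<dots> = L * (R + 1) + L * e1 * l * real n" by (simp add: algebra_simps)
    also have "\<dots> \<le> e * real n" unfolding e1(2) using n1(1) by linarith
    finally have az: "dist a z \<le> e * real n" .
    have bz: "of_int s * b' z = real n * l'" using Y.b_orbit_z[of "s * int n"] s by (auto simp: z_def)
    have "of_int s * b' z \<le> of_int s * b' a + dist a z"
      using Y.b_lip[of a z] zY s by (auto simp: abs_le_iff)
    then have S: "real n * l' - e * real n \<le> of_int s * b' a" using az bz by linarith
    have "\<bar>real_of_int (s * int n)\<bar> = real n" using s by auto
    then have "dist y0 z \<le> real n * l' + C'" using Y.orbit_z[of "s * int n"] by (simp add: z_def)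
    then have D: "dist y0 a \<le> real n * l' + 2 * (e * real n)"
      using az n1 dist_triangle2[of y0 a z] by linarith
    have aS: "of_int s * b' a \<le> dist y0 a" using Y.abs_height[OF zY(2)] s by auto
    have "e * real n \<le> l' / 6 * real n" using e by (intro mult_right_mono) auto
    then have D2: "real n * l' / 2 \<le> dist y0 a"
    proof -
      have "0 \<le> real n * l'" using Y.l by simp
      moreover have "e * real n \<le> real n * l' / 6" using \<open>e * real n \<le> l' / 6 * real n\<close> by (simp add: mult.commute)
      ultimately show ?thesis using S aS by linarith
    qed
    have "3 * e * r * real n \<le> l' / 2 * real n" using e by (intro mult_right_mono) auto
    then have er: "r * (3 * (e * real n)) \<le> dist y0 a" using D2 by (simp add: algebra_simps)
    have "r * dist y0 a - dist y0 a \<le> r * (dist y0 a - 3 * (e * real n))"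
      using er by (simp add: algebra_simps)
    also have "\<dots> \<le> r * (of_int s * b' a)" using S D r by (intro mult_left_mono) auto
    also have "\<dots> \<le> dist y0 a * (of_int s * b' (gd Y y0 a r)) + C' * dist y0 a"
      using Y.b_gd[OF zY(2) r0] n(3) s by (auto simp: a_def abs_le_iff)
    finally have "dist y0 a * (r - 1 - C') \<le> dist y0 a * (of_int s * b' (gd Y y0 a r))"
      by (simp add: algebra_simps)
    then have 4: "r - 1 - C' \<le> of_int s * b' (gd Y y0 a r)"
      by (rule mult_left_le_imp_le) (unfold a_def, rule less_trans[OF r n(3)])
    have "\<bar>b' (gd Y y0 a r) - b' (d r)\<bar> \<le> 1"
      using Y.b_lip[of "gd Y y0 a r" "d r"] Y.gd_in Y.x0 zY Y.ray_in[OF ray' r0] n(4) by (simp add: a_def)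
    then show ?thesis using 4 s by (auto simp: abs_le_iff)
  qed
qed

text \<open>Conversely, a nonpolar ray diverges linearly from \<open>\<langle>z\<rangle> x0\<close>, and this passes to \<open>Y\<close> as well.\<close>

lemma nonpolar_slope:
  assumes ray: "geodesic_ray X c" "c 0 = x0" and np: "X.nonpolar c"
  obtains \<kappa> K where "0 \<le> \<kappa>" "\<kappa> < 1" "0 \<le> K" "\<And>t g. 0 \<le> t \<Longrightarrow> g \<in> carrier F2 \<times> UNIV \<Longrightarrow>
    dist (c t) (\<phi> g x0) \<le> R \<Longrightarrow> \<bar>b' (\<psi> g y0)\<bar> \<le> \<kappa> * dist y0 (\<psi> g y0) + K"
proof -
  obtain \<kappa>0 K0 where K0: "\<kappa>0 < 1" "\<And>t. t \<ge> 0 \<Longrightarrow> \<bar>b (c t)\<bar> \<le> \<kappa>0 * t + K0"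
    using np unfolding X.nonpolar_def by blast
  obtain L where L: "L > 0" "\<And>g h. g \<in> carrier F2 \<times> UNIV \<Longrightarrow> h \<in> carrier F2 \<times> UNIV
    \<Longrightarrow> dist (\<psi> g y0) (\<psi> h y0) \<le> L * dist (\<phi> g x0) (\<phi> h x0) + L"
    using orbit_maps_lipschitz[OF X.F2Z_action_axioms Y.F2Z_action_axioms] by blast
  obtain L' where L': "L' > 0" "\<And>g h. g \<in> carrier F2 \<times> UNIV \<Longrightarrow> h \<in> carrier F2 \<times> UNIV
    \<Longrightarrow> dist (\<phi> g x0) (\<phi> h x0) \<le> L' * dist (\<psi> g y0) (\<psi> h y0) + L'"
    using orbit_maps_lipschitz[OF Y.F2Z_action_axioms X.F2Z_action_axioms] by blast
  obtain K where K: "K > 0" "\<And>a s. a \<in> Y \<Longrightarrow> s \<in> {1, -1 :: int} \<Longrightarrow>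
    (dist a (\<psi> ([], s * \<lfloor>dist y0 a / l'\<rfloor>) y0))\<^sup>2
      \<le> K * (dist y0 a + K) * (dist y0 a - of_int s * b' a + K)"
    using Y.near_centre by blast
  \<comment> \<open>Rate of divergence from the centre orbit in \<open>Y\<close>: the 2 comes from
    \<open>far_from_centre\<close>, \<open>L\<close> and \<open>L'\<close> from the orbit maps in
    the two directions.\<close>
  define \<eta> where "\<eta> = (1 - \<kappa>0) / (2 * L * L')"
  have \<eta>: "\<eta> > 0" using K0 L L' by (simp add: \<eta>_def)
  define K1 where "K1 = \<bar>((1 - \<kappa>0) * (1 + R) + K0 + C) / 2 + R + L'\<bar> / L'"
  have K1: "K1 \<ge> 0" using L' by (simp add: K1_def)
  \<comment> \<open>Solves \<open>(\<eta> * D / 2)\<^sup>2 \<le> K * (2 * D) * (D - \<beta> +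
    K)\<close> for the defect: divergence at rate \<open>\<eta>\<close> forces a defect of at least
    \<open>\<delta> * D - K\<close>.\<close>
  define \<delta> where "\<delta> = \<eta>\<^sup>2 / (8 * K)"
  have \<delta>: "\<delta> > 0" using \<eta> K by (simp add: \<delta>_def)
  define K2 where "K2 = K + \<delta> * (2 * K1 / \<eta>) + \<delta> * K"
  have far: "\<eta> * dist y0 (\<psi> g y0) - K1 \<le> dist (\<psi> g y0) (\<psi> ([], j) y0)"
    if t: "0 \<le> t" and g: "g \<in> carrier F2 \<times> UNIV" and near: "dist (c t) (\<phi> g x0) \<le> R" for t g j
  proof -
    have ct: "c t \<in> X" "dist x0 (c t) = t" using X.ray_in[OF ray(1) t] X.ray_dist[OF ray(1), of 0 t] ray t by auto
    have "(1 - \<kappa>0) * t - K0 - C \<le> 2 * dist (c t) (\<phi> ([], j) x0)"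
      using X.far_from_centre[OF ct(1), of \<kappa>0 K0 j] ct K0(2)[OF t] by simp
    moreover have "dist (c t) (\<phi> ([], j) x0) \<le> R + dist (\<phi> g x0) (\<phi> ([], j) x0)"
      using near dist_triangle[of "c t" "\<phi> ([], j) x0" "\<phi> g x0"] by linarith
    moreover have "dist (\<phi> g x0) (\<phi> ([], j) x0) \<le> L' * dist (\<psi> g y0) (\<psi> ([], j) y0) + L'"
      using L'(2)[OF g, of "([], j)"] by simp
    ultimately have 1: "(1 - \<kappa>0) * t / 2 - (K0 + C) / 2 - R - L' \<le> L' * dist (\<psi> g y0) (\<psi> ([], j) y0)"
      by argo
    have "dist x0 (\<phi> g x0) \<le> t + R" using near ct dist_triangle[of x0 "\<phi> g x0" "c t"] by linarith
    then have "L * dist x0 (\<phi> g x0) \<le> L * (t + R)" using L(1) by simp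
    then have "dist y0 (\<psi> g y0) \<le> L * (t + R) + L"
      using L(2)[of "([], 0)" g] g X.act_one[OF X.x0] Y.act_one[OF Y.x0] by simp
    then have "dist y0 (\<psi> g y0) / L \<le> t + R + 1" using L(1) by (simp add: field_simps)
    then have "(1 - \<kappa>0) / 2 * (dist y0 (\<psi> g y0) / L) \<le> (1 - \<kappa>0) / 2 * (t + R + 1)"
      using K0(1) by (intro mult_left_mono) auto
    then have "(1 - \<kappa>0) / (2 * L) * dist y0 (\<psi> g y0) - (((1 - \<kappa>0) * (1 + R) + K0 + C) / 2 + R + L')
        \<le> (1 - \<kappa>0) * t / 2 - (K0 + C) / 2 - R - L'" by (simp add: add_divide_distrib diff_divide_distrib algebra_simps)
    moreover have "((1 - \<kappa>0) * (1 + R) + K0 + C) / 2 + R + L' \<le> L' * K1" using L' by (simp add: K1_def)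
    moreover have "(1 - \<kappa>0) / (2 * L) * dist y0 (\<psi> g y0) = L' * (\<eta> * dist y0 (\<psi> g y0))"
      using L' by (simp add: \<eta>_def)
    ultimately have "L' * (\<eta> * dist y0 (\<psi> g y0)) - L' * K1 \<le> L' * dist (\<psi> g y0) (\<psi> ([], j) y0)"
      using 1 by linarith
    then have "L' * (\<eta> * dist y0 (\<psi> g y0) - K1) \<le> L' * dist (\<psi> g y0) (\<psi> ([], j) y0)"
      by (simp add: algebra_simps)
    then show ?thesis using L' by simp
  qed
  have bound: "of_int s * b' (\<psi> g y0) \<le> (1 - \<delta>) * dist y0 (\<psi> g y0) + K2"
    if t: "0 \<le> t" and g: "g \<in> carrier F2 \<times> UNIV" and near: "dist (c t) (\<phi> g x0) \<le> R"
      and s: "s \<in> {1, -1 :: int}" for t g s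
  proof -
    define a where "a = \<psi> g y0"
    define D where "D = dist y0 a"
    define \<beta> where "\<beta> = of_int s * b' a"
    have a: "a \<in> Y" using g Y.orbit_in by (simp add: a_def)
    have D0: "D \<ge> 0" by (simp add: D_def)
    have \<beta>: "\<beta> \<le> D" using Y.abs_height[OF a] s by (auto simp: \<beta>_def D_def)
    have nonneg: "\<delta> * (2 * K1 / \<eta>) \<ge> 0" "\<delta> * K \<ge> 0" using \<delta> K1 \<eta> K by auto
    show ?thesis
    \<comment> \<open>Near the base point the divergence estimate is void; the last two summands of
      \<open>K2\<close> cover this range.\<close>
    proof (cases "D \<le> 2 * K1 / \<eta> \<or> D \<le> K")
      case True
      then have "\<delta> * D \<le> \<delta> * (2 * K1 / \<eta>) \<or> \<delta> * D \<le> \<delta> * K"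
        using \<delta> mult_left_mono[of D "2 * K1 / \<eta>" \<delta>] mult_left_mono[of D K \<delta>] by linarith
      then have "\<delta> * D \<le> K2" using nonneg K(1) unfolding K2_def by linarith
      then have "\<beta> \<le> (1 - \<delta>) * D + K2" using \<beta> by (simp add: algebra_simps)
      then show ?thesis by (simp add: \<beta>_def D_def a_def)
    next
      case False
      then have big: "2 * K1 < \<eta> * D" "K < D" using \<eta> by (auto simp: field_simps)
      then have Dpos: "D > 0" using K by simp
      define e where "e = dist a (\<psi> ([], s * \<lfloor>dist y0 a / l'\<rfloor>) y0)"
      have "\<eta> * D / 2 \<le> e" using far[OF t g near, of "s * \<lfloor>dist y0 a / l'\<rfloor>"] big
        by (simp add: e_def D_def a_def)
      then have "(\<eta> * D / 2)\<^sup>2 \<le> e\<^sup>2" using \<eta> D0 by (intro power_mono) auto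
      also have "\<dots> \<le> K * (D + K) * (D - \<beta> + K)" using K(2)[OF a s] by (simp add: e_def D_def \<beta>_def)
      also have "\<dots> \<le> K * (2 * D) * (D - \<beta> + K)" using K(1) big \<beta> by (intro mult_right_mono mult_left_mono) auto
      finally have "D * (\<eta>\<^sup>2 * D) \<le> D * (8 * K * (D - \<beta> + K))" by (simp add: power2_eq_square algebra_simps)
      then have "\<eta>\<^sup>2 * D \<le> 8 * K * (D - \<beta> + K)" using Dpos by simp
      then have "\<delta> * D \<le> D - \<beta> + K" using K(1) by (simp add: \<delta>_def field_simps)
      then have "\<beta> \<le> (1 - \<delta>) * D + K2" using nonneg by (simp add: K2_def algebra_simps)
      then show ?thesis by (simp add: \<beta>_def D_def a_def)
    qed
  qed
  show thesis
  \<comment> \<open>Nothing prevents \<open>\<delta>\<close> from exceeding 1, while a nonnegative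
    slope bound is promised.\<close>
  proof (rule that[of "max 0 (1 - \<delta>)" K2])
    show "0 \<le> K2" using K \<delta> K1 \<eta> by (auto simp: K2_def intro!: add_nonneg_nonneg)
    fix t g assume *: "0 \<le> t" "g \<in> carrier F2 \<times> UNIV" "dist (c t) (\<phi> g x0) \<le> R"
    have "\<bar>b' (\<psi> g y0)\<bar> \<le> (1 - \<delta>) * dist y0 (\<psi> g y0) + K2"
      using bound[OF *, of 1] bound[OF *, of "-1"] by (simp add: abs_le_iff)
    also have "\<dots> \<le> max 0 (1 - \<delta>) * dist y0 (\<psi> g y0) + K2"
      by (intro add_right_mono mult_right_mono) auto
    finally show "\<bar>b' (\<psi> g y0)\<bar> \<le> max 0 (1 - \<delta>) * dist y0 (\<psi> g y0) + K2" .
  qed (use \<delta> in auto)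
qed

end

text \<open>Here \<open>d\<close>, \<open>d'\<close> are distances, \<open>\<beta>\<close>,
  \<open>\<beta>'\<close> slopes and \<open>s\<close> the difference of heights. At equal slopes of
  modulus at most \<open>\<kappa>\<close>, a change of distance by \<open>\<bar>s\<bar> + C\<close>
  changes the height by at most \<open>\<kappa> * (\<bar>s\<bar> + C)\<close>, which falls short of
  a large \<open>\<bar>s\<bar>\<close>; unequal slopes contribute \<open>\<delta>\<close> times a
  distance.\<close>

lemma slope_gap:
  fixes d d' \<beta> \<beta>' \<kappa> \<delta> s C :: real
  assumes d: "d \<ge> 0" "d' \<ge> 0" and \<beta>: "\<bar>\<beta>\<bar> \<le> \<kappa>" "\<bar>\<beta>'\<bar> \<le> \<kappa>" "\<kappa> < 1" and \<delta>: "\<bar>\<beta> - \<beta>'\<bar> \<le> \<delta>"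
    and C: "C \<ge> 0" and s: "\<beta>' * d' = \<beta> * d + s" "\<bar>d' - d\<bar> \<le> \<bar>s\<bar> + C"
  shows "\<bar>s\<bar> * (1 - \<kappa> - \<delta>) \<le> \<delta> * d + (1 + \<delta>) * C"
proof -
  \<comment> \<open>The case \<open>s < 0\<close> is reduced to this by changing the sign of all
    heights.\<close>
  have main: "s * (1 - \<kappa> - \<delta>) \<le> \<delta> * d + (1 + \<delta>) * C"
    if \<beta>: "\<bar>\<beta>\<bar> \<le> \<kappa>" "\<bar>\<beta>'\<bar> \<le> \<kappa>" and \<delta>: "\<bar>\<beta> - \<beta>'\<bar> \<le> \<delta>"
      and s: "\<beta>' * d' = \<beta> * d + s" "\<bar>d' - d\<bar> \<le> s + C" "s \<ge> 0" for s \<beta> \<beta>'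
  proof -
    have \<delta>0: "\<delta> \<ge> 0" using \<delta> by linarith
    have \<kappa>C: "\<kappa> * C \<le> C" using mult_right_mono[of \<kappa> 1 C] assms(5) C by simp
    have nn: "0 \<le> \<delta> * s" "0 \<le> \<delta> * C" using \<delta>0 s C by auto
    show ?thesis
    proof (cases "\<beta>' \<ge> 0")
      case True
      have "\<beta>' * d' \<le> \<beta>' * (d + s + C)" using True s by (intro mult_left_mono) auto
      then have "s \<le> (\<beta>' - \<beta>) * d + \<beta>' * s + \<beta>' * C" using s(1) by (simp add: algebra_simps)
      also have "\<dots> \<le> \<delta> * d + \<kappa> * s + \<kappa> * C"
        using \<beta> \<delta> d s C by (intro add_mono mult_right_mono) auto
      finally show ?thesis using \<kappa>C nn by (simp add: algebra_simps)
    next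
      case False
      then have "\<beta>' * d' \<le> 0" using d by (simp add: mult_nonpos_nonneg)
      then have "\<beta> * d \<le> - s" using s(1) by linarith
      then have neg: "\<beta> \<le> 0 \<or> s = 0" using s(3) mult_nonneg_nonneg[OF _ d(1), of \<beta>] by linarith
      show ?thesis
      proof (cases "s = 0")
        case True
        then show ?thesis using \<delta>0 d C by simp
      next
        case False
        then have neg: "\<beta> \<le> 0" using neg by simp
        have "(- \<beta>) * d \<le> (- \<beta>) * (d' + s + C)" using neg s by (intro mult_left_mono) auto
        then have "s \<le> (\<beta>' - \<beta>) * d' + (- \<beta>) * s + (- \<beta>) * C" using s(1) by (simp add: algebra_simps)
        also have "\<dots> \<le> \<delta> * (d + s + C) + \<kappa> * s + \<kappa> * C"
          using \<beta> \<delta> \<delta>0 d s C by (intro add_mono mult_right_mono mult_mono) auto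
        finally show ?thesis using \<kappa>C by (simp add: algebra_simps)
      qed
    qed
  qed
  show ?thesis
  proof (cases "s \<ge> 0")
    case True
    then show ?thesis using main[OF \<beta>(1,2) \<delta>] s by simp
  next
    case False
    have "\<bar>- \<beta> - - \<beta>'\<bar> \<le> \<delta>" using \<delta> by linarith
    then show ?thesis using main[of "- \<beta>" "- \<beta>'" "- s"] \<beta> s False by simp
  qed
qed

context height_action
begin

lemma slope_gd:
  assumes a: "a \<in> X" "\<bar>b a\<bar> \<le> \<kappa> * dist x0 a + K" and r: "0 \<le> r" "r \<le> dist x0 a" and K: "0 \<le> \<kappa>" "0 \<le> K"
  shows "\<bar>b (gd X x0 a r)\<bar> \<le> \<kappa> * r + K + C"
proof (cases "dist x0 a = 0")
  case True
  then show ?thesis using r K C b0 x0 a gd_0 by simp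
next
  case False
  let ?d = "dist x0 a"
  have d: "?d > 0" using False by simp
  have "?d * \<bar>b (gd X x0 a r)\<bar> = \<bar>?d * b (gd X x0 a r)\<bar>" by (simp add: abs_mult)
  also have "\<dots> \<le> \<bar>r * b a\<bar> + C * ?d" using b_gd[OF a(1) r] by linarith
  also have "\<bar>r * b a\<bar> = r * \<bar>b a\<bar>" using r by (simp add: abs_mult)
  also have "r * \<bar>b a\<bar> \<le> r * (\<kappa> * ?d + K)" using a r by (intro mult_left_mono)
  also have "r * (\<kappa> * ?d + K) + C * ?d \<le> ?d * (\<kappa> * r + K + C)"
    using mult_right_mono[OF r(2) K(2)] by (simp add: algebra_simps)
  finally show ?thesis using d by simp
qed

text \<open>The fibres of the finitely many short words stay within \<open>B\<close> of the centre
  orbit, from which a nonpolar ray diverges linearly.\<close>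

lemma words_grow:
  assumes ray: "geodesic_ray X c" "c 0 = x0" and np: "nonpolar c"
    and g: "\<And>k. g k \<in> carrier F2 \<times> UNIV" "\<And>k. dist (c (real k)) (\<phi> (g k) x0) \<le> R"
  shows "eventually (\<lambda>k. m \<le> length (fst (g k))) sequentially"
proof -
  obtain \<kappa> K where K: "\<kappa> < 1" "\<And>t. t \<ge> 0 \<Longrightarrow> \<bar>b (c t)\<bar> \<le> \<kappa> * t + K"
    using np unfolding nonpolar_def by blast
  obtain B where B: "\<And>w. w \<in> {w \<in> carrier F2. length w \<le> m} \<Longrightarrow> dist x0 (\<phi> (w, 0) x0) \<le> B"
    by (rule finite_bounded_above[OF finite_short_words, where f = "\<lambda>w. dist x0 (\<phi> (w, 0) x0)"]) blast
  have "eventually (\<lambda>k. real k > (2 * (R + B) + K + C) / (1 - \<kappa>)) sequentially"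
    using filterlim_real_sequentially unfolding filterlim_at_top_dense by blast
  then show ?thesis
  proof eventually_elim
    case (elim k)
    show ?case
    proof (rule ccontr)
      assume "\<not> ?thesis"
      then have w: "fst (g k) \<in> {w \<in> carrier F2. length w \<le> m}" using g(1)[of k] by auto
      have ck: "c (real k) \<in> X" "dist x0 (c (real k)) = real k"
        using ray_in[OF ray(1), of "real k"] ray_dist[OF ray(1), of 0 "real k"] ray by auto
      have "(1 - \<kappa>) * real k - K - C \<le> 2 * dist (c (real k)) (\<phi> ([], snd (g k)) x0)"
        using far_from_centre[OF ck(1), of \<kappa> K "snd (g k)"] K(2)[of "real k"] ck by simp
      moreover have "dist (c (real k)) (\<phi> ([], snd (g k)) x0) \<le> R + dist (\<phi> (g k) x0) (\<phi> ([], snd (g k)) x0)"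
        using g(2)[of k] dist_triangle[of "c (real k)" "\<phi> ([], snd (g k)) x0" "\<phi> (g k) x0"] by linarith
      moreover have "dist (\<phi> (g k) x0) (\<phi> ([], snd (g k)) x0) \<le> B"
        using act_fibre[of "fst (g k)" "snd (g k)"] B[OF w] w by simp
      ultimately have "(1 - \<kappa>) * real k \<le> 2 * (R + B) + K + C" by argo
      then show False using elim K(1) by (simp add: field_simps)
    qed
  qed
qed

end

context limset_pair
begin

text \<open>The slope bound for the orbit points along \<open>c\<close> descends to radius
  \<open>r\<close> of their geodesics with constants independent of \<open>r\<close>, and there
  these geodesics approximate \<open>d\<close>.\<close>

lemma nonpolar_image:
  assumes \<xi>: "\<xi> \<in> visual_boundary X" "c \<in> \<xi>" "c 0 = x0" and d: "d \<in> f \<xi>" "d 0 = y0"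
    and np: "X.nonpolar c"
  shows "Y.nonpolar d"
proof -
  have ray: "geodesic_ray X c" using X.boundary_ray \<xi> by blast
  have ray': "geodesic_ray Y d" using Y.boundary_ray f_boundary \<xi> d by blast
  obtain R g where g: "\<And>k. g k \<in> carrier F2 \<times> UNIV" "\<And>k. dist (c (real k)) (\<phi> (g k) x0) \<le> R"
    using X.ray_near_orbit ray by metis
  obtain \<kappa> K where K: "0 \<le> \<kappa>" "\<kappa> < 1" "0 \<le> K" "\<And>t g. 0 \<le> t \<Longrightarrow> g \<in> carrier F2 \<times> UNIV \<Longrightarrow>
    dist (c t) (\<phi> g x0) \<le> R \<Longrightarrow> \<bar>b' (\<psi> g y0)\<bar> \<le> \<kappa> * dist y0 (\<psi> g y0) + K"
    using nonpolar_slope[OF ray \<xi>(3) np] by blast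
  have "\<bar>b' (d r)\<bar> \<le> \<kappa> * r + (K + C' + 1)" if r: "r \<ge> 0" for r
  proof (cases "r = 0")
    case True
    then show ?thesis using d Y.b0 K Y.C by simp
  next
    case False
    then have "eventually (\<lambda>k. r < dist y0 (\<psi> (g k) y0) \<and> dist (gd Y y0 (\<psi> (g k) y0) r) (d r) < 1) sequentially"
      using limset_near_ray[OF \<xi> d g(1) filterlim_real_sequentially g(2), of r 1] r by simp
    then obtain k where k: "r < dist y0 (\<psi> (g k) y0)" "dist (gd Y y0 (\<psi> (g k) y0) r) (d r) < 1"
      using eventually_happens'[OF sequentially_bot] by blast
    have a: "\<psi> (g k) y0 \<in> Y" using Y.orbit_in g by blast
    have "\<bar>b' (gd Y y0 (\<psi> (g k) y0) r)\<bar> \<le> \<kappa> * r + K + C'"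
      by (rule Y.slope_gd[OF a K(4)[OF of_nat_0_le_iff g]]) (use K(1-3) k r in auto)
    then show ?thesis
      using Y.b_lip[of "gd Y y0 (\<psi> (g k) y0) r" "d r"] Y.gd_in Y.x0 a Y.ray_in[OF ray' r] k(2) by force
  qed
  then show ?thesis using K unfolding Y.nonpolar_def by blast
qed

text \<open>The geodesics from \<open>y0\<close> to the orbit points cross the fibre of the prefix.
  Their slope bound keeps the crossing within a radius that does not depend on \<open>k\<close>, and
  up to that radius they are close to \<open>d\<close>. The radius depends on \<open>N\<close>, the
  bound \<open>B\<close> does not.\<close>

lemma visits_fibres:
  obtains B where "\<And>\<xi> c d g R N. \<xi> \<in> visual_boundary X \<Longrightarrow> c \<in> \<xi> \<Longrightarrow> c 0 = x0 \<Longrightarrow> d \<in> f \<xi> \<Longrightarrow> d 0 = y0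
    \<Longrightarrow> X.nonpolar c \<Longrightarrow> \<forall>k. g k \<in> carrier F2 \<times> UNIV \<Longrightarrow> \<forall>k. dist (c (real k)) (\<phi> (g k) x0) \<le> R
    \<Longrightarrow> 0 < N \<Longrightarrow> eventually (\<lambda>k. N \<le> length (fst (g k)) \<and>
      (\<exists>t\<ge>0. \<exists>n. dist (d t) (\<psi> (take N (fst (g k)), n) y0) \<le> B)) sequentially"
proof -
  obtain B where B: "\<And>u m v n c s t p. u \<in> carrier F2 \<Longrightarrow> v \<in> carrier F2 \<Longrightarrow> Y.lipschitz_path s t c
     \<Longrightarrow> dist (c s) (\<psi> (u, m) y0) \<le> 0 \<Longrightarrow> dist (c t) (\<psi> (v, n) y0) \<le> 0
     \<Longrightarrow> prefix p v \<Longrightarrow> \<not> prefix p u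
     \<Longrightarrow> \<exists>r\<in>{s..t}. \<exists>k. dist (c r) (\<psi> (p, k) y0) \<le> B"
    using Y.bottleneck[of 0] by blast
  show thesis
  proof (rule that[of "B + 1"])
    fix \<xi> c d g R and N :: nat
    assume \<xi>: "\<xi> \<in> visual_boundary X" "c \<in> \<xi>" "c 0 = x0" and d: "d \<in> f \<xi>" "d 0 = y0"
      and np: "X.nonpolar c" and g: "\<forall>k. g k \<in> carrier F2 \<times> UNIV" "\<forall>k. dist (c (real k)) (\<phi> (g k) x0) \<le> R"
      and N: "0 < N"
    have ray: "geodesic_ray X c" using X.boundary_ray \<xi> by blast
    have ray': "geodesic_ray Y d" using Y.boundary_ray f_boundary \<xi> d by blast
    obtain \<kappa> K where K: "0 \<le> \<kappa>" "\<kappa> < 1" "0 \<le> K" "\<And>t g. 0 \<le> t \<Longrightarrow> g \<in> carrier F2 \<times> UNIV \<Longrightarrow>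
      dist (c t) (\<phi> g x0) \<le> R \<Longrightarrow> \<bar>b' (\<psi> g y0)\<bar> \<le> \<kappa> * dist y0 (\<psi> g y0) + K"
      using nonpolar_slope[OF ray \<xi>(3) np] by blast
    obtain W where W: "\<And>w. w \<in> {w \<in> carrier F2. length w \<le> N} \<Longrightarrow> dist y0 (\<psi> (w, 0) y0) \<le> W"
      by (rule finite_bounded_above[OF Y.finite_short_words, where f = "\<lambda>w. dist y0 (\<psi> (w, 0) y0)"]) blast
    \<comment> \<open>A crossing at radius \<open>r\<close> is within \<open>B + W\<close> of the
      centre orbit, so \<open>far_from_centre\<close> bounds \<open>r\<close> by \<open>T\<close>.
      One \<open>C'\<close> comes from there, the other from \<open>slope_gd\<close>.\<close>
    define T where "T = \<bar>2 * (B + W) + K + C' + C'\<bar> / (1 - \<kappa>) + 1"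
    have "(1 - \<kappa>) * T = \<bar>2 * (B + W) + K + C' + C'\<bar> + (1 - \<kappa>)"
      using K(2) unfolding T_def distrib_left by simp
    then have T: "T > 0" "2 * (B + W) + K + C' + C' < (1 - \<kappa>) * T"
      using K(2) by (simp_all add: T_def add_nonneg_pos)
    have 1: "eventually (\<lambda>k. N \<le> length (fst (g k))) sequentially"
      using X.words_grow[OF ray \<xi>(3) np] g by blast
    have 2: "eventually (\<lambda>k. T < dist y0 (\<psi> (g k) y0) \<and> dist (gd Y y0 (\<psi> (g k) y0) T) (d T) < 1) sequentially"
      by (rule limset_near_ray[OF \<xi> d _ filterlim_real_sequentially _ T(1)]) (use g in auto)
    show "eventually (\<lambda>k. N \<le> length (fst (g k)) \<and>
      (\<exists>t\<ge>0. \<exists>n. dist (d t) (\<psi> (take N (fst (g k)), n) y0) \<le> B + 1)) sequentially"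
      using 1 2
    proof eventually_elim
      case (elim k)
      define w where "w = fst (g k)"
      define p where "p = take N w"
      define a where "a = \<psi> (g k) y0"
      have w: "w \<in> carrier F2" "g k = (w, snd (g k))" using g(1) by (auto simp: w_def mem_Times_iff)
      have a: "a \<in> Y" using Y.orbit_in g by (simp add: a_def)
      have lp: "length p = N" using elim by (simp add: p_def w_def)
      have p: "prefix p w" "\<not> prefix p []" using lp N by (auto simp: p_def take_is_prefix)
      have pF: "p \<in> carrier F2" using F2_prefix[OF w(1) p(1)] .
      have ends: "dist (gd Y y0 a 0) (\<psi> ([], 0) y0) \<le> 0" "dist (gd Y y0 a (dist y0 a)) (\<psi> (w, snd (g k)) y0) \<le> 0"
        using Y.gd_0[OF Y.x0 a] Y.gd_end[OF Y.x0 a] Y.act_one[OF Y.x0] w by (simp_all add: a_def)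
      obtain r n where r: "r \<in> {0..dist y0 a}" "dist (gd Y y0 a r) (\<psi> (p, n) y0) \<le> B"
        using B[OF Nil_F2 w(1) Y.lipschitz_path_gd[OF Y.x0 a zero_le_dist] ends p] by blast
      have rX: "gd Y y0 a r \<in> Y" "dist y0 (gd Y y0 a r) = r"
        using Y.gd_in Y.gd_dist_start Y.x0 a r by auto
      have "dist (\<psi> (p, n) y0) (\<psi> ([], n) y0) \<le> W"
        using Y.act_fibre[OF pF, of n] W pF lp by simp
      then have "dist (gd Y y0 a r) (\<psi> ([], n) y0) \<le> B + W"
        using r(2) dist_triangle[of "gd Y y0 a r" "\<psi> ([], n) y0" "\<psi> (p, n) y0"] by linarith
      moreover have "\<bar>b' (gd Y y0 a r)\<bar> \<le> \<kappa> * r + K + C'"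
        by (rule Y.slope_gd[OF a K(4)[OF of_nat_0_le_iff, of "g k" k, folded a_def]])
          (use K(1-3) g r in auto)
      ultimately have "(1 - \<kappa>) * r \<le> 2 * (B + W) + K + C' + C'"
        using Y.far_from_centre[OF rX(1), of \<kappa> "K + C'" n] rX(2) by simp
      then have "(1 - \<kappa>) * r < (1 - \<kappa>) * T" using T(2) by linarith
      then have rT: "r \<le> T" using K(2) by simp
      have dT: "d T \<in> Y" "dist y0 (d T) = T"
        using Y.ray_in[OF ray', of T] Y.ray_dist[OF ray', of 0 T] d T by auto
      \<comment> \<open>Closeness at radius \<open>T\<close> passes to the smaller radius
        \<open>r\<close> by convexity.\<close>
      have "T * dist (gd Y y0 a r) (gd Y y0 (d T) r) \<le> r * dist (gd Y y0 a T) (gd Y y0 (d T) T)"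
        by (rule Y.gd_mono) (use Y.x0 a dT r rT elim in \<open>auto simp: a_def\<close>)
      also have "\<dots> \<le> T * 1"
        using Y.gd_end[OF Y.x0 dT(1), of T] dT elim r rT by (intro mult_mono) (auto simp: a_def)
      finally have "dist (gd Y y0 a r) (d r) \<le> 1"
        using Y.ray_eq_gd[OF ray', of r T] d r rT T by simp
      then have "dist (d r) (\<psi> (p, n) y0) \<le> B + 1"
        using r(2) dist_triangle3[of "d r" "\<psi> (p, n) y0" "gd Y y0 a r"] by linarith
      then show ?case using elim r by (auto simp: p_def w_def)
    qed
  qed
qed

text \<open>The common image ray visits fibres of prefixes from both rays, and
  \<open>ray_prefix_unique\<close> in \<open>Y\<close> makes these prefixes agree. Back in
  \<open>X\<close>, \<open>bottleneck\<close> leads both rays past the fibre of the common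
  prefix.\<close>

lemma common_fibres:
  assumes \<xi>: "\<xi> \<in> visual_boundary X" "c \<in> \<xi>" "c 0 = x0" "X.nonpolar c"
    and \<eta>: "\<eta> \<in> visual_boundary X" "c' \<in> \<eta>" "c' 0 = x0" "X.nonpolar c'"
    and eq: "f \<xi> = f \<eta>"
  obtains B where "\<And>N. 0 < N \<Longrightarrow> \<exists>v t n t' n'. v \<in> carrier F2 \<and> length v = N \<and> 0 \<le> t \<and> 0 \<le> t' \<and>
    dist (c t) (\<phi> (v, n) x0) \<le> B \<and> dist (c' t') (\<phi> (v, n') x0) \<le> B"
proof -
  have ray: "geodesic_ray X c" "geodesic_ray X c'" using X.boundary_ray \<xi> \<eta> by blast+
  obtain d where d: "d \<in> f \<xi>" "geodesic_ray Y d" "d 0 = y0"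
    using Y.boundary_ray_exists[OF Y.x0 f_boundary[OF \<xi>(1)]] .
  obtain R where R: "R \<ge> 0" "\<And>c. geodesic_ray X c \<Longrightarrow>
    \<exists>g. \<forall>k::nat. g k \<in> carrier F2 \<times> UNIV \<and> dist (c (real k)) (\<phi> (g k) x0) \<le> R"
    using X.ray_near_orbit by blast
  obtain g where g: "\<forall>k. g k \<in> carrier F2 \<times> UNIV" "\<forall>k. dist (c (real k)) (\<phi> (g k) x0) \<le> R"
    using R(2)[OF ray(1)] by blast
  obtain g' where g': "\<forall>k. g' k \<in> carrier F2 \<times> UNIV" "\<forall>k. dist (c' (real k)) (\<phi> (g' k) x0) \<le> R"
    using R(2)[OF ray(2)] by blast
  obtain B1 where B1: "\<And>\<xi> c d g R N. \<xi> \<in> visual_boundary X \<Longrightarrow> c \<in> \<xi> \<Longrightarrow> c 0 = x0 \<Longrightarrow> d \<in> f \<xi> \<Longrightarrow> d 0 = y0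
    \<Longrightarrow> X.nonpolar c \<Longrightarrow> \<forall>k. g k \<in> carrier F2 \<times> UNIV \<Longrightarrow> \<forall>k. dist (c (real k)) (\<phi> (g k) x0) \<le> R
    \<Longrightarrow> 0 < N \<Longrightarrow> eventually (\<lambda>k. N \<le> length (fst (g k)) \<and>
      (\<exists>t\<ge>0. \<exists>n. dist (d t) (\<psi> (take N (fst (g k)), n) y0) \<le> B1)) sequentially"
    using visits_fibres by blast
  obtain M where M: "\<And>d N v n t v' n' t'. geodesic_ray Y d \<Longrightarrow> d 0 = y0 \<Longrightarrow> v \<in> carrier F2 \<Longrightarrow> v' \<in> carrier F2
    \<Longrightarrow> length v = N + M \<Longrightarrow> length v' = N + M \<Longrightarrow> 0 \<le> t \<Longrightarrow> 0 \<le> t'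
    \<Longrightarrow> dist (d t) (\<psi> (v, n) y0) \<le> B1 \<Longrightarrow> dist (d t') (\<psi> (v', n') y0) \<le> B1 \<Longrightarrow> take N v = take N v'"
    using Y.ray_prefix_unique[of B1] by blast
  obtain B where B: "\<And>u m v n c s t p. u \<in> carrier F2 \<Longrightarrow> v \<in> carrier F2 \<Longrightarrow> X.lipschitz_path s t c
     \<Longrightarrow> dist (c s) (\<phi> (u, m) x0) \<le> R \<Longrightarrow> dist (c t) (\<phi> (v, n) x0) \<le> R
     \<Longrightarrow> prefix p v \<Longrightarrow> \<not> prefix p u
     \<Longrightarrow> \<exists>r\<in>{s..t}. \<exists>k. dist (c r) (\<phi> (p, k) x0) \<le> B"
    using X.bottleneck[of R] by blast
  have visit: "\<exists>t n. 0 \<le> t \<and> dist (c t) (\<phi> (p, n) x0) \<le> B"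
    if c: "geodesic_ray X c" "c 0 = x0" and h: "h \<in> carrier F2 \<times> UNIV" "dist (c (real k)) (\<phi> h x0) \<le> R"
      and p: "prefix p (fst h)" "p \<noteq> []" for c h k p
  proof -
    have "fst h \<in> carrier F2" "dist (c (real k)) (\<phi> (fst h, snd h) x0) \<le> R" using h by auto
    moreover have "dist (c 0) (\<phi> ([], 0) x0) \<le> R" using c X.act_one[OF X.x0] R by simp
    ultimately have "\<exists>r\<in>{0..real k}. \<exists>n. dist (c r) (\<phi> (p, n) x0) \<le> B"
      using B[OF Nil_F2 _ X.lipschitz_path_ray[OF c(1) order_refl], of "fst h" "real k" 0 "snd h" p] p by simp
    then show ?thesis by auto
  qed
  show thesis
  proof (rule that[of B])
    fix N :: nat assume N: "0 < N"
    \<comment> \<open>The last \<open>M\<close> letters are lost in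
      \<open>ray_prefix_unique\<close>, so \<open>N + M\<close> are requested.\<close>
    have ev1: "eventually (\<lambda>k. N + M \<le> length (fst (g k)) \<and>
      (\<exists>t\<ge>0. \<exists>n. dist (d t) (\<psi> (take (N + M) (fst (g k)), n) y0) \<le> B1)) sequentially"
      by (rule B1[OF \<xi>(1-3) d(1,3) \<xi>(4) g]) (use N in simp)
    have ev2: "eventually (\<lambda>k. N + M \<le> length (fst (g' k)) \<and>
      (\<exists>t\<ge>0. \<exists>n. dist (d t) (\<psi> (take (N + M) (fst (g' k)), n) y0) \<le> B1)) sequentially"
      by (rule B1[OF \<eta>(1-3) d(1)[unfolded eq] d(3) \<eta>(4) g']) (use N in simp)
    obtain k t n t' n' where k: "N + M \<le> length (fst (g k))" "N + M \<le> length (fst (g' k))"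
      and t: "0 \<le> t" "dist (d t) (\<psi> (take (N + M) (fst (g k)), n) y0) \<le> B1"
      and t': "0 \<le> t'" "dist (d t') (\<psi> (take (N + M) (fst (g' k)), n') y0) \<le> B1"
      using eventually_happens'[OF sequentially_bot eventually_conj[OF ev1 ev2]] by blast
    have F: "fst (g k) \<in> carrier F2" "fst (g' k) \<in> carrier F2" using g(1) g'(1) by (auto simp: mem_Times_iff)
    have "length (take (N + M) (fst (g k))) = N + M" "length (take (N + M) (fst (g' k))) = N + M"
      using k by simp_all
    then have "take N (take (N + M) (fst (g k))) = take N (take (N + M) (fst (g' k)))"
      by (rule M[OF d(2,3) F2_prefix[OF F(1) take_is_prefix] F2_prefix[OF F(2) take_is_prefix]
        _ _ t(1) t'(1) t(2) t'(2)])
    then have p: "take N (fst (g k)) = take N (fst (g' k))" by (simp add: take_take min_def)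
    define p where "p = take N (fst (g k))"
    have lp: "length p = N" using k by (simp add: p_def)
    have pp: "prefix p (fst (g k))" "prefix p (fst (g' k))"
      using take_is_prefix p unfolding p_def by metis+
    have p0: "p \<noteq> []" using lp N by auto
    obtain s m where "0 \<le> s" "dist (c s) (\<phi> (p, m) x0) \<le> B"
      using visit[OF ray(1) \<xi>(3) _ _ pp(1) p0] g by blast
    moreover obtain s' m' where "0 \<le> s'" "dist (c' s') (\<phi> (p, m') x0) \<le> B"
      using visit[OF ray(2) \<eta>(3) _ _ pp(2) p0] g' by blast
    moreover have "p \<in> carrier F2" using F2_prefix F pp by blast
    ultimately show "\<exists>v t n t' n'. v \<in> carrier F2 \<and> length v = N \<and> 0 \<le> t \<and> 0 \<le> t' \<and>
      dist (c t) (\<phi> (v, n) x0) \<le> B \<and> dist (c' t') (\<phi> (v, n') x0) \<le> B"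
      using lp by blast
  qed
qed

end

section \<open>Injectivity and surjectivity\<close>

context limset_pair
begin

text \<open>If two nonpolar boundary points have the same image, their rays visit the fibres of the same
  words \<open>v\<close>, say near \<open>v z\<^sup>n\<close> and \<open>v z\<^sup>m\<close>. In \<open>Y\<close> both sequences converge to the same nonpolar
  point, so they have the same asymptotic slope, which forces \<open>n - m\<close> to be sublinear.\<close>

lemma nonpolar_injective:
  assumes \<xi>: "\<xi> \<in> visual_boundary X" "c \<in> \<xi>" "c 0 = x0" "X.nonpolar c"
    and \<eta>: "\<eta> \<in> visual_boundary X" "c' \<in> \<eta>" "c' 0 = x0" "X.nonpolar c'"
    and eq: "f \<xi> = f \<eta>"
  shows "\<xi> = \<eta>"
proof -
  have ray: "geodesic_ray X c" "geodesic_ray X c'" using X.boundary_ray \<xi> \<eta> by blast+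
  obtain d where d: "d \<in> f \<xi>" "geodesic_ray Y d" "d 0 = y0"
    using Y.boundary_ray_exists[OF Y.x0 f_boundary[OF \<xi>(1)]] .
  obtain B where B: "\<And>N. 0 < N \<Longrightarrow> \<exists>v t n t' n'. v \<in> carrier F2 \<and> length v = N \<and> 0 \<le> t \<and> 0 \<le> t' \<and>
    dist (c t) (\<phi> (v, n) x0) \<le> B \<and> dist (c' t') (\<phi> (v, n') x0) \<le> B"
    using common_fibres[OF \<xi> \<eta> eq] by blast
  have "\<forall>i. \<exists>v t n t' n'. v \<in> carrier F2 \<and> length v = Suc i \<and> 0 \<le> t \<and> 0 \<le> t' \<and>
    dist (c t) (\<phi> (v, n) x0) \<le> B \<and> dist (c' t') (\<phi> (v, n') x0) \<le> B"
    using B by blast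
  then obtain v t n t' n' where v: "\<And>i. v i \<in> carrier F2" "\<And>i. length (v i) = Suc i"
    and t: "\<And>i. 0 \<le> t i" "\<And>i. 0 \<le> t' i"
    and near: "\<And>i. dist (c (t i)) (\<phi> (v i, n i) x0) \<le> B" "\<And>i. dist (c' (t' i)) (\<phi> (v i, n' i) x0) \<le> B"
    by metis
  have G: "(v i, n i) \<in> carrier F2 \<times> UNIV" "(v i, n' i) \<in> carrier F2 \<times> UNIV" for i using v by simp_all
  have X: "\<phi> (v i, k) x0 \<in> X" and Y: "\<psi> (v i, k) y0 \<in> Y" for i k using X.act_in X.x0 Y.act_in Y.x0 v by auto
  have B0: "B \<ge> 0" using near(1)[of 0] zero_le_dist order_trans by blast
  \<comment> \<open>The words \<open>v i\<close> get longer, so the orbit points leave every ball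
    and the times of the visits tend to infinity.\<close>
  have escape: "filterlim (\<lambda>i. s i) at_top sequentially"
    if s: "\<And>i. dist x0 (\<phi> (v i, k i) x0) \<le> s i + B" for s :: "nat \<Rightarrow> real" and k
    unfolding filterlim_at_top
  proof
    fix T
    obtain M where M: "\<And>w n. w \<in> carrier F2 \<Longrightarrow> dist x0 (\<phi> (w, n) x0) \<le> T + B \<Longrightarrow> length w < M"
      using X.long_words[of "T + B"] by blast
    have "T \<le> s i" if "i \<ge> M" for i
    proof (rule ccontr)
      assume "\<not> T \<le> s i"
      then have "dist x0 (\<phi> (v i, k i) x0) \<le> T + B" using s[of i] by linarith
      then have "length (v i) < M" using M v by blast
      then show False using v(2)[of i] that by simp
    qed
    then show "eventually (\<lambda>i. T \<le> s i) sequentially" unfolding eventually_sequentially by blast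
  qed
  have dc: "dist x0 (c (t i)) = t i" "dist x0 (c' (t' i)) = t' i" for i
    using X.ray_dist[OF ray(1), of 0 "t i"] X.ray_dist[OF ray(2), of 0 "t' i"] t \<xi> \<eta> by auto
  have s1: "dist x0 (\<phi> (v i, n i) x0) \<le> t i + B" for i
    using near(1)[of i] dc(1)[of i] dist_triangle[of x0 "\<phi> (v i, n i) x0" "c (t i)"] by linarith
  have s2: "dist x0 (\<phi> (v i, n' i) x0) \<le> t' i + B" for i
    using near(2)[of i] dc(2)[of i] dist_triangle[of x0 "\<phi> (v i, n' i) x0" "c' (t' i)"] by linarith
  have tlim: "filterlim t at_top sequentially" "filterlim t' at_top sequentially"
    using escape[OF s1] escape[OF s2] by auto
  obtain \<kappa>1 K1 where K1: "0 \<le> \<kappa>1" "\<kappa>1 < 1" "0 \<le> K1" "\<And>t g. 0 \<le> t \<Longrightarrow> g \<in> carrier F2 \<times> UNIV \<Longrightarrow>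
    dist (c t) (\<phi> g x0) \<le> B \<Longrightarrow> \<bar>b' (\<psi> g y0)\<bar> \<le> \<kappa>1 * dist y0 (\<psi> g y0) + K1"
    using nonpolar_slope[OF ray(1) \<xi>(3,4)] by blast
  obtain \<kappa>2 K2 where K2: "0 \<le> \<kappa>2" "\<kappa>2 < 1" "0 \<le> K2" "\<And>t g. 0 \<le> t \<Longrightarrow> g \<in> carrier F2 \<times> UNIV \<Longrightarrow>
    dist (c' t) (\<phi> g x0) \<le> B \<Longrightarrow> \<bar>b' (\<psi> g y0)\<bar> \<le> \<kappa>2 * dist y0 (\<psi> g y0) + K2"
    using nonpolar_slope[OF ray(2) \<eta>(3,4)] by blast
  define \<kappa> where "\<kappa> = max \<kappa>1 \<kappa>2"
  define K where "K = max K1 K2"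
  have \<kappa>: "0 \<le> \<kappa>" "\<kappa> < 1" "0 \<le> K" using K1 K2 by (auto simp: \<kappa>_def K_def)
  define A where "A = (\<lambda>i. \<psi> (v i, n i) y0)"
  define A' where "A' = (\<lambda>i. \<psi> (v i, n' i) y0)"
  have AY: "A i \<in> Y" "A' i \<in> Y" for i using Y by (auto simp: A_def A'_def)
  have weaken: "\<kappa>0 * D + K0 \<le> \<kappa> * D + K" if "\<kappa>0 \<le> \<kappa>" "K0 \<le> K" "D \<ge> 0" for \<kappa>0 K0 D :: real
    using that by (intro add_mono mult_right_mono)
  have slope: "\<bar>b' (A i)\<bar> \<le> \<kappa> * dist y0 (A i) + K" "\<bar>b' (A' i)\<bar> \<le> \<kappa> * dist y0 (A' i) + K" for i
    using K1(4)[OF t(1) G(1) near(1), of i] weaken[of \<kappa>1 K1 "dist y0 (A i)"]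
      K2(4)[OF t(2) G(2) near(2), of i] weaken[of \<kappa>2 K2 "dist y0 (A' i)"]
    by (auto simp: A_def A'_def \<kappa>_def K_def)
  \<comment> \<open>The two points of the fibre differ by the central element
    \<open>z\<^sup>m\<close>, in \<open>Y\<close> as in \<open>X\<close>.\<close>
  define m where "m = (\<lambda>i. n' i - n i)"
  have A': "A' i = \<psi> ([], m i) (A i)" for i
    using Y.act_central(1)[OF v(1) Y.x0, of "m i" i "n i"] by (simp add: A_def A'_def m_def)
  have AA': "dist (A i) (A' i) \<le> \<bar>of_int (m i)\<bar> * l' + C'" for i
    using Y.displacement_invariant[OF v(1) Y.x0, of i "n i" "m i"] Y.orbit_z[of "m i"]
    unfolding A' by (simp add: A_def)
  obtain L where L: "L > 0" "\<And>g h. g \<in> carrier F2 \<times> UNIV \<Longrightarrow> h \<in> carrier F2 \<times> UNIV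
    \<Longrightarrow> dist (\<psi> g y0) (\<psi> h y0) \<le> L * dist (\<phi> g x0) (\<phi> h x0) + L"
    using orbit_maps_lipschitz[OF X.F2Z_action_axioms Y.F2Z_action_axioms] by blast
  have dL: "dist y0 (A i) \<le> L * (t i + B) + L" for i
  proof -
    have "dist y0 (A i) \<le> L * dist x0 (\<phi> (v i, n i) x0) + L"
      using L(2)[of "([], 0)" "(v i, n i)"] G X.act_one[OF X.x0] Y.act_one[OF Y.x0] by (simp add: A_def)
    also have "\<dots> \<le> L * (t i + B) + L" using s1[of i] L(1) by simp
    finally show ?thesis .
  qed
  have m_small: "eventually (\<lambda>i. \<bar>of_int (m i)\<bar> \<le> e * t i) sequentially" if e: "e > 0" for e :: real
  proof -
    \<comment> \<open>A slope bound strictly between \<open>\<kappa>\<close> and 1 that absorbs the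
      additive \<open>K\<close> at distances beyond \<open>r1\<close>.\<close>
    define \<kappa>3 where "\<kappa>3 = (1 + \<kappa>) / 2"
    have \<kappa>3: "\<kappa> < \<kappa>3" "\<kappa>3 < 1" using \<kappa> by (auto simp: \<kappa>3_def)
    \<comment> \<open>The tolerated difference of slopes: the first bound leaves half of the gap
      \<open>1 - \<kappa>3\<close>, the second makes the resulting error small against
      \<open>e * t i\<close>.\<close>
    define \<delta> where "\<delta> = min ((1 - \<kappa>3) / 2) (e * l' * (1 - \<kappa>3) / (4 * L))"
    have "\<delta> > 0" using \<kappa>3 e Y.l L(1) by (simp add: \<delta>_def)
    moreover have "\<delta> \<le> (1 - \<kappa>3) / 2" unfolding \<delta>_def by (rule min.cobounded1)
    moreover have "\<delta> \<le> e * l' * (1 - \<kappa>3) / (4 * L)" unfolding \<delta>_def by (rule min.cobounded2)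
    ultimately have \<delta>: "\<delta> > 0" "\<delta> \<le> (1 - \<kappa>3) / 2" "\<delta> \<le> e * l' * (1 - \<kappa>3) / (4 * L)" .
    define q where "q = l' * (1 - \<kappa>3) / 4"
    have q: "q > 0" using Y.l \<kappa>3 by (simp add: q_def)
    have \<delta>L: "\<delta> * L \<le> e * q" using \<delta>(3) L(1) by (simp add: field_simps q_def)
    \<comment> \<open>At radius \<open>r\<close> each height equals \<open>r\<close> times the slope
      up to \<open>C'\<close>, and the two heights differ by at most 1; so the slopes agree up to
      \<open>(2 * C' + 1) / r = \<delta>\<close>.\<close>
    define r where "r = (2 * C' + 1) / \<delta>"
    have r: "r > 0" "r * \<delta> = 2 * C' + 1" using \<delta> Y.C by (auto simp: r_def)
    define r1 where "r1 = K / (\<kappa>3 - \<kappa>) + 1"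
    have r1: "r1 > 0" "K \<le> (\<kappa>3 - \<kappa>) * r1"
      using \<kappa> \<kappa>3 unfolding r1_def distrib_left by (simp_all add: add_nonneg_pos)
    define E where "E = (\<delta> * (L * B + L) + 2 * C') / q"
    have E: "E * q = \<delta> * (L * B + L) + 2 * C'" using q by (simp add: E_def)
    have near_d: "eventually (\<lambda>i. q < dist y0 (A i) \<and> dist (gd Y y0 (A i) q) (d q) < 1/2) sequentially"
      "eventually (\<lambda>i. q < dist y0 (A' i) \<and> dist (gd Y y0 (A' i) q) (d q) < 1/2) sequentially" if "q > 0" for q
      using limset_near_ray[OF \<xi>(1-3) d(1,3) G(1) tlim(1) near(1) that, of "1/2"]
        limset_near_ray[OF \<eta>(1-3) d(1)[unfolded eq] d(3) G(2) tlim(2) near(2) that, of "1/2"]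
      by (auto simp: A_def A'_def)
    have tE: "eventually (\<lambda>i. E / e \<le> t i) sequentially" using tlim(1) by (simp add: filterlim_at_top)
    show ?thesis
      using near_d[OF r(1)] near_d[OF r1(1)] tE
    proof eventually_elim
      case (elim i)
      define D where "D = dist y0 (A i)"
      define D' where "D' = dist y0 (A' i)"
      define \<beta> where "\<beta> = b' (A i) / D"
      define \<beta>' where "\<beta>' = b' (A' i) / D'"
      have D: "D > 0" "D' > 0" "r1 \<le> D" "r1 \<le> D'" using elim r1(1) by (auto simp: D_def D'_def)
      have \<beta>_eq: "\<beta> * D = b' (A i)" "\<beta>' * D' = b' (A' i)" using D by (auto simp: \<beta>_def \<beta>'_def)
      have bound: "\<bar>x / D0\<bar> \<le> \<kappa>3" if "\<bar>x\<bar> \<le> \<kappa> * D0 + K" "r1 \<le> D0" "D0 > 0" for x D0 :: real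
      proof -
        have "K \<le> (\<kappa>3 - \<kappa>) * D0"
          using r1(2) mult_left_mono[OF that(2), of "\<kappa>3 - \<kappa>"] \<kappa>3 by linarith
        then have "\<bar>x\<bar> \<le> \<kappa>3 * D0" using that(1) by (simp add: algebra_simps)
        then show ?thesis using that(3) by (simp add: field_simps abs_if split: if_splits)
      qed
      have \<beta>\<kappa>: "\<bar>\<beta>\<bar> \<le> \<kappa>3" "\<bar>\<beta>'\<bar> \<le> \<kappa>3"
        unfolding \<beta>_def \<beta>'_def using bound slope[of i] D by (auto simp: D_def D'_def)
      have height: "\<bar>b' (gd Y y0 a r) - r * (b' a / D0)\<bar> \<le> C'"
        if "a \<in> Y" "D0 = dist y0 a" "D0 > 0" "r \<le> D0" for a D0
      proof -
        have "D0 * \<bar>b' (gd Y y0 a r) - r * (b' a / D0)\<bar> = \<bar>D0 * (b' (gd Y y0 a r) - r * (b' a / D0))\<bar>"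
          using that(3) by (simp add: abs_mult)
        also have "D0 * (b' (gd Y y0 a r) - r * (b' a / D0)) = D0 * b' (gd Y y0 a r) - r * b' a"
          using that(3) by (simp add: right_diff_distrib)
        also have "\<bar>D0 * b' (gd Y y0 a r) - r * b' a\<bar> \<le> D0 * C'"
          using Y.b_gd[OF that(1), of r] that r by (simp add: mult.commute)
        finally show ?thesis using that(3) by simp
      qed
      have "\<bar>b' (gd Y y0 (A i) r) - b' (gd Y y0 (A' i) r)\<bar> \<le> 1"
        using Y.b_lip[of "gd Y y0 (A i) r" "gd Y y0 (A' i) r"] Y.gd_in Y.x0 AY elim
          dist_triangle2[of "gd Y y0 (A i) r" "gd Y y0 (A' i) r" "d r"] by fastforce
      moreover have "\<bar>b' (gd Y y0 (A i) r) - r * \<beta>\<bar> \<le> C'" "\<bar>b' (gd Y y0 (A' i) r) - r * \<beta>'\<bar> \<le> C'"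
        unfolding \<beta>_def \<beta>'_def using height AY D elim by (auto simp: D_def D'_def)
      ultimately have "\<bar>r * \<beta> - r * \<beta>'\<bar> \<le> r * \<delta>" unfolding r(2) by linarith
      then have "r * \<bar>\<beta> - \<beta>'\<bar> \<le> r * \<delta>" using r(1) by (simp flip: right_diff_distrib add: abs_mult)
      then have \<beta>\<delta>: "\<bar>\<beta> - \<beta>'\<bar> \<le> \<delta>" using r(1) by simp
      define s where "s = of_int (m i) * l'"
      have abs_s: "\<bar>s\<bar> = \<bar>of_int (m i)\<bar> * l'" using Y.l by (simp add: s_def abs_mult)
      have "\<beta>' * D' = \<beta> * D + s"
        using Y.b_shift[OF AY(1), of "m i" i] unfolding \<beta>_eq A' s_def by simp
      moreover have "\<bar>D' - D\<bar> \<le> \<bar>s\<bar> + C'"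
        using AA'[of i] dist_triangle[of y0 "A' i" "A i"] dist_triangle2[of y0 "A i" "A' i"]
        unfolding abs_s D_def D'_def by (simp add: abs_le_iff)
      ultimately have gap: "\<bar>s\<bar> * (1 - \<kappa>3 - \<delta>) \<le> \<delta> * D + (1 + \<delta>) * C'"
        by (rule slope_gap[OF less_imp_le[OF D(1)] less_imp_le[OF D(2)] \<beta>\<kappa> \<kappa>3(2) \<beta>\<delta> Y.C])
      have "\<bar>s\<bar> * ((1 - \<kappa>3) / 2) \<le> \<bar>s\<bar> * (1 - \<kappa>3 - \<delta>)" using \<delta>(2) by (intro mult_left_mono) auto
      moreover have "\<delta> * D \<le> \<delta> * (L * (t i + B) + L)" using dL[of i] \<delta>(1) by (simp add: D_def)
      moreover have "(1 + \<delta>) * C' \<le> 2 * C'" using \<delta> \<kappa>3 \<kappa> Y.C by (intro mult_right_mono) auto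
      ultimately have "\<bar>s\<bar> * ((1 - \<kappa>3) / 2) \<le> \<delta> * (L * (t i + B) + L) + 2 * C'" using gap by linarith
      also have "\<dots> = \<delta> * L * t i + (\<delta> * (L * B + L) + 2 * C')" by (simp add: algebra_simps)
      also have "\<dots> \<le> e * q * t i + E * q"
        unfolding E using \<delta>L t(1)[of i] by (intro add_right_mono mult_right_mono)
      also have "\<dots> = (e * t i + E) * q" by (simp add: algebra_simps)
      also have "\<dots> \<le> (2 * (e * t i)) * q"
        using elim(5) e q by (intro mult_right_mono) (auto simp: field_simps)
      also have "\<dots> = e * t i * l' * ((1 - \<kappa>3) / 2)" by (simp add: q_def)
      finally have "\<bar>s\<bar> * ((1 - \<kappa>3) / 2) \<le> e * t i * l' * ((1 - \<kappa>3) / 2)" .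
      then have "\<bar>s\<bar> \<le> e * t i * l'" by (rule mult_right_le_imp_le) (use \<kappa>3 in simp)
      then show ?case unfolding abs_s using Y.l by simp
    qed
  qed
  \<comment> \<open>The rays have to be compared at one time; replacing \<open>t' i\<close> by
    \<open>t i\<close> costs at most the distance already estimated, whence the factor 2.\<close>
  have close: "dist (c (t i)) (c' (t i)) \<le> 2 * (2 * B + C) + 2 * l * \<bar>of_int (m i)\<bar>" for i
  proof -
    have "\<phi> (v i, n' i) x0 = \<phi> ([], m i) (\<phi> (v i, n i) x0)"
      using X.act_central(1)[OF v(1) X.x0, of "m i" i "n i"] by (simp add: m_def)
    then have "dist (\<phi> (v i, n i) x0) (\<phi> (v i, n' i) x0) \<le> \<bar>of_int (m i)\<bar> * l + C"
      using X.displacement_invariant[OF v(1) X.x0, of i "n i" "m i"] X.orbit_z[of "m i"] by simp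
    then have 1: "dist (c (t i)) (c' (t' i)) \<le> 2 * B + C + l * \<bar>of_int (m i)\<bar>"
      using near[of i] dist_triangle[of "c (t i)" "c' (t' i)" "\<phi> (v i, n i) x0"]
        dist_triangle2[of "\<phi> (v i, n i) x0" "c' (t' i)" "\<phi> (v i, n' i) x0"]
      by (simp add: mult.commute)
    have "\<bar>t' i - t i\<bar> \<le> dist (c (t i)) (c' (t' i))"
      using dist_triangle[of x0 "c' (t' i)" "c (t i)"] dist_triangle2[of x0 "c (t i)" "c' (t' i)"]
      by (simp add: dc abs_le_iff)
    moreover have "dist (c' (t' i)) (c' (t i)) = \<bar>t' i - t i\<bar>" using X.ray_dist[OF ray(2)] t by simp
    ultimately have "dist (c (t i)) (c' (t i)) \<le> 2 * dist (c (t i)) (c' (t' i))"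
      using dist_triangle[of "c (t i)" "c' (t i)" "c' (t' i)"] by linarith
    also have "\<dots> \<le> 2 * (2 * B + C + l * \<bar>of_int (m i)\<bar>)" using 1 by simp
    finally show ?thesis by (simp add: algebra_simps)
  qed
  have same: "c q = c' q" if q: "q \<ge> 0" for q
  proof (rule X.ray_eq_sublinear[OF ray _ _ q])
    show "c 0 = c' 0" using \<xi> \<eta> by simp
    fix e T0 :: real assume e: "e > 0"
    have "eventually (\<lambda>i. \<bar>of_int (m i)\<bar> \<le> e / (4 * l) * t i) sequentially"
      by (rule m_small) (use e X.l in simp)
    moreover have "eventually (\<lambda>i. max T0 (4 * (2 * B + C) / e) \<le> t i) sequentially"
      using tlim(1) unfolding filterlim_at_top by blast
    ultimately obtain i where i: "\<bar>of_int (m i)\<bar> \<le> e / (4 * l) * t i" "max T0 (4 * (2 * B + C) / e) \<le> t i"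
      using eventually_happens'[OF sequentially_bot eventually_conj] by blast
    have "2 * l * \<bar>of_int (m i)\<bar> \<le> 2 * l * (e / (4 * l) * t i)" using i(1) X.l by (intro mult_left_mono) auto
    also have "\<dots> = e * t i / 2" using X.l by simp
    finally have "dist (c (t i)) (c' (t i)) \<le> e * t i"
      using close[of i] i(2) e by (simp add: field_simps)
    then show "\<exists>T\<ge>T0. dist (c T) (c' T) \<le> e * T" using i(2) by auto
  qed
  show ?thesis by (rule X.boundary_eqI[OF \<xi>(1) \<eta>(1) \<xi>(2) \<eta>(2), of 0]) (simp add: same)
qed

text \<open>The type of a preimage can be read off from its image, since polarity with its sign and
  nonpolarity exclude each other in \<open>Y\<close>. Only points of equal type remain to be
  compared.\<close>

lemma limset_injective: "inj_on f (visual_boundary X)"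
proof (rule inj_onI)
  fix \<xi> \<eta> assume \<xi>: "\<xi> \<in> visual_boundary X" and \<eta>: "\<eta> \<in> visual_boundary X" and eq: "f \<xi> = f \<eta>"
  obtain c where c: "c \<in> \<xi>" "geodesic_ray X c" "c 0 = x0" using X.boundary_ray_exists[OF X.x0 \<xi>] .
  obtain c' where c': "c' \<in> \<eta>" "geodesic_ray X c'" "c' 0 = x0" using X.boundary_ray_exists[OF X.x0 \<eta>] .
  obtain d where d: "d \<in> f \<xi>" "geodesic_ray Y d" "d 0 = y0"
    using Y.boundary_ray_exists[OF Y.x0 f_boundary[OF \<xi>]] .
  have d': "d \<in> f \<eta>" using d eq by simp
  note pol = polar_image[OF \<xi> c(1,3) d(1,3)] polar_image[OF \<eta> c'(1,3) d' d(3)]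
  note npol = nonpolar_image[OF \<xi> c(1,3) d(1,3)] nonpolar_image[OF \<eta> c'(1,3) d' d(3)]
  show "\<xi> = \<eta>"
  proof (cases "Y.nonpolar d")
    case True
    then have "X.nonpolar c" "X.nonpolar c'"
      using X.polar_or_nonpolar[OF c(2,3)] X.polar_or_nonpolar[OF c'(2,3)] pol Y.polar_not_nonpolar by blast+
    then show ?thesis using nonpolar_injective[OF \<xi> c(1,3) _ \<eta> c'(1,3) _ eq] by blast
  next
    case False
    then obtain s s' where s: "s \<in> {1, -1}" "X.polar s c" and s': "s' \<in> {1, -1}" "X.polar s' c'"
      using X.polar_or_nonpolar[OF c(2,3)] X.polar_or_nonpolar[OF c'(2,3)] npol by blast
    have "Y.polar s d" "Y.polar s' d" using pol s s' by blast+
    then have "s = s'" using s(1) s'(1) Y.polar_opposite by auto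
    then have "c r = c' r" if "r \<ge> 0" for r
      using X.polar_unique[OF c(2,3) c'(2,3) s(1) s(2)] s'(2) that by blast
    then show ?thesis by (intro X.boundary_eqI[OF \<xi> \<eta> c(1) c'(1), of 0]) simp
  qed
qed

lemma limset_surjective: "f ` visual_boundary X = visual_boundary Y"
proof (intro equalityI subsetI)
  fix \<zeta> assume \<zeta>: "\<zeta> \<in> visual_boundary Y"
  obtain d where d: "d \<in> \<zeta>" "geodesic_ray Y d" "d 0 = y0" using Y.boundary_ray_exists[OF Y.x0 \<zeta>] .
  obtain R g where g: "\<And>k. g k \<in> carrier F2 \<times> UNIV" "\<And>k. dist (d (real k)) (\<psi> (g k) y0) \<le> R"
    using Y.ray_near_orbit d(2) by metis
  have gX: "\<phi> (g k) x0 \<in> X" and gY: "\<psi> (g k) y0 \<in> Y" for k using X.orbit_in Y.orbit_in g by blast+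
  obtain L where L: "L > 0" "\<And>g h. g \<in> carrier F2 \<times> UNIV \<Longrightarrow> h \<in> carrier F2 \<times> UNIV
    \<Longrightarrow> dist (\<psi> g y0) (\<psi> h y0) \<le> L * dist (\<phi> g x0) (\<phi> h x0) + L"
    using orbit_maps_lipschitz[OF X.F2Z_action_axioms Y.F2Z_action_axioms] by blast
  \<comment> \<open>The orbit map to \<open>Y\<close> is coarsely Lipschitz, so divergence in
    \<open>Y\<close> forces divergence in \<open>X\<close>.\<close>
  have far: "filterlim (\<lambda>k. dist x0 (\<phi> (g k) x0)) at_top sequentially"
    unfolding filterlim_at_top
  proof
    fix T
    have "eventually (\<lambda>k. L * T + L \<le> dist y0 (\<psi> (g k) y0)) sequentially"
      using Y.near_ray_tendsto(1)[OF d(2,3) gY filterlim_real_sequentially g(2)] unfolding filterlim_at_top by blast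
    then show "eventually (\<lambda>k. T \<le> dist x0 (\<phi> (g k) x0)) sequentially"
    proof eventually_elim
      case (elim k)
      then have "L * T \<le> L * dist x0 (\<phi> (g k) x0)"
        using L(2)[of "([], 0)" "g k"] g(1)[of k] X.act_one[OF X.x0] Y.act_one[OF Y.x0] by simp
      then show ?case using L(1) by simp
    qed
  qed
  obtain c F where c: "geodesic_ray X c" "c 0 = x0" and F: "F \<noteq> bot" "F \<le> sequentially"
    and lim: "\<And>r. ((\<lambda>k. gd X x0 (\<phi> (g k) x0) r) \<longlongrightarrow> c r) F"
    using X.cluster_ray[OF X.x0 gX far] by blast
  define \<xi> where "\<xi> = asymptotic_rel X `` {c}"
  have \<xi>: "\<xi> \<in> visual_boundary X" "c \<in> \<xi>"
    using X.ray_class_in[OF c(1)] X.ray_in_class[OF c(1)] by (simp_all add: \<xi>_def)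
  obtain e where e: "e \<in> f \<xi>" "geodesic_ray Y e" "e 0 = y0"
    using Y.boundary_ray_exists[OF Y.x0 f_boundary[OF \<xi>(1)]] .
  have farF: "filterlim (\<lambda>k. dist x0 (\<phi> (g k) x0)) at_top F"
    using far F(2) by (rule filterlim_mono[OF _ order_refl])
  have "e r = d r" if r: "r \<ge> 0" for r
  proof (cases "r = 0")
    case False
    then have r: "r > 0" using r by simp
    have 1: "((\<lambda>k. gd Y y0 (\<psi> (g k) y0) r) \<longlongrightarrow> e r) F"
      by (rule limset_tendsto(1)[OF g(1) \<xi> c(2) farF lim e(1,3) r])
    have "((\<lambda>k. gd Y y0 (\<psi> (g k) y0) r) \<longlongrightarrow> d r) sequentially"
      by (rule Y.near_ray_tendsto(2)[OF d(2,3) gY filterlim_real_sequentially g(2) r])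
    \<comment> \<open>In \<open>Y\<close> the whole sequence converges to \<open>d\<close>, hence
      also along the finer filter on which \<open>X\<close> provides a limit.\<close>
    then have "((\<lambda>k. gd Y y0 (\<psi> (g k) y0) r) \<longlongrightarrow> d r) F"
      using F(2) by (rule tendsto_mono[rotated])
    then show ?thesis using 1 F(1) tendsto_unique by blast
  qed (use d e in simp)
  then have "f \<xi> = \<zeta>"
    by (intro Y.boundary_eqI[OF f_boundary[OF \<xi>(1)] \<zeta> e(1) d(1), of 0]) simp
  then show "\<zeta> \<in> f ` visual_boundary X" using \<xi>(1) by blast
qed (use f_boundary in blast)

end

theorem theorem3:
  fixes X :: "'a::metric_space set" and Y :: "'b::metric_space set"
    and \<phi> :: "(nat \<times> bool) list \<times> int \<Rightarrow> 'a \<Rightarrow> 'a"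
    and \<psi> :: "(nat \<times> bool) list \<times> int \<Rightarrow> 'b \<Rightarrow> 'b"
    and f :: "(real \<Rightarrow> 'a) set \<Rightarrow> (real \<Rightarrow> 'b) set"
  defines "G \<equiv> F2 \<times>\<times> integer_group"
  assumes "CAT0_space X" and "proper_space X" and "x0 \<in> X" and "geometric_action G X \<phi>"
    and "CAT0_space Y" and "proper_space Y" and "y0 \<in> Y" and "geometric_action G Y \<psi>"
    and "limset_map G X \<phi> x0 Y \<psi> y0 f"
  shows "homeomorphic_map (boundary_topology X x0) (boundary_topology Y y0) f"
proof -
  interpret X: F2Z_action X \<phi> x0
    using assms by unfold_locales auto
  interpret Y: F2Z_action Y \<psi> y0
    using assms by unfold_locales auto
  obtain b l C where "height_action X \<phi> x0 b l C" using X.height_exists .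
  then interpret HX: height_action X \<phi> x0 b l C .
  obtain b' l' C' where "height_action Y \<psi> y0 b' l' C'" using Y.height_exists .
  then interpret HY: height_action Y \<psi> y0 b' l' C' .
  interpret limset_pair X \<phi> x0 b l C Y \<psi> y0 b' l' C' f
    using assms by unfold_locales auto
  show ?thesis
  proof (rule continuous_imp_homeomorphic_map)
    show "compact_space (boundary_topology X x0)" using X.compact_boundary X.x0 .
    show "Hausdorff_space (boundary_topology Y y0)" using Y.Hausdorff_boundary Y.x0 .
    show "continuous_map (boundary_topology X x0) (boundary_topology Y y0) f"
      by (rule limset_map_continuous[OF X.cat0_axioms Y.cat0_axioms X.x0 Y.x0 _ f])
        (use X.orbit_in in auto)
    show "f ` topspace (boundary_topology X x0) = topspace (boundary_topology Y y0)"
      unfolding X.topspace_boundary[OF X.x0] Y.topspace_boundary[OF Y.x0] by (rule limset_surjective)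
    show "inj_on f (topspace (boundary_topology X x0))"
      unfolding X.topspace_boundary[OF X.x0] by (rule limset_injective)
  qed
qed

end
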